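(* $\mathsf{OG\mapsto\epsilon}\equiv_{\mathsf{W}}\mathsf{WF}$, where $\mathsf{OG\mapsto\epsilon}$ is the problem which, given a countable ordered group $(G,\leq)$, outputs the bit $\epsilon\in\{0,1\}$ such that the order type of $G$ is $\mathbb{Z}^{\alpha}\mathbb{Q}^{\epsilon}$ for some ordinal $\alpha$.
   Context: Weihrauch reducibility: a represented space is a set $X$ with a partial surjection $\delta_X:\subseteq\mathbb{N}^{\mathbb{N}}\to X$; if $\delta_X(p)=x$, $p$ is a name of $x$. A problem is a partial multi-valued function between represented spaces. $f\leq_{\mathsf{W}}g$ iff there are computable partial functions $\Phi,\Psi$ on Baire space such that whenever $p$ is a name of some $x\in\mathrm{dom}(f)$, $\Phi(p)$ is a name of some $z\in\mathrm{dom}(g)$, and for every name $q$ of an element of $g(z)$, $\Psi(p,q)$ is a name of an element of $f(x)$. $f\equiv_{\mathsf{W}}g$ means $f\leq_{\mathsf{W}}g$ and $g\leq_{\mathsf{W}}f$. Ordered groups: an ordered group is a group $G$ with a linear order $\leq$ such that $a\leq b$ implies $ag\leq bg$ and $ga\leq gb$ for all $g$. Countable ordered groups are presented on subsets of $\mathbb{N}$, a name coding the universe, operation and order. The order type of $G$ is a linear order $X$ such that there is an order-preserving bijection $G\to X$. For linear orders $X,Y$, the product $XY$ is $X\times Y$ with $\langle x_0,y_0\rangle<\langle x_1,y_1\rangle$ iff $y_0<y_1$, or $y_0=y_1$ and $x_0<x_1$. $\mathbb{Z}^X$ is the set of finitely supported functions $X\to\mathbb{Z}$, where for $f\neq g$,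 $f<g$ iff $f(x)<g(x)$ at the maximum $x$ where they differ. $\mathbb{Z}^\alpha\mathbb{Q}^0=\mathbb{Z}^\alpha$ and $\mathbb{Z}^\alpha\mathbb{Q}^1=\mathbb{Z}^\alpha\mathbb{Q}$. By Maltsev's theorem every countable ordered group has order type $\mathbb{Z}^\alpha\mathbb{Q}^\epsilon$ for some ordinal $\alpha$ and $\epsilon\in\{0,1\}$. $\mathsf{WF}$: given a tree $T\subseteq\mathbb{N}^{<\mathbb{N}}$ (nonempty, closed under initial segments), output $0$ if $T$ is well-founded (no infinite path) and $1$ otherwise. *)

theory Defs
  imports
    Complex_Main
    "HOL-Library.Nat_Bijection"
    "HOL-Library.Sublist"
    "HOL-Algebra.Group"
begin

section \<open>Computability on Baire space\<close>

type_synonym baire = "nat \<Rightarrow> nat"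

text \<open>Kleene's partial recursive functions on tuples of naturals, with one oracle in
  \<^typ>\<open>baire\<close> as an additional initial function.\<close>

datatype prog =
    ZeroP
  | SuccP
  | ProjP nat
  | OracleP
  | CompP prog "prog list"
  | PrimRecP prog prog
  | MuP prog

text \<open>\<open>None\<close> means divergence (or a missing argument). Composition is strict,
  and unbounded search requires all earlier values to be defined.\<close>

primrec run :: "prog \<Rightarrow> baire \<Rightarrow> nat list \<Rightarrow> nat option" where
  "run ZeroP p xs = Some 0"
| "run SuccP p xs = (case xs of [] \<Rightarrow> None | x # _ \<Rightarrow> Some (Suc x))"
| "run (ProjP i) p xs = (if i < length xs then Some (xs ! i) else None)"
| "run OracleP p xs = (case xs of [] \<Rightarrow> None | x # _ \<Rightarrow> Some (p x))"
| "run (CompP f gs) p xs =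
     Option.bind (those (map (\<lambda>h. h p xs) (map run gs))) (run f p)"
| "run (PrimRecP f g) p xs =
     (case xs of [] \<Rightarrow> None
      | n # ys \<Rightarrow> rec_nat (run f p ys)
                   (\<lambda>m r. Option.bind r (\<lambda>v. run g p (m # v # ys))) n)"
| "run (MuP f) p xs =
     (if \<exists>n. run f p (n # xs) = Some 0 \<and> (\<forall>m<n. run f p (m # xs) \<noteq> None)
      then Some (LEAST n. run f p (n # xs) = Some 0)
      else None)"

text \<open>A partial function on Baire space is computable if one program computes the value
  digit by digit from every point of the domain. As usual, nothing is
  required of the program outside the domain.\<close>

definition computable :: "(baire \<rightharpoonup> baire) \<Rightarrow> bool" where
  "computable \<Phi> \<longleftrightarrow>
     (\<exists>e. \<forall>p q. \<Phi> p = Some q \<longrightarrow> (\<forall>n. run e p [n] = Some (q n)))"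

definition baire_pair :: "baire \<Rightarrow> baire \<Rightarrow> baire" where
  "baire_pair p q = (\<lambda>n. if even n then p (n div 2) else q (n div 2))"


section \<open>Problems and Weihrauch reducibility\<close>

text \<open>A represented space is given by its representation, a partial map on Baire space;
  the underlying set is its range. A partial multi-valued function is a partial function
  into sets of solutions.\<close>

type_synonym 'a representation = "baire \<rightharpoonup> 'a"

record ('a, 'b) problem =
  inrep :: "'a representation"
  outrep :: "'b representation"
  mvf :: "'a \<rightharpoonup> 'b set"

definition weihrauch_le :: "('a, 'b) problem \<Rightarrow> ('c, 'd) problem \<Rightarrow> bool"
    (infix "\<le>\<^sub>W" 50) where
  "f \<le>\<^sub>W g \<longleftrightarrow>
     (\<exists>\<Phi> \<Psi>. computable \<Phi> \<and> computable \<Psi> \<and>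
       (\<forall>p x Y. inrep f p = Some x \<and> mvf f x = Some Y \<longrightarrow>
         (\<exists>p' z V. \<Phi> p = Some p' \<and> inrep g p' = Some z \<and> mvf g z = Some V \<and>
           (\<forall>q v. outrep g q = Some v \<and> v \<in> V \<longrightarrow>
             (\<exists>q' y. \<Psi> (baire_pair p q) = Some q' \<and> outrep f q' = Some y \<and> y \<in> Y)))))"

definition weihrauch_equiv :: "('a, 'b) problem \<Rightarrow> ('c, 'd) problem \<Rightarrow> bool"
    (infix "\<equiv>\<^sub>W" 50) where
  "f \<equiv>\<^sub>W g \<longleftrightarrow> f \<le>\<^sub>W g \<and> g \<le>\<^sub>W f"

text \<open>The space \<open>{0, 1}\<close>; a name carries the bit in its first digit.\<close>

definition bit_rep :: "nat representation" where
  "bit_rep p = (if p 0 \<in> {0, 1} then Some (p 0) else None)"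


section \<open>Well-foundedness of trees\<close>

definition tree :: "nat list set \<Rightarrow> bool" where
  "tree T \<longleftrightarrow> T \<noteq> {} \<and> (\<forall>\<sigma>\<in>T. \<forall>\<tau>. prefix \<tau> \<sigma> \<longrightarrow> \<tau> \<in> T)"

definition well_founded_tree :: "nat list set \<Rightarrow> bool" where
  "well_founded_tree T \<longleftrightarrow> \<not> (\<exists>h :: baire. \<forall>n. map h [0..<n] \<in> T)"

text \<open>Sets of naturals are coded throughout by the places where a name is nonzero.\<close>

definition tree_rep :: "nat list set representation" where
  "tree_rep p =
     (let T = {\<sigma>. p (list_encode \<sigma>) \<noteq> 0} in if tree T then Some T else None)"

definition WF :: "(nat list set, nat) problem" where
  "WF = \<lparr> inrep = tree_rep, outrep = bit_rep,
          mvf = (\<lambda>T. if tree T then Some {if well_founded_tree T then 0 else 1}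
                     else None) \<rparr>"


section \<open>Linear orders\<close>

text \<open>Linear orders are reflexive relations on their \<^const>\<open>Field\<close>.\<close>

definition order_isomorphic :: "'a rel \<Rightarrow> 'b rel \<Rightarrow> bool" where
  "order_isomorphic r s \<longleftrightarrow>
     (\<exists>f. bij_betw f (Field r) (Field s) \<and>
          (\<forall>a\<in>Field r. \<forall>b\<in>Field r. (a, b) \<in> r \<longleftrightarrow> (f a, f b) \<in> s))"

definition order_prod :: "'a rel \<Rightarrow> 'b rel \<Rightarrow> ('a \<times> 'b) rel" where
  "order_prod r s =
     {((x0, y0), (x1, y1)) | x0 y0 x1 y1.
        x0 \<in> Field r \<and> x1 \<in> Field r \<and> y0 \<in> Field s \<and> y1 \<in> Field s \<and>
        ((y0, y1) \<in> s \<and> y0 \<noteq> y1 \<or> y0 = y1 \<and> (x0, x1) \<in> r)}"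

text \<open>Functions on \<open>Field r\<close> are extended by \<open>0\<close>.\<close>

definition fin_supp :: "'a rel \<Rightarrow> ('a \<Rightarrow> int) set" where
  "fin_supp r = {f. finite {x. f x \<noteq> 0} \<and> {x. f x \<noteq> 0} \<subseteq> Field r}"

definition Z_pow :: "'a rel \<Rightarrow> ('a \<Rightarrow> int) rel" where
  "Z_pow r =
     {(f, g). f \<in> fin_supp r \<and> g \<in> fin_supp r \<and>
        (f = g \<or> (\<exists>x. f x < g x \<and> (\<forall>y. f y \<noteq> g y \<longrightarrow> (y, x) \<in> r)))}"

definition Q_order :: "rat rel" where
  "Q_order = {(a, b). a \<le> b}"

text \<open>Two cases, because \<open>\<int>\<^sup>\<alpha>\<close> and \<open>\<int>\<^sup>\<alpha>\<rat>\<close> live on different types.\<close>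

definition has_order_type_ZQ :: "'a rel \<Rightarrow> 'b rel \<Rightarrow> nat \<Rightarrow> bool" where
  "has_order_type_ZQ r \<alpha> \<epsilon> \<longleftrightarrow>
     \<epsilon> = 0 \<and> order_isomorphic r (Z_pow \<alpha>) \<or>
     \<epsilon> = 1 \<and> order_isomorphic r (order_prod (Z_pow \<alpha>) Q_order)"


section \<open>Ordered groups\<close>

definition ordered_group :: "'a monoid \<Rightarrow> 'a rel \<Rightarrow> bool" where
  "ordered_group G r \<longleftrightarrow>
     group G \<and> linear_order_on (carrier G) r \<and>
     (\<forall>a\<in>carrier G. \<forall>b\<in>carrier G. \<forall>g\<in>carrier G. (a, b) \<in> r \<longrightarrow>
        (a \<otimes>\<^bsub>G\<^esub> g, b \<otimes>\<^bsub>G\<^esub> g) \<in> r \<and> (g \<otimes>\<^bsub>G\<^esub> a, g \<otimes>\<^bsub>G\<^esub> b) \<in> r)"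

text \<open>A name joins three parts, at the positions congruent to 0, 1, 2 modulo 3: the
  universe, the operation and the order. Only values at elements of the universe matter;
  the identity is determined by the operation.\<close>

definition coded_universe :: "baire \<Rightarrow> nat set" where
  "coded_universe p = {a. p (3 * a) \<noteq> 0}"

definition coded_mult :: "baire \<Rightarrow> nat \<Rightarrow> nat \<Rightarrow> nat" where
  "coded_mult p a b =
     (if a \<in> coded_universe p \<and> b \<in> coded_universe p
      then p (3 * prod_encode (a, b) + 1) else undefined)"

definition coded_group :: "baire \<Rightarrow> nat monoid" where
  "coded_group p =
     \<lparr> carrier = coded_universe p,
       mult = coded_mult p,
       one = (THE e. e \<in> coded_universe p \<and>
                (\<forall>a\<in>coded_universe p. coded_mult p e a = a \<and> coded_mult p a e = a)) \<rparr>"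

definition coded_order :: "baire \<Rightarrow> nat rel" where
  "coded_order p =
     {(a, b). a \<in> coded_universe p \<and> b \<in> coded_universe p \<and>
              p (3 * prod_encode (a, b) + 2) \<noteq> 0}"

definition og_rep :: "(nat monoid \<times> nat rel) representation" where
  "og_rep p =
     (if ordered_group (coded_group p) (coded_order p)
      then Some (coded_group p, coded_order p) else None)"

text \<open>Ordinals are well-orders on subsets of \<open>nat\<close>. This includes \<open>0\<close> (the empty relation)
  and loses nothing: \<open>\<int>\<^sup>\<alpha>\<close> is uncountable for uncountable \<open>\<alpha>\<close>, hence so is \<open>\<int>\<^sup>\<alpha>\<rat>\<close>. The
  problem is defined on every ordered group, so that the existence of \<open>\<epsilon>\<close> (Maltsev) is not
  built into the domain.\<close>

definition OG_eps :: "(nat monoid \<times> nat rel, nat) problem" where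
  "OG_eps = \<lparr> inrep = og_rep, outrep = bit_rep,
     mvf = (\<lambda>(G, r). if ordered_group G r
              then Some {\<epsilon>. \<exists>\<alpha> :: nat rel. Well_order \<alpha> \<and> has_order_type_ZQ r \<alpha> \<epsilon>}
              else None) \<rparr>"

end

theory Submission
  imports Defs "HOL-Library.Countable_Set" "HOL-Algebra.Generated_Groups"
begin

text \<open>
  The bit is read off from the existence of a dense suborder, that is, of a copy of the
  rationals. The elements \<open>g\<close> for which the interval between \<open>1\<close> and \<open>g\<close> contains no dense set
  form a convex subgroup \<open>H\<close>, which is itself scattered. The quotient of a scattered convex
  subgroup by a proper convex subgroup \<open>K\<close> has a least positive coset, since coset
  representatives would otherwise form a dense set. It follows that the proper convex subgroups
  of \<open>H\<close> are well-ordered by inclusion, and division with remainder by representatives of the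
  least positive cosets expands each element of \<open>H\<close> as a product of powers of these, so that
  \<open>H\<close> has order type \<open>\<int>\<^sup>\<alpha>\<close>. Either \<open>H\<close> is the whole group, or its cosets are densely ordered without
  endpoints, like \<open>\<rat>\<close>. Hence \<open>\<epsilon> = 1\<close> iff the tree of finite attempts at enumerating a dense subset has an
  infinite path.

  Conversely, a tree \<open>T\<close> is sent to the lexicographically ordered group of finitely supported
  functions from \<open>T\<close>, under the Kleene--Brouwer order, to \<open>\<int>\<close>. If \<open>T\<close> is well-founded, this order is a
  well-order, and a dense set is impossible: take two of its elements whose largest difference
  is at the least possible place \<open>m\<close>; all elements in between then differ at \<open>m\<close>, where only
  finitely many values are available. If \<open>T\<close> has an infinite path, then the functions supported on
  the path are dense, because any of them can be increased slightly further along the path.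
\<close>

section \<open>Total computable functionals and decidable predicates\<close>

text \<open>The group need not be commutative, and convex subgroups need not be normal. Quotients
  are therefore ordered sets of left cosets, and powers are always divided off on the left;
  convexity makes the order on the left cosets well defined.

  The two reductions face different obligations. From groups to trees, the computed bit must be
  shown to be a solution, so an order type has to be produced. From trees to groups, every solution
  must agree with the tree, although the well-order \<alpha> that witnesses it has no relation to
  the tree. What is compared there is an isomorphism invariant: \<open>Z_pow \<alpha>\<close> has no
  dense subset for a well-order \<alpha>, while its product with the rationals always has one.

  Both reductions return the bit unchanged, so all computation lies in the forward functionals.
  These are total on Baire space, and codes are chosen so that every test is a bounded quantifier
  over numbers; that a number bounds the positions used by the list it codes is what supplies the
  bounds.\<close>

definition comp_fun :: "(baire \<Rightarrow> nat \<Rightarrow> nat) \<Rightarrow> bool" where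
  "comp_fun F \<longleftrightarrow> (\<exists>e. \<forall>p n. run e p [n] = Some (F p n))"

definition comp_fun2 :: "(baire \<Rightarrow> nat \<Rightarrow> nat \<Rightarrow> nat) \<Rightarrow> bool" where
  "comp_fun2 F \<longleftrightarrow> (\<exists>e. \<forall>p m n. run e p [m, n] = Some (F p m n))"

text \<open>Arity three serves the step of a primitive recursion, which receives the counter, the
  value so far and one parameter, in this order. Further parameters are packed by pairing.\<close>

definition comp_fun3 :: "(baire \<Rightarrow> nat \<Rightarrow> nat \<Rightarrow> nat \<Rightarrow> nat) \<Rightarrow> bool" where
  "comp_fun3 F \<longleftrightarrow> (\<exists>e. \<forall>p l m n. run e p [l, m, n] = Some (F p l m n))"

lemma comp_fun_comp:
  assumes "comp_fun F" "comp_fun a" shows "comp_fun (\<lambda>p n. F p (a p n))"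
proof -
  obtain e where e: "\<And>p n. run e p [n] = Some (F p n)" using assms by (auto simp: comp_fun_def)
  obtain d where d: "\<And>p n. run d p [n] = Some (a p n)" using assms by (auto simp: comp_fun_def)
  have "\<forall>p n. run (CompP e [d]) p [n] = Some (F p (a p n))" by (simp add: e d)
  then show ?thesis unfolding comp_fun_def by blast
qed

lemma comp_fun_comp2:
  assumes "comp_fun2 F" "comp_fun a" "comp_fun b" shows "comp_fun (\<lambda>p n. F p (a p n) (b p n))"
proof -
  obtain e where e: "\<And>p m n. run e p [m, n] = Some (F p m n)" using assms by (auto simp: comp_fun2_def)
  obtain d where d: "\<And>p n. run d p [n] = Some (a p n)" using assms by (auto simp: comp_fun_def)
  obtain c where c: "\<And>p n. run c p [n] = Some (b p n)" using assms by (auto simp: comp_fun_def)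
  have "\<forall>p n. run (CompP e [d, c]) p [n] = Some (F p (a p n) (b p n))" by (simp add: e d c)
  then show ?thesis unfolding comp_fun_def by blast
qed

lemma comp_fun2_comp:
  assumes "comp_fun F" "comp_fun2 a" shows "comp_fun2 (\<lambda>p m n. F p (a p m n))"
proof -
  obtain e where e: "\<And>p n. run e p [n] = Some (F p n)" using assms by (auto simp: comp_fun_def)
  obtain d where d: "\<And>p m n. run d p [m, n] = Some (a p m n)" using assms by (auto simp: comp_fun2_def)
  have "\<forall>p m n. run (CompP e [d]) p [m, n] = Some (F p (a p m n))" by (simp add: e d)
  then show ?thesis unfolding comp_fun2_def by blast
qed

lemma comp_fun2_comp2:
  assumes "comp_fun2 F" "comp_fun2 a" "comp_fun2 b" shows "comp_fun2 (\<lambda>p m n. F p (a p m n) (b p m n))"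
proof -
  obtain e where e: "\<And>p m n. run e p [m, n] = Some (F p m n)" using assms by (auto simp: comp_fun2_def)
  obtain d where d: "\<And>p m n. run d p [m, n] = Some (a p m n)" using assms by (auto simp: comp_fun2_def)
  obtain c where c: "\<And>p m n. run c p [m, n] = Some (b p m n)" using assms by (auto simp: comp_fun2_def)
  have "\<forall>p m n. run (CompP e [d, c]) p [m, n] = Some (F p (a p m n) (b p m n))" by (simp add: e d c)
  then show ?thesis unfolding comp_fun2_def by blast
qed

lemma comp_fun3_comp:
  assumes "comp_fun F" "comp_fun3 a" shows "comp_fun3 (\<lambda>p l m n. F p (a p l m n))"
proof -
  obtain e where e: "\<And>p n. run e p [n] = Some (F p n)" using assms by (auto simp: comp_fun_def)
  obtain d where d: "\<And>p l m n. run d p [l, m, n] = Some (a p l m n)"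
    using assms by (auto simp: comp_fun3_def)
  have "\<forall>p l m n. run (CompP e [d]) p [l, m, n] = Some (F p (a p l m n))" by (simp add: e d)
  then show ?thesis unfolding comp_fun3_def by blast
qed

lemma comp_fun3_comp2:
  assumes "comp_fun2 F" "comp_fun3 a" "comp_fun3 b" shows "comp_fun3 (\<lambda>p l m n. F p (a p l m n) (b p l m n))"
proof -
  obtain e where e: "\<And>p m n. run e p [m, n] = Some (F p m n)" using assms by (auto simp: comp_fun2_def)
  obtain d where d: "\<And>p l m n. run d p [l, m, n] = Some (a p l m n)" using assms by (auto simp: comp_fun3_def)
  obtain c where c: "\<And>p l m n. run c p [l, m, n] = Some (b p l m n)" using assms by (auto simp: comp_fun3_def)
  have "\<forall>p l m n. run (CompP e [d, c]) p [l, m, n] = Some (F p (a p l m n) (b p l m n))"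
    by (simp add: e d c)
  then show ?thesis unfolding comp_fun3_def by blast
qed

lemma comp_fun_arg: "comp_fun (\<lambda>p n. n)"
  unfolding comp_fun_def by (rule exI[of _ "ProjP 0"]) simp

lemma comp_fun2_arg: "comp_fun2 (\<lambda>p m n. m)" "comp_fun2 (\<lambda>p m n. n)"
  unfolding comp_fun2_def by (rule exI[of _ "ProjP 0"], simp) (rule exI[of _ "ProjP 1"], simp)

lemma comp_fun3_arg: "comp_fun3 (\<lambda>p l m n. l)" "comp_fun3 (\<lambda>p l m n. m)" "comp_fun3 (\<lambda>p l m n. n)"
  unfolding comp_fun3_def
  by (rule exI[of _ "ProjP 0"], simp) (rule exI[of _ "ProjP 1"], simp, rule exI[of _ "ProjP 2"], simp)

lemma comp_fun_oracle: "comp_fun (\<lambda>p n. p n)"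
  unfolding comp_fun_def by (rule exI[of _ "OracleP"]) simp

lemma comp_fun_Suc0: "comp_fun (\<lambda>p n. Suc n)"
  unfolding comp_fun_def by (rule exI[of _ "SuccP"]) simp

lemma comp_fun_const: "comp_fun (\<lambda>p n. k)"
proof (induction k)
  case 0
  show ?case unfolding comp_fun_def by (rule exI[of _ "ZeroP"]) simp
next
  case (Suc k)
  show ?case using comp_fun_comp[OF comp_fun_Suc0 Suc] .
qed

lemma comp_fun2_primrec:
  assumes "comp_fun f" "comp_fun3 g"
  shows "comp_fun2 (\<lambda>p m n. rec_nat (f p n) (\<lambda>k r. g p k r n) m)"
proof -
  obtain e where e: "\<And>p n. run e p [n] = Some (f p n)" using assms by (auto simp: comp_fun_def)
  obtain d where d: "\<And>p l m n. run d p [l, m, n] = Some (g p l m n)" using assms by (auto simp: comp_fun3_def)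
  have "run (PrimRecP e d) p [m, n] = Some (rec_nat (f p n) (\<lambda>k r. g p k r n) m)" for p m n
    by (induction m) (auto simp: e d)
  then show ?thesis unfolding comp_fun2_def by blast
qed

text \<open>Without a parameter the base program would be run on the empty list. So a dummy
  parameter is carried along and finally identified with the recursion variable.\<close>

lemma comp_fun_primrec0:
  assumes "comp_fun2 g"
  shows "comp_fun (\<lambda>p m. rec_nat c (\<lambda>k r. g p k r) m)"
proof -
  obtain e where e: "\<And>p n. run e p [n] = Some c" using comp_fun_const[of c] by (auto simp: comp_fun_def)
  obtain d where d: "\<And>p m n. run d p [m, n] = Some (g p m n)" using assms by (auto simp: comp_fun2_def)
  have "comp_fun2 (\<lambda>p m n. rec_nat c (\<lambda>k r. g p k r) m)"
  proof -
    have "comp_fun3 (\<lambda>p k r n. g p k r)"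
      using comp_fun3_comp2[OF assms comp_fun3_arg(1,2)] .
    from comp_fun2_primrec[OF comp_fun_const this] show ?thesis .
  qed
  from comp_fun_comp2[OF this comp_fun_arg comp_fun_arg] show ?thesis .
qed

lemma comp_fun2_add: "comp_fun2 (\<lambda>p m n. m + n)"
proof -
  have "rec_nat n (\<lambda>k r. Suc r) m = m + n" for m n by (induction m) auto
  with comp_fun2_primrec[OF comp_fun_arg comp_fun3_comp[OF comp_fun_Suc0 comp_fun3_arg(2)]] show ?thesis by simp
qed

lemma comp_fun2_mult: "comp_fun2 (\<lambda>p m n. m * n)"
proof -
  have "rec_nat 0 (\<lambda>k r. r + n) m = m * n" for m n :: nat by (induction m) auto
  with comp_fun2_primrec[OF comp_fun_const[of 0] comp_fun3_comp2[OF comp_fun2_add comp_fun3_arg(2,3)]] show ?thesis by simp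
qed

lemma comp_fun_pred: "comp_fun (\<lambda>p n. n - 1)"
proof -
  have "rec_nat 0 (\<lambda>k r. k) m = m - 1" for m :: nat by (induction m) auto
  with comp_fun_primrec0[OF comp_fun2_arg(1), of 0] show ?thesis by simp
qed

lemma comp_fun2_diff: "comp_fun2 (\<lambda>p m n. m - n)"
proof -
  \<comment> \<open>Recursion runs over the first argument, so the subtrahend stands first here and
    the arguments are swapped at the end.\<close>
  have "rec_nat n (\<lambda>k r. r - 1) m = n - m" for m n :: nat by (induction m) auto
  with comp_fun2_primrec[OF comp_fun_arg comp_fun3_comp[OF comp_fun_pred comp_fun3_arg(2)]]
  have "comp_fun2 (\<lambda>p m n. n - m)" by simp
  from comp_fun2_comp2[OF this comp_fun2_arg(2) comp_fun2_arg(1)] show ?thesis .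
qed

section \<open>Pairing and its inverse\<close>

lemma comp_fun_triangle: "comp_fun (\<lambda>p n. triangle n)"
proof -
  have "rec_nat 0 (\<lambda>k r. Suc k + r) m = triangle m" for m by (induction m) auto
  with comp_fun_primrec0[OF comp_fun2_comp2[OF comp_fun2_add comp_fun2_comp[OF comp_fun_Suc0 comp_fun2_arg(1)] comp_fun2_arg(2)], of 0]
  show ?thesis by simp
qed

lemma comp_fun2_pair: "comp_fun2 (\<lambda>p m n. prod_encode (m, n))"
  unfolding prod_encode_def
  using comp_fun2_comp2[OF comp_fun2_add comp_fun2_comp[OF comp_fun_triangle comp_fun2_add] comp_fun2_arg(1)] by simp

text \<open>The antidiagonal on which the pairing places \<open>k\<close>; it advances when \<open>Suc k\<close> reaches the
  next triangular number.\<close>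

definition diag :: "nat \<Rightarrow> nat" where
  "diag k = rec_nat 0 (\<lambda>k s. s + (1 - (triangle (Suc s) - Suc k))) k"

lemma comp_fun_diag: "comp_fun (\<lambda>p n. diag n)"
proof -
  have s: "comp_fun2 (\<lambda>p (k::nat) s::nat. s)" and k: "comp_fun2 (\<lambda>p (k::nat) s::nat. k)" by (rule comp_fun2_arg)+
  have 1: "comp_fun2 (\<lambda>p (k::nat) s::nat. 1)" using comp_fun2_comp[OF comp_fun_const k] .
  have "comp_fun2 (\<lambda>p k s. s + (1 - (triangle (Suc s) - Suc k)))"
    by (rule comp_fun2_comp2[OF comp_fun2_add s] comp_fun2_comp2[OF comp_fun2_diff] 1 comp_fun2_comp[OF comp_fun_triangle]
        comp_fun2_comp[OF comp_fun_Suc0] s k)+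
  from comp_fun_primrec0[OF this] show ?thesis unfolding diag_def .
qed

lemma diag_bounds: "triangle (diag k) \<le> k \<and> k < triangle (Suc (diag k))"
proof (induction k)
  case 0 show ?case by (simp add: diag_def)
next
  case (Suc k)
  have "diag (Suc k) = diag k + (1 - (triangle (Suc (diag k)) - Suc k))" by (simp add: diag_def)
  then show ?case using Suc by (cases "triangle (Suc (diag k)) = Suc k") auto
qed

lemma triangle_mono: "m \<le> n \<Longrightarrow> triangle m \<le> triangle n"
  by (induction rule: dec_induct) auto

lemma diag_prod_encode: "diag (prod_encode (m, n)) = m + n"
proof -
  let ?k = "prod_encode (m, n)"
  have b: "triangle (m + n) \<le> ?k" "?k < triangle (Suc (m + n))" by (auto simp: prod_encode_def)
  have "\<not> Suc (diag ?k) \<le> m + n"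
    using b(1) diag_bounds[of ?k] triangle_mono[of "Suc (diag ?k)" "m + n"] by linarith
  moreover have "\<not> Suc (m + n) \<le> diag ?k"
    using b(2) diag_bounds[of ?k] triangle_mono[of "Suc (m + n)" "diag ?k"] by linarith
  ultimately show ?thesis by linarith
qed

definition pfst :: "nat \<Rightarrow> nat" where "pfst k = fst (prod_decode k)"
definition psnd :: "nat \<Rightarrow> nat" where "psnd k = snd (prod_decode k)"

text \<open>The pair \<open>(m, n)\<close> has the code \<open>triangle (m + n) + m\<close>. Once
  the antidiagonal \<open>m + n\<close> is known, both components are differences of computable
  terms.\<close>

lemma pfst_diag: "pfst k = k - triangle (diag k)" and psnd_diag: "psnd k = diag k - pfst k"
proof -
  obtain m n where k: "k = prod_encode (m, n)" by (metis prod_decode_inverse surj_pair)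
  show "pfst k = k - triangle (diag k)"
    unfolding k diag_prod_encode pfst_def prod_encode_inverse by (simp add: prod_encode_def)
  show "psnd k = diag k - pfst k"
    unfolding k diag_prod_encode pfst_def psnd_def by simp
qed

lemma comp_fun_pfst0: "comp_fun (\<lambda>p n. pfst n)"
  unfolding pfst_diag by (intro comp_fun_comp2[OF comp_fun2_diff] comp_fun_arg comp_fun_comp[OF comp_fun_triangle] comp_fun_diag)

lemma comp_fun_psnd0: "comp_fun (\<lambda>p n. psnd n)"
  unfolding psnd_diag by (intro comp_fun_comp2[OF comp_fun2_diff] comp_fun_diag comp_fun_pfst0)

lemma pfst_psnd_encode [simp]: "pfst (prod_encode (a, b)) = a" "psnd (prod_encode (a, b)) = b"
  by (simp_all add: pfst_def psnd_def)

lemma prod_encode_pfst_psnd [simp]: "prod_encode (pfst k, psnd k) = k"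
  by (simp add: pfst_def psnd_def)

text \<open>Default values: dropping from an empty list leaves it empty, and an entry read past the
  end of a coded list is 0, that is, the pair \<open>(0, 0)\<close>, which later stands for the
  coefficient 0.\<close>

lemma pfst_0 [simp]: "pfst 0 = 0" and psnd_0 [simp]: "psnd 0 = 0"
  by (simp_all add: pfst_diag psnd_diag diag_def)

section \<open>Decidable predicates, recursion and search\<close>

named_theorems comp_fun_intros

text \<open>Each basic function is given already composed with computable arguments, so that
  resolution can follow the structure of an expression.\<close>

lemmas [comp_fun_intros] = comp_fun_arg comp_fun_const comp_fun_comp[OF comp_fun_oracle] comp_fun_comp[OF comp_fun_Suc0] comp_fun_comp2[OF comp_fun2_add]
  comp_fun_comp2[OF comp_fun2_mult] comp_fun_comp2[OF comp_fun2_diff] comp_fun_comp2[OF comp_fun2_pair] comp_fun_comp[OF comp_fun_pfst0]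
  comp_fun_comp[OF comp_fun_psnd0]

definition comp_pred :: "(baire \<Rightarrow> nat \<Rightarrow> bool) \<Rightarrow> bool" where
  "comp_pred P \<longleftrightarrow> comp_fun (\<lambda>p n. of_bool (P p n))"

lemma comp_pred_comp: "comp_pred P \<Longrightarrow> comp_fun a \<Longrightarrow> comp_pred (\<lambda>p n. P p (a p n))"
  unfolding comp_pred_def by (rule comp_fun_comp)

lemma comp_pred_less [comp_fun_intros]: "comp_fun a \<Longrightarrow> comp_fun b \<Longrightarrow> comp_pred (\<lambda>p n. a p n < b p n)"
proof -
  assume ab: "comp_fun a" "comp_fun b"
  \<comment> \<open>With truncated subtraction, \<open>1 - (1 - d)\<close> is the sign of
    \<open>d\<close>.\<close>
  have eq: "of_bool (x < y) = 1 - (1 - (y - x))" for x y :: nat by auto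
  show ?thesis unfolding comp_pred_def eq using ab by (intro comp_fun_intros)
qed

lemma comp_pred_not [comp_fun_intros]: "comp_pred P \<Longrightarrow> comp_pred (\<lambda>p n. \<not> P p n)"
proof -
  assume P: "comp_pred P"
  have eq: "(of_bool (\<not> P) :: nat) = 1 - of_bool P" for P by auto
  show ?thesis using P unfolding comp_pred_def eq by (intro comp_fun_intros)
qed

lemma comp_pred_conj [comp_fun_intros]: "comp_pred P \<Longrightarrow> comp_pred Q \<Longrightarrow> comp_pred (\<lambda>p n. P p n \<and> Q p n)"
proof -
  assume P: "comp_pred P" "comp_pred Q"
  have eq: "(of_bool (P \<and> Q) :: nat) = of_bool P * of_bool Q" for P Q by auto
  show ?thesis using P unfolding comp_pred_def eq by (intro comp_fun_intros)
qed

lemma comp_pred_disj [comp_fun_intros]: "comp_pred P \<Longrightarrow> comp_pred Q \<Longrightarrow> comp_pred (\<lambda>p n. P p n \<or> Q p n)"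
proof -
  assume "comp_pred P" "comp_pred Q"
  then have "comp_pred (\<lambda>p n. \<not> (\<not> P p n \<and> \<not> Q p n))" by (intro comp_pred_not comp_pred_conj)
  then show ?thesis by simp
qed

lemma comp_pred_imp [comp_fun_intros]: "comp_pred P \<Longrightarrow> comp_pred Q \<Longrightarrow> comp_pred (\<lambda>p n. P p n \<longrightarrow> Q p n)"
  unfolding imp_conv_disj by (intro comp_pred_disj comp_pred_not)

lemma comp_pred_eq [comp_fun_intros]: "comp_fun a \<Longrightarrow> comp_fun b \<Longrightarrow> comp_pred (\<lambda>p n. a p n = b p n)"
proof -
  assume ab: "comp_fun a" "comp_fun b"
  have eq: "x = y \<longleftrightarrow> \<not> x < y \<and> \<not> y < x" for x y :: nat by auto
  show ?thesis unfolding eq using ab by (intro comp_fun_intros)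
qed

lemma comp_fun_if [comp_fun_intros]:
  assumes "comp_pred P" "comp_fun a" "comp_fun b" shows "comp_fun (\<lambda>p n. if P p n then a p n else b p n)"
proof -
  have eq: "(if Q then x else y) = of_bool Q * x + (1 - of_bool Q) * y" for Q and x y :: nat
    by auto
  have "comp_fun (\<lambda>p n. of_bool (P p n))" using assms(1) by (simp add: comp_pred_def)
  then show ?thesis unfolding eq using assms(2,3) by (intro comp_fun_intros)
qed

text \<open>The step depends on three numbers, packed here as
  \<open>prod_encode (n, prod_encode (m, r))\<close>. The premise is thus again a
  \<open>comp_fun\<close> in a single argument, to which the introduction rules apply; the
  quantifier rules below use the same device.\<close>

lemma comp_fun_rec [comp_fun_intros]:
  assumes f: "comp_fun f" and h: "comp_fun h"
    and g: "comp_fun (\<lambda>p k. g p (pfst k) (pfst (psnd k)) (psnd (psnd k)))"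
  shows "comp_fun (\<lambda>p n. rec_nat (f p n) (\<lambda>m r. g p n m r) (h p n))"
proof -
  have 1: "comp_fun3 (\<lambda>p m r n. prod_encode (n, prod_encode (m, r)))"
    by (intro comp_fun3_comp2[OF comp_fun2_pair] comp_fun3_arg)
  have "comp_fun3 (\<lambda>p m r n. g p n m r)" using comp_fun3_comp[OF g 1] by simp
  from comp_fun_comp2[OF comp_fun2_primrec[OF f this] h comp_fun_arg] show ?thesis .
qed

lemma comp_pred_all [comp_fun_intros]:
  assumes P: "comp_pred (\<lambda>p k. P p (pfst k) (psnd k))" and b: "comp_fun b"
  shows "comp_pred (\<lambda>p n. \<forall>i<b p n. P p n i)"
proof -
  have eq: "(of_bool (\<forall>i<b. P i) :: nat) = rec_nat 1 (\<lambda>m r. r * of_bool (P m)) b" for b :: nat and P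
  proof (induction b)
    case (Suc b)
    then show ?case by (cases "P b") (auto simp: less_Suc_eq simp flip: Suc.IH)
  qed simp
  \<comment> \<open>The recursion packs \<open>n\<close>, the counter and the value so far; the
    predicate reads the first two.\<close>
  have "comp_fun (\<lambda>p k. of_bool (P p (pfst k) (pfst (psnd k))))"
  proof -
    have "comp_fun (\<lambda>p k. prod_encode (pfst k, pfst (psnd k)))" by (intro comp_fun_intros)
    from comp_fun_comp[OF P[unfolded comp_pred_def] this] show ?thesis by simp
  qed
  then show ?thesis unfolding comp_pred_def eq using b by (intro comp_fun_intros)
qed

lemma comp_pred_ex [comp_fun_intros]:
  assumes P: "comp_pred (\<lambda>p k. P p (pfst k) (psnd k))" and b: "comp_fun b"
  shows "comp_pred (\<lambda>p n. \<exists>i<b p n. P p n i)"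
  using comp_pred_not[OF comp_pred_all[OF comp_pred_not[OF P] b]] by simp

text \<open>Unbounded search. \<open>MuP\<close> looks for the value 0, hence the negated test; that
  a solution exists for every oracle and argument makes the result total.\<close>

lemma comp_fun_Least:
  assumes P: "comp_pred (\<lambda>p k. P p (pfst k) (psnd k))" and ex: "\<And>p n. \<exists>i. P p n i"
  shows "comp_fun (\<lambda>p n. LEAST i. P p n i)"
proof -
  obtain e where e: "\<And>p k. run e p [k] = Some (of_bool (\<not> P p (pfst k) (psnd k)))"
    using comp_pred_not[OF P] by (auto simp: comp_fun_def comp_pred_def)
  have "comp_fun2 (\<lambda>p i n. prod_encode (n, i))" by (intro comp_fun2_comp2[OF comp_fun2_pair] comp_fun2_arg)
  then obtain d where d: "\<And>p i n. run d p [i, n] = Some (prod_encode (n, i))" by (auto simp: comp_fun2_def)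
  have "run (MuP (CompP e [d])) p [n] = Some (LEAST i. P p n i)" for p n
    using ex[of p n] by (simp add: e d)
  then show ?thesis unfolding comp_fun_def by blast
qed

lemma computable_cf: "comp_fun F \<Longrightarrow> computable (\<lambda>p. Some (F p))"
  unfolding comp_fun_def computable_def by auto

section \<open>Coded lists\<close>

definition ldrop :: "nat \<Rightarrow> nat \<Rightarrow> nat" where
  "ldrop c i = rec_nat c (\<lambda>m r. psnd (r - 1)) i"

definition lnth :: "nat \<Rightarrow> nat \<Rightarrow> nat" where
  "lnth c i = pfst (ldrop c i - 1)"

lemma comp_fun_ldrop [comp_fun_intros]: "comp_fun a \<Longrightarrow> comp_fun b \<Longrightarrow> comp_fun (\<lambda>p n. ldrop (a p n) (b p n))"
  unfolding ldrop_def by (intro comp_fun_intros)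

lemma comp_fun_lnth [comp_fun_intros]: "comp_fun a \<Longrightarrow> comp_fun b \<Longrightarrow> comp_fun (\<lambda>p n. lnth (a p n) (b p n))"
  unfolding lnth_def by (intro comp_fun_intros)

text \<open>The code of a nonempty list is the successor of a pair, so the predecessor is taken
  before its second component; the code 0 of the empty list is kept because
  \<open>psnd 0 = 0\<close>.\<close>

lemma ldrop_encode: "ldrop (list_encode xs) i = list_encode (drop i xs)"
proof (induction i)
  case 0 show ?case by (simp add: ldrop_def)
next
  case (Suc i)
  have "ldrop (list_encode xs) (Suc i) = psnd (list_encode (drop i xs) - 1)"
    using Suc by (simp add: ldrop_def)
  also have "\<dots> = list_encode (drop (Suc i) xs)"
    by (cases "drop i xs") (auto simp: drop_Suc drop_tl)
  finally show ?case .
qed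

lemma list_encode_eq_0 [simp]: "list_encode xs = 0 \<longleftrightarrow> xs = []"
  by (cases xs) auto

text \<open>Decides whether a position is inside a coded list without computing the length.\<close>

lemma ldrop_encode_neq_0: "ldrop (list_encode xs) i \<noteq> 0 \<longleftrightarrow> i < length xs"
  by (simp add: ldrop_encode not_le)

lemma lnth_encode: "lnth (list_encode xs) i = (if i < length xs then xs ! i else 0)"
  unfolding lnth_def ldrop_encode by (cases "drop i xs") (auto simp: drop_eq_Nil2 dest: nth_via_drop)

text \<open>Allows quantifiers over the positions of a list to be bounded by its code.\<close>

lemma length_le_list_encode: "length xs \<le> list_encode xs"
proof (induction xs)
  case (Cons x xs)
  then show ?case using le_prod_encode_2[of "list_encode xs" x] by simp
qed simp

section \<open>Dense and scattered sets\<close>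

text \<open>Endpoints are allowed. In a linear order this leaves the notion of a scattered set
  unchanged, since the part of a dense set strictly between two of its elements is dense
  again.\<close>

definition dense_set :: "'a rel \<Rightarrow> 'a set \<Rightarrow> bool" where
  "dense_set r D \<longleftrightarrow> (\<exists>x\<in>D. \<exists>y\<in>D. x \<noteq> y) \<and>
     (\<forall>x\<in>D. \<forall>y\<in>D. (x, y) \<in> r \<and> x \<noteq> y \<longrightarrow>
        (\<exists>z\<in>D. (x, z) \<in> r \<and> x \<noteq> z \<and> (z, y) \<in> r \<and> z \<noteq> y))"

definition scattered :: "'a rel \<Rightarrow> 'a set \<Rightarrow> bool" where
  "scattered r S \<longleftrightarrow> \<not> (\<exists>D\<subseteq>S. dense_set r D)"

lemma dense_setD:
  assumes "dense_set r D" "x \<in> D" "y \<in> D" "(x, y) \<in> r" "x \<noteq> y"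
  obtains z where "z \<in> D" "(x, z) \<in> r" "x \<noteq> z" "(z, y) \<in> r" "z \<noteq> y"
  using assms unfolding dense_set_def by blast

lemma scattered_subset: "scattered r S \<Longrightarrow> S' \<subseteq> S \<Longrightarrow> scattered r S'"
  unfolding scattered_def by blast

lemma dense_set_image:
  assumes "dense_set r D" "inj_on f D"
    "\<And>a b. a \<in> D \<Longrightarrow> b \<in> D \<Longrightarrow> (a, b) \<in> r \<longleftrightarrow> (f a, f b) \<in> s"
  shows "dense_set s (f ` D)"
  unfolding dense_set_def
proof (intro conjI ballI impI)
  from assms(1) obtain x y where "x \<in> D" "y \<in> D" "x \<noteq> y" unfolding dense_set_def by blast
  then show "\<exists>x\<in>f ` D. \<exists>y\<in>f ` D. x \<noteq> y" using assms(2) by (meson image_eqI inj_onD)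
next
  fix u v assume "u \<in> f ` D" "v \<in> f ` D" "(u, v) \<in> s \<and> u \<noteq> v"
  then obtain x y where xy: "x \<in> D" "y \<in> D" "u = f x" "v = f y" "(x, y) \<in> r" "x \<noteq> y"
    using assms(3) by blast
  then obtain z where z: "z \<in> D" "(x, z) \<in> r" "x \<noteq> z" "(z, y) \<in> r" "z \<noteq> y"
    using dense_setD[OF assms(1)] by metis
  with xy show "\<exists>w\<in>f ` D. (u, w) \<in> s \<and> u \<noteq> w \<and> (w, v) \<in> s \<and> w \<noteq> v"
    using assms(2,3) by (metis image_eqI inj_onD)
qed

lemma scattered_image:
  assumes "scattered s (f ` S)" "inj_on f S"
    "\<And>a b. a \<in> S \<Longrightarrow> b \<in> S \<Longrightarrow> (a, b) \<in> r \<longleftrightarrow> (f a, f b) \<in> s"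
  shows "scattered r S"
  unfolding scattered_def
proof (intro notI, elim exE conjE)
  fix D assume D: "D \<subseteq> S" "dense_set r D"
  have "dense_set s (f ` D)"
    using dense_set_image[OF D(2)] D(1) assms(2,3) by (meson inj_on_subset subsetD)
  then show False using assms(1) D(1) unfolding scattered_def by (meson image_mono)
qed

lemma order_isomorphic_dense:
  assumes "order_isomorphic r s" "dense_set r D" "D \<subseteq> Field r"
  shows "\<exists>E\<subseteq>Field s. dense_set s E"
proof -
  obtain f where f: "bij_betw f (Field r) (Field s)"
    "\<And>a b. a \<in> Field r \<Longrightarrow> b \<in> Field r \<Longrightarrow> (a, b) \<in> r \<longleftrightarrow> (f a, f b) \<in> s"
    using assms(1) unfolding order_isomorphic_def by blast
  have "inj_on f D" using f(1) assms(3) by (meson bij_betw_def inj_on_subset)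
  then have "dense_set s (f ` D)" using dense_set_image[OF assms(2), of f s] f(2) assms(3) by blast
  moreover have "f ` D \<subseteq> Field s" using f(1) assms(3) by (auto simp: bij_betw_def)
  ultimately show ?thesis by blast
qed

lemma order_isomorphic_sym:
  assumes "order_isomorphic r s" shows "order_isomorphic s r"
proof -
  obtain f where f: "bij_betw f (Field r) (Field s)"
    "\<And>a b. a \<in> Field r \<Longrightarrow> b \<in> Field r \<Longrightarrow> (a, b) \<in> r \<longleftrightarrow> (f a, f b) \<in> s"
    using assms unfolding order_isomorphic_def by blast
  let ?g = "inv_into (Field r) f"
  have "bij_betw ?g (Field s) (Field r)" using f(1) by (rule bij_betw_inv_into)
  moreover have "(a, b) \<in> s \<longleftrightarrow> (?g a, ?g b) \<in> r" if "a \<in> Field s" "b \<in> Field s" for a b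
  proof -
    have "?g a \<in> Field r" "?g b \<in> Field r" "f (?g a) = a" "f (?g b) = b"
      using that f(1) by (auto simp: bij_betw_def inv_into_into f_inv_into_f)
    then show ?thesis using f(2)[of "?g a" "?g b"] by simp
  qed
  ultimately show ?thesis unfolding order_isomorphic_def by blast
qed

text \<open>Makes scatteredness a local matter: a dense set can be shrunk into a gap that avoids one
  of two pieces, or into an interval already known to be scattered.\<close>

lemma dense_set_interval:
  assumes r: "trans r" "antisym r" and D: "dense_set r D" "x \<in> D" "y \<in> D" "(x, y) \<in> r" "x \<noteq> y"
  shows "dense_set r {z\<in>D. (x, z) \<in> r \<and> x \<noteq> z \<and> (z, y) \<in> r \<and> z \<noteq> y}"
proof -
  obtain z where z: "z \<in> D" "(x, z) \<in> r" "x \<noteq> z" "(z, y) \<in> r" "z \<noteq> y"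
    using dense_setD[OF D] .
  obtain w where w: "w \<in> D" "(z, w) \<in> r" "z \<noteq> w" "(w, y) \<in> r" "w \<noteq> y"
    using dense_setD[OF D(1) z(1) D(3) z(4,5)] .
  have xw: "(x, w) \<in> r" "x \<noteq> w" using z w r by (meson transD antisymD)+
  show ?thesis
    unfolding dense_set_def
  proof (intro conjI ballI impI)
    show "\<exists>u\<in>{z\<in>D. (x, z) \<in> r \<and> x \<noteq> z \<and> (z, y) \<in> r \<and> z \<noteq> y}. \<exists>v\<in>{z\<in>D. (x, z) \<in> r \<and> x \<noteq> z \<and> (z, y) \<in> r \<and> z \<noteq> y}. u \<noteq> v"
      using z w xw by blast
  next
    fix u v assume uv: "u \<in> {z\<in>D. (x, z) \<in> r \<and> x \<noteq> z \<and> (z, y) \<in> r \<and> z \<noteq> y}"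
      "v \<in> {z\<in>D. (x, z) \<in> r \<and> x \<noteq> z \<and> (z, y) \<in> r \<and> z \<noteq> y}" "(u, v) \<in> r \<and> u \<noteq> v"
    then obtain t where t: "t \<in> D" "(u, t) \<in> r" "u \<noteq> t" "(t, v) \<in> r" "t \<noteq> v"
      using dense_setD[OF D(1), of u v] by blast
    have "(x, t) \<in> r" "(t, y) \<in> r" "x \<noteq> t" "t \<noteq> y"
      using uv t r by (auto dest: transD antisymD)
    then show "\<exists>t\<in>{z\<in>D. (x, z) \<in> r \<and> x \<noteq> z \<and> (z, y) \<in> r \<and> z \<noteq> y}. (u, t) \<in> r \<and> u \<noteq> t \<and> (t, v) \<in> r \<and> t \<noteq> v"
      using t by blast
  qed
qed

text \<open>The rationals are indivisible. Either some open interval of \<open>D\<close> avoids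
  \<open>S1\<close> and is a dense part of \<open>S2\<close>, or \<open>S1\<close> meets every open
  interval of \<open>D\<close>, and then \<open>D \<inter> S1\<close> is dense.\<close>

lemma scattered_Un:
  assumes r: "trans r" "antisym r" and tot: "total_on (S1 \<union> S2) r"
    and S: "scattered r S1" "scattered r S2"
  shows "scattered r (S1 \<union> S2)"
  unfolding scattered_def
proof (intro notI, elim exE conjE)
  fix D assume D: "D \<subseteq> S1 \<union> S2" "dense_set r D"
  show False
  proof (cases "\<exists>x\<in>D. \<exists>y\<in>D. (x, y) \<in> r \<and> x \<noteq> y \<and>
      (\<forall>z\<in>D. (x, z) \<in> r \<and> x \<noteq> z \<and> (z, y) \<in> r \<and> z \<noteq> y \<longrightarrow> z \<notin> S1)")
    case True
    then obtain x y where xy: "x \<in> D" "y \<in> D" "(x, y) \<in> r" "x \<noteq> y"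
      "\<forall>z\<in>D. (x, z) \<in> r \<and> x \<noteq> z \<and> (z, y) \<in> r \<and> z \<noteq> y \<longrightarrow> z \<notin> S1" by blast
    let ?E = "{z\<in>D. (x, z) \<in> r \<and> x \<noteq> z \<and> (z, y) \<in> r \<and> z \<noteq> y}"
    have "dense_set r ?E" using dense_set_interval[OF r D(2) xy(1-4)] .
    moreover have "?E \<subseteq> S2" using D(1) xy(5) by blast
    ultimately show False using S(2) unfolding scattered_def by blast
  next
    case False
    then have *: "\<exists>z\<in>D \<inter> S1. (x, z) \<in> r \<and> x \<noteq> z \<and> (z, y) \<in> r \<and> z \<noteq> y"
      if "x \<in> D" "y \<in> D" "(x, y) \<in> r" "x \<noteq> y" for x y
      using that by blast
    obtain x y where xy: "x \<in> D" "y \<in> D" "x \<noteq> y" "(x, y) \<in> r"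
    proof -
      obtain a b where "a \<in> D" "b \<in> D" "a \<noteq> b" using D(2) unfolding dense_set_def by blast
      moreover then have "(a, b) \<in> r \<or> (b, a) \<in> r" using tot D(1) unfolding total_on_def by blast
      ultimately show thesis using that by metis
    qed
    obtain z where z: "z \<in> D \<inter> S1" "(x, z) \<in> r" "x \<noteq> z" using *[OF xy(1,2,4,3)] by blast
    obtain w where w: "w \<in> D \<inter> S1" "(x, w) \<in> r" "x \<noteq> w" "(w, z) \<in> r" "w \<noteq> z"
      using *[of x z] z xy by blast
    have "dense_set r (D \<inter> S1)"
      unfolding dense_set_def
    proof (intro conjI ballI impI)
      show "\<exists>x\<in>D \<inter> S1. \<exists>y\<in>D \<inter> S1. x \<noteq> y" using z w by blast
    qed (use * in blast)
    then show False using S(1) unfolding scattered_def by blast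
  qed
qed

section \<open>The order of finitely supported functions\<close>

lemma Field_Z_pow [simp]: "Field (Z_pow r) = fin_supp r"
  unfolding Z_pow_def Field_def by auto

lemma linear_order_onD:
  assumes "linear_order_on A r"
  shows "x \<in> A \<Longrightarrow> (x, x) \<in> r"
    and "(x, y) \<in> r \<Longrightarrow> (y, z) \<in> r \<Longrightarrow> (x, z) \<in> r"
    and "(x, y) \<in> r \<Longrightarrow> (y, x) \<in> r \<Longrightarrow> x = y"
    and "x \<in> A \<Longrightarrow> y \<in> A \<Longrightarrow> (x, y) \<in> r \<or> (y, x) \<in> r"
    and "(x, y) \<in> r \<Longrightarrow> x \<in> A \<and> y \<in> A"
  using assms unfolding order_on_defs refl_on_def total_on_def
  by (blast, meson transD, meson antisymD, metis, blast)

lemma finite_rel_max: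
  assumes "Linear_order r" "finite S" "S \<noteq> {}" "S \<subseteq> Field r"
  shows "\<exists>m\<in>S. \<forall>y\<in>S. (y, m) \<in> r"
  using assms(2-4)
proof (induction S rule: finite_ne_induct)
  case (singleton x)
  then show ?case using assms(1) by (auto simp: order_on_defs refl_on_def)
next
  case (insert x S)
  then obtain m where m: "m \<in> S" "\<forall>y\<in>S. (y, m) \<in> r" by auto
  have "m \<in> Field r" "x \<in> Field r" using insert.prems m(1) by auto
  then have "(x, m) \<in> r \<or> (m, x) \<in> r" "(x, x) \<in> r"
    using linear_order_onD(1,4)[OF assms(1)] by simp_all
  then show ?case
    using m linear_order_onD(2)[OF assms(1)] by (metis insert_iff)
qed

lemma fin_supp_neq_max:
  assumes "Linear_order r" "f \<in> fin_supp r" "g \<in> fin_supp r" "f \<noteq> g"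
  obtains m where "m \<in> Field r" "f m \<noteq> g m" "\<forall>y. f y \<noteq> g y \<longrightarrow> (y, m) \<in> r"
proof -
  let ?S = "{y. f y \<noteq> g y}"
  have "?S \<subseteq> {y. f y \<noteq> 0} \<union> {y. g y \<noteq> 0}" by auto
  then have "finite ?S" "?S \<subseteq> Field r"
    using assms(2,3) finite_subset[of ?S "{y. f y \<noteq> 0} \<union> {y. g y \<noteq> 0}"]
    unfolding fin_supp_def by auto
  moreover have "?S \<noteq> {}" using assms(4) by auto
  ultimately show thesis using finite_rel_max[OF assms(1), of ?S] that by blast
qed

text \<open>Stated for every linear order because the Kleene-Brouwer order of an ill-founded tree
  also serves as an exponent. In the proof of transitivity, the larger of the two deciding places
  decides.\<close>

lemma linear_order_Z_pow:
  assumes r: "Linear_order r" shows "Linear_order (Z_pow r)"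
proof -
  have anti: "antisym r" and tr: "trans r" using r unfolding order_on_defs by blast+
  have "antisym (Z_pow r)"
  proof (rule antisymI)
    fix f g assume fg: "(f, g) \<in> Z_pow r" "(g, f) \<in> Z_pow r"
    show "f = g"
    proof (rule ccontr)
      assume "f \<noteq> g"
      then obtain x y where x: "f x < g x" "\<forall>y. f y \<noteq> g y \<longrightarrow> (y, x) \<in> r"
        and y: "g y < f y" "\<forall>x. g x \<noteq> f x \<longrightarrow> (x, y) \<in> r"
        using fg unfolding Z_pow_def by auto
      have "(y, x) \<in> r" "(x, y) \<in> r" using x y by (metis order_less_irrefl)+
      then have "x = y" using anti by (metis antisymD)
      then show False using x y by simp
    qed
  qed
  moreover have "trans (Z_pow r)"
  proof (rule transI)
    fix f g h assume fgh: "(f, g) \<in> Z_pow r" "(g, h) \<in> Z_pow r"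
    have F: "f \<in> fin_supp r" "h \<in> fin_supp r" using fgh unfolding Z_pow_def by auto
    show "(f, h) \<in> Z_pow r"
    proof (cases "f = g \<or> g = h")
      case True then show ?thesis using fgh by auto
    next
      case False
      then obtain x y where x: "f x < g x" "\<forall>y. f y \<noteq> g y \<longrightarrow> (y, x) \<in> r"
        and y: "g y < h y" "\<forall>x. g x \<noteq> h x \<longrightarrow> (x, y) \<in> r"
        using fgh unfolding Z_pow_def by auto
      have "(x, x) \<in> r" "(y, y) \<in> r" using x y by (metis order_less_irrefl)+
      then have "x \<in> Field r" "y \<in> Field r" by (auto simp: Field_def)
      then have "x = y \<or> (x, y) \<in> r \<and> (y, x) \<notin> r \<or> (y, x) \<in> r \<and> (x, y) \<notin> r"
        using r anti unfolding order_on_defs total_on_def by (metis antisymD)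
      then have "\<exists>z. f z < h z \<and> (\<forall>y. f y \<noteq> h y \<longrightarrow> (y, z) \<in> r)"
      proof (elim disjE conjE)
        assume "x = y"
        then show ?thesis using x y by (metis order_less_trans)
      next
        assume xy: "(x, y) \<in> r" "(y, x) \<notin> r"
        then have "f y = g y" using x by blast
        then have "f y < h y" using y by simp
        moreover have "(z, y) \<in> r" if "f z \<noteq> h z" for z
          using that x(2) y(2) xy tr by (metis transD)
        ultimately show ?thesis by blast
      next
        assume xy: "(y, x) \<in> r" "(x, y) \<notin> r"
        then have "g x = h x" using y by blast
        then have "f x < h x" using x by simp
        moreover have "(z, x) \<in> r" if "f z \<noteq> h z" for z
          using that x(2) y(2) xy tr by (metis transD)
        ultimately show ?thesis by blast
      qed
      then show ?thesis using F unfolding Z_pow_def by blast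
    qed
  qed
  moreover have "refl_on (Field (Z_pow r)) (Z_pow r)"
    unfolding Field_Z_pow by (auto simp: refl_on_def Z_pow_def)
  moreover have "total_on (Field (Z_pow r)) (Z_pow r)"
  proof (rule total_onI)
    fix f g assume fg: "f \<in> Field (Z_pow r)" "g \<in> Field (Z_pow r)" "f \<noteq> g"
    then obtain m where m: "f m \<noteq> g m" "\<forall>y. f y \<noteq> g y \<longrightarrow> (y, m) \<in> r"
      using fin_supp_neq_max[OF r, of f g] by auto
    then have "f m < g m \<or> g m < f m" by auto
    moreover have "\<forall>y. g y \<noteq> f y \<longrightarrow> (y, m) \<in> r" using m(2) by metis
    moreover have "f \<in> fin_supp r" "g \<in> fin_supp r" using fg(1,2) by simp_all
    ultimately show "(f, g) \<in> Z_pow r \<or> (g, f) \<in> Z_pow r"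
      using m(2) unfolding Z_pow_def by blast
  qed
  moreover have "Z_pow r \<subseteq> Field (Z_pow r) \<times> Field (Z_pow r)" by (auto simp: Field_def)
  ultimately show ?thesis unfolding order_on_defs by blast
qed

lemma Z_pow_scattered:
  assumes "Well_order \<alpha>" shows "scattered (Z_pow \<alpha>) (fin_supp \<alpha>)"
  unfolding scattered_def
proof (intro notI, elim exE conjE)
  fix D assume D: "D \<subseteq> fin_supp \<alpha>" "dense_set (Z_pow \<alpha>) D"
  have wo: "antisym \<alpha>" "trans \<alpha>" "Total \<alpha>" "Refl \<alpha>" "wf (\<alpha> - Id)"
    using assms by (auto simp: well_order_on_def order_on_defs)
  \<comment> \<open>\<open>W f g x\<close> makes explicit the place \<open>x\<close> at which
    \<open>f < g\<close> is decided, so that this place can be minimised over all pairs from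
    \<open>D\<close>.\<close>
  define W where "W f g x \<longleftrightarrow> f x < g x \<and> (\<forall>y. f y \<noteq> g y \<longrightarrow> (y, x) \<in> \<alpha>)"
    for f g :: "'a \<Rightarrow> int" and x
  have W_less: "\<exists>x. W f g x" if "(f, g) \<in> Z_pow \<alpha>" "f \<noteq> g" for f g
    using that unfolding Z_pow_def W_def by auto
  have less_W: "(f, g) \<in> Z_pow \<alpha>" "f \<noteq> g" if "f \<in> D" "g \<in> D" "W f g x" for f g x
    using that D(1) unfolding Z_pow_def W_def by auto
  have W_Field: "x \<in> Field \<alpha>" if "W f g x" for f g x
    using that unfolding W_def Field_def by force
  have tot: "total_on (fin_supp \<alpha>) (Z_pow \<alpha>)"
    using linear_order_Z_pow[of \<alpha>] assms unfolding well_order_on_def by (auto simp: order_on_defs)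
  obtain f g where fg: "f \<in> D" "g \<in> D" "(f, g) \<in> Z_pow \<alpha>" "f \<noteq> g"
  proof -
    obtain f g where fg: "f \<in> D" "g \<in> D" "f \<noteq> g" using D(2) unfolding dense_set_def by blast
    with tot D(1) have "(f, g) \<in> Z_pow \<alpha> \<or> (g, f) \<in> Z_pow \<alpha>" unfolding total_on_def by blast
    with fg that show thesis by blast
  qed
  obtain m where m: "\<exists>f\<in>D. \<exists>g\<in>D. W f g m" "\<And>x. \<exists>f\<in>D. \<exists>g\<in>D. W f g x \<Longrightarrow> (m, x) \<in> \<alpha>"
  proof -
    define X where "X = {x. \<exists>f\<in>D. \<exists>g\<in>D. W f g x}"
    obtain x where "x \<in> X" using fg W_less unfolding X_def by blast
    with wo(5)[unfolded wf_eq_minimal, rule_format, of x X]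
    obtain m where m: "m \<in> X" "\<And>y. (y, m) \<in> \<alpha> - Id \<Longrightarrow> y \<notin> X" by blast
    have "(m, x) \<in> \<alpha>" if "x \<in> X" for x
    proof -
      have "x \<in> Field \<alpha>" "m \<in> Field \<alpha>" using that m(1) W_Field unfolding X_def by auto
      then show ?thesis using wo(3,4) m(2)[of x] that unfolding total_on_def refl_on_def by fastforce
    qed
    with m(1) that show thesis unfolding X_def by blast
  qed
  have "\<not> W f g m" if "f \<in> D" "g \<in> D" for f g
    using that
  proof (induction "nat (g m - f m)" arbitrary: f g rule: less_induct)
    case less
    show ?case
    proof
      assume W: "W f g m"
      obtain h where h: "h \<in> D" "(f, h) \<in> Z_pow \<alpha>" "f \<noteq> h" "(h, g) \<in> Z_pow \<alpha>" "h \<noteq> g"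
        using dense_setD[OF D(2) less.prems less_W[OF less.prems W]] .
      obtain y z where y: "W f h y" and z: "W h g z" using W_less h by metis
      have "(m, y) \<in> \<alpha>" "(m, z) \<in> \<alpha>" using m(2) y z h(1) less.prems by blast+
      then have eq: "y \<noteq> m \<Longrightarrow> f y = g y" "z \<noteq> m \<Longrightarrow> f z = g z"
        using W wo(1) unfolding W_def by (meson antisymD)+
      \<comment> \<open>The places \<open>y\<close> and \<open>z\<close> decide \<open>f < h\<close>
        and \<open>h < g\<close>; by minimality neither is below \<open>m\<close>, and
        \<open>f\<close> and \<open>g\<close> agree at any other such place. If \<open>y\<close>
        were above \<open>m\<close>, each of \<open>y\<close> and \<open>z\<close> would bound the
        other, giving \<open>f y < h y < g y\<close> where \<open>f\<close> and \<open>g\<close>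
        agree.\<close>
      have ym: "y = m"
      proof (rule ccontr)
        assume "y \<noteq> m"
        then have "h y \<noteq> g y" using eq y unfolding W_def by auto
        then have yz: "(y, z) \<in> \<alpha>" using z unfolding W_def by blast
        have "z \<noteq> m" using yz \<open>(m, y) \<in> \<alpha>\<close> \<open>y \<noteq> m\<close> wo(1) by (metis antisymD)
        then have "f z \<noteq> h z" using eq z unfolding W_def by auto
        then have "(z, y) \<in> \<alpha>" using y unfolding W_def by blast
        then have "y = z" using yz wo(1) by (metis antisymD)
        then show False using eq \<open>y \<noteq> m\<close> y z unfolding W_def by auto
      qed
      have zm: "z = m"
      proof (rule ccontr)
        assume "z \<noteq> m"
        then have "f z \<noteq> h z" using eq z unfolding W_def by auto
        then have "(z, y) \<in> \<alpha>" using y unfolding W_def by blast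
        then show False using \<open>z \<noteq> m\<close> ym \<open>(m, z) \<in> \<alpha>\<close> wo(1) by (metis antisymD)
      qed
      have "nat (h m - f m) < nat (g m - f m)" using y z ym zm W unfolding W_def by auto
      from less.hyps[OF this less.prems(1) h(1)] show False using y ym by simp
    qed
  qed
  then show False using m(1) by blast
qed

section \<open>Cantor's theorem\<close>

definition unbounded_dense :: "'a rel \<Rightarrow> bool" where
  "unbounded_dense r \<longleftrightarrow> Linear_order r \<and> Field r \<noteq> {} \<and>
     (\<forall>x\<in>Field r. \<exists>y. (y, x) \<in> r \<and> y \<noteq> x) \<and> (\<forall>x\<in>Field r. \<exists>y. (x, y) \<in> r \<and> x \<noteq> y) \<and>
     (\<forall>x y. (x, y) \<in> r \<and> x \<noteq> y \<longrightarrow> (\<exists>z. (x, z) \<in> r \<and> x \<noteq> z \<and> (z, y) \<in> r \<and> z \<noteq> y))"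

text \<open>The extension property behind back and forth. If both sides are nonempty, use density
  between the maximum of \<open>L\<close> and the minimum of \<open>U\<close>; an empty side is
  handled by the absence of an endpoint.\<close>

lemma unbounded_dense_between:
  assumes r: "unbounded_dense r" and fin: "finite L" "finite U" and sub: "L \<subseteq> Field r" "U \<subseteq> Field r"
    and LU: "\<And>x y. x \<in> L \<Longrightarrow> y \<in> U \<Longrightarrow> (x, y) \<in> r \<and> x \<noteq> y"
  shows "\<exists>z\<in>Field r. (\<forall>x\<in>L. (x, z) \<in> r \<and> x \<noteq> z) \<and> (\<forall>y\<in>U. (z, y) \<in> r \<and> z \<noteq> y)"
proof -
  have lin: "Linear_order r" and ne: "Field r \<noteq> {}"
    and below: "\<And>x. x \<in> Field r \<Longrightarrow> \<exists>y. (y, x) \<in> r \<and> y \<noteq> x"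
    and above: "\<And>x. x \<in> Field r \<Longrightarrow> \<exists>y. (x, y) \<in> r \<and> x \<noteq> y"
    and between: "\<And>x y. (x, y) \<in> r \<Longrightarrow> x \<noteq> y \<Longrightarrow> \<exists>z. (x, z) \<in> r \<and> x \<noteq> z \<and> (z, y) \<in> r \<and> z \<noteq> y"
    using r unfolding unbounded_dense_def by blast+
  note tr = linear_order_onD(2)[OF lin] and anti = linear_order_onD(3)[OF lin]
    and F = linear_order_onD(5)[OF lin]
  have lin': "Linear_order (r\<inverse>)" using lin by simp
  have max: "\<exists>m\<in>L. \<forall>x\<in>L. (x, m) \<in> r" if "L \<noteq> {}"
    using finite_rel_max[OF lin fin(1) that sub(1)] .
  have min: "\<exists>m\<in>U. \<forall>y\<in>U. (m, y) \<in> r" if "U \<noteq> {}"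
    using finite_rel_max[OF lin' fin(2) that] sub(2) by simp
  show ?thesis
  proof (cases "L = {}"; cases "U = {}")
    assume "L = {}" "U = {}" then show ?thesis using ne by auto
  next
    assume LU: "L = {}" "U \<noteq> {}"
    then obtain m where m: "m \<in> U" "\<forall>y\<in>U. (m, y) \<in> r" using min by blast
    obtain z where "(z, m) \<in> r" "z \<noteq> m" using below m(1) sub(2) by blast
    then show ?thesis using LU(1) m(2) tr anti F by (metis empty_iff)
  next
    assume LU: "L \<noteq> {}" "U = {}"
    then obtain m where m: "m \<in> L" "\<forall>y\<in>L. (y, m) \<in> r" using max by blast
    obtain z where "(m, z) \<in> r" "z \<noteq> m" using above m(1) sub(1) by blast
    then show ?thesis using LU(2) m(2) tr anti F by (metis empty_iff)
  next
    assume ne: "L \<noteq> {}" "U \<noteq> {}"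
    then obtain l u where l: "l \<in> L" "\<forall>y\<in>L. (y, l) \<in> r" and u: "u \<in> U" "\<forall>y\<in>U. (u, y) \<in> r"
      using min max by blast
    obtain z where "(l, z) \<in> r" "z \<noteq> l" "(z, u) \<in> r" "z \<noteq> u" using between LU[OF l(1) u(1)] by metis
    then show ?thesis using l(2) u(2) tr anti F by metis
  qed
qed

text \<open>A relation instead of a partial function, so that the back step is the forth step for
  the converse. Single-valuedness follows from reflexivity and antisymmetry.\<close>

definition partial_iso :: "'a rel \<Rightarrow> 'b rel \<Rightarrow> ('a \<times> 'b) set \<Rightarrow> bool" where
  "partial_iso r s P \<longleftrightarrow> P \<subseteq> Field r \<times> Field s \<and>
     (\<forall>(a, b)\<in>P. \<forall>(a', b')\<in>P. (a, a') \<in> r \<longleftrightarrow> (b, b') \<in> s)"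

lemma partial_iso_converse: "partial_iso r s P \<Longrightarrow> partial_iso s r (P\<inverse>)"
  unfolding partial_iso_def by fast

lemma partial_iso_extend:
  assumes r: "Linear_order r" and s: "unbounded_dense s"
    and P: "partial_iso r s P" "finite P" and a: "a \<in> Field r"
  shows "\<exists>b. partial_iso r s (insert (a, b) P)"
proof (cases "a \<in> Domain P")
  case True
  then obtain b where "(a, b) \<in> P" by blast
  then show ?thesis using P(1) by (metis insert_absorb)
next
  case False
  have s': "Linear_order s" using s unfolding unbounded_dense_def by blast
  note R = linear_order_onD[OF r] and S = linear_order_onD[OF s']
  let ?L = "{y. \<exists>x. (x, y) \<in> P \<and> (x, a) \<in> r}" and ?U = "{y. \<exists>x. (x, y) \<in> P \<and> (a, x) \<in> r}"
  have PF: "x \<in> Field r \<and> y \<in> Field s" if "(x, y) \<in> P" for x y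
    using P(1) that unfolding partial_iso_def by blast
  have Piff: "(x, x') \<in> r \<longleftrightarrow> (y, y') \<in> s" if "(x, y) \<in> P" "(x', y') \<in> P" for x y x' y'
    using P(1) that unfolding partial_iso_def by fast
  have "?L \<subseteq> Range P" "?U \<subseteq> Range P" by blast+
  then have fin: "finite ?L" "finite ?U" using P(2) by (meson finite_Range finite_subset)+
  have sub: "?L \<subseteq> Field s" "?U \<subseteq> Field s" using PF by blast+
  have LU: "(y, y') \<in> s \<and> y \<noteq> y'" if y: "y \<in> ?L" and y': "y' \<in> ?U" for y y'
  proof -
    obtain x x' where x: "(x, y) \<in> P" "(x, a) \<in> r" and x': "(x', y') \<in> P" "(a, x') \<in> r"
      using y y' by blast
    have ne: "x \<noteq> a" using x(1) False by blast
    have "(x, x') \<in> r" using R(2) x x' by blast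
    moreover have "(x', x) \<notin> r" using R(2,3) x x' ne by metis
    ultimately show ?thesis using Piff[OF x(1) x'(1)] Piff[OF x'(1) x(1)] by metis
  qed
  from unbounded_dense_between[OF s fin sub LU]
  obtain b where b: "b \<in> Field s" "\<forall>y\<in>?L. (y, b) \<in> s \<and> y \<noteq> b" "\<forall>y\<in>?U. (b, y) \<in> s \<and> b \<noteq> y"
    by blast
  have key: "((a, x) \<in> r \<longleftrightarrow> (b, y) \<in> s) \<and> ((x, a) \<in> r \<longleftrightarrow> (y, b) \<in> s)" if xy: "(x, y) \<in> P" for x y
  proof (cases "(a, x) \<in> r")
    case True
    then have "(b, y) \<in> s" "b \<noteq> y" using b(3) xy by blast+
    moreover have "(x, a) \<notin> r" using True xy False R(3) by blast
    ultimately show ?thesis using True S(3) by blast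
  next
    case 2: False
    then have "(x, a) \<in> r" using R(4) a PF[OF xy] by blast
    moreover then have "(y, b) \<in> s" "y \<noteq> b" using b(2) xy by blast+
    ultimately show ?thesis using 2 S(3) by blast
  qed
  have "(a, a) \<in> r" "(b, b) \<in> s" using R(1) S(1) a b(1) by auto
  then have "partial_iso r s (insert (a, b) P)"
    using P(1) a b(1) key unfolding partial_iso_def by auto
  then show ?thesis by blast
qed

text \<open>Back and forth: stage \<open>Suc n\<close> takes in the \<open>n\<close>-th element of
  each field, and the union of the stages is the graph of the isomorphism.\<close>

theorem cantor_order_isomorphic:
  assumes r: "unbounded_dense r" "countable (Field r)" and s: "unbounded_dense s" "countable (Field s)"
  shows "order_isomorphic r s"
proof -
  have lin: "Linear_order r" "Linear_order s" and ne: "Field r \<noteq> {}" "Field s \<noteq> {}"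
    using r s unfolding unbounded_dense_def by blast+
  let ?a = "from_nat_into (Field r)" and ?b = "from_nat_into (Field s)"
  have step: "\<exists>Q. (finite Q \<and> partial_iso r s Q) \<and> P \<subseteq> Q \<and> ?a n \<in> Domain Q \<and> ?b n \<in> Range Q"
    if P: "finite P \<and> partial_iso r s P" for P n
  proof -
    obtain b where b: "partial_iso r s (insert (?a n, b) P)"
      using partial_iso_extend[OF lin(1) s(1), of P "?a n"] P from_nat_into[OF ne(1), of n] by blast
    let ?Q = "insert (?a n, b) P"
    obtain a where a: "partial_iso s r (insert (?b n, a) (?Q\<inverse>))"
      using partial_iso_extend[OF lin(2) r(1) partial_iso_converse[OF b], of "?b n"] P
        from_nat_into[OF ne(2), of n] by auto
    have "(insert (?b n, a) (?Q\<inverse>))\<inverse> = insert (a, ?b n) ?Q" by auto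
    then have "partial_iso r s (insert (a, ?b n) ?Q)" using partial_iso_converse[OF a] by simp
    then show ?thesis using P by (intro exI[of _ "insert (a, ?b n) ?Q"]) auto
  qed
  have "\<exists>f. \<forall>n. (finite (f n) \<and> partial_iso r s (f n)) \<and>
      (f n \<subseteq> f (Suc n) \<and> ?a n \<in> Domain (f (Suc n)) \<and> ?b n \<in> Range (f (Suc n)))"
  proof (rule dependent_nat_choice)
    show "\<exists>P. finite P \<and> partial_iso r s P" by (rule exI[of _ "{}"]) (simp add: partial_iso_def)
  qed (use step in blast)
  then obtain f where f: "\<And>n. partial_iso r s (f n)" "\<And>n. f n \<subseteq> f (Suc n)"
    "\<And>n. ?a n \<in> Domain (f (Suc n))" "\<And>n. ?b n \<in> Range (f (Suc n))" by blast
  have mono: "m \<le> n \<Longrightarrow> f m \<subseteq> f n" for m n using f(2) by (simp add: lift_Suc_mono_le)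
  define P where "P = (\<Union>n. f n)"
  have iff: "(a, a') \<in> r \<longleftrightarrow> (b, b') \<in> s" if ab: "(a, b) \<in> P" "(a', b') \<in> P" for a a' b b'
  proof -
    obtain m n where "(a, b) \<in> f m" "(a', b') \<in> f n" using ab unfolding P_def by blast
    then have "(a, b) \<in> f (max m n)" "(a', b') \<in> f (max m n)" using mono by (meson max.cobounded1 max.cobounded2 subsetD)+
    then show ?thesis using f(1)[of "max m n"] unfolding partial_iso_def by fast
  qed
  have PF: "a \<in> Field r \<and> b \<in> Field s" if "(a, b) \<in> P" for a b
    using that f(1) unfolding P_def partial_iso_def by blast
  have dom: "\<exists>b. (a, b) \<in> P" if a: "a \<in> Field r" for a
    using f(3) from_nat_into_surj[OF r(2) a] unfolding P_def by blast
  have ran: "\<exists>a. (a, b) \<in> P" if b: "b \<in> Field s" for b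
    using f(4) from_nat_into_surj[OF s(2) b] unfolding P_def by blast
  obtain g where g: "\<And>a. a \<in> Field r \<Longrightarrow> (a, g a) \<in> P" using dom by metis
  have single: "b = b'" if "(a, b) \<in> P" "(a, b') \<in> P" for a b b'
    using iff[OF that] iff[OF that(2,1)] linear_order_onD(1)[OF lin(1)] linear_order_onD(3)[OF lin(2)] PF[OF that(1)] by blast
  have iffg: "(a, a') \<in> r \<longleftrightarrow> (g a, g a') \<in> s" if "a \<in> Field r" "a' \<in> Field r" for a a'
    using iff g that by blast
  have "inj_on g (Field r)"
    using iffg linear_order_onD(1,3)[OF lin(1)] by (metis inj_onI)
  moreover have "g ` Field r = Field s" using g PF ran single by blast
  ultimately show ?thesis using iffg unfolding order_isomorphic_def bij_betw_def by blast
qed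

lemma unbounded_dense_Q_order: "unbounded_dense Q_order" and Field_Q_order [simp]: "Field Q_order = UNIV"
proof -
  show F: "Field Q_order = UNIV" by (auto simp: Q_order_def Field_def)
  have "\<exists>y. y \<le> x \<and> y \<noteq> x" "\<exists>y. x \<le> y \<and> x \<noteq> y" for x :: rat
    by (rule exI[of _ "x - 1"], simp) (rule exI[of _ "x + 1"], simp)
  moreover have "\<exists>z. x \<le> z \<and> x \<noteq> z \<and> z \<le> y \<and> z \<noteq> y" if "x \<le> y" "x \<noteq> y" for x y :: rat
    using that dense[of x y] by (metis order.strict_iff_order)
  moreover have "Linear_order Q_order"
    unfolding F by (auto simp: order_on_defs refl_on_def trans_def antisym_def total_on_def Q_order_def)
  ultimately show "unbounded_dense Q_order"
    unfolding unbounded_dense_def F by (simp add: Q_order_def)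
qed

section \<open>Convex subgroups of ordered groups\<close>

locale ogroup = group G for G :: "'a monoid" (structure) +
  fixes r :: "'a rel"
  assumes lin: "linear_order_on (carrier G) r"
    and mult_mono: "\<And>a b g. a \<in> carrier G \<Longrightarrow> b \<in> carrier G \<Longrightarrow> g \<in> carrier G \<Longrightarrow> (a, b) \<in> r \<Longrightarrow>
      (a \<otimes> g, b \<otimes> g) \<in> r \<and> (g \<otimes> a, g \<otimes> b) \<in> r"
begin

abbreviation le (infix "\<preceq>" 50) where "x \<preceq> y \<equiv> (x, y) \<in> r"
abbreviation lt (infix "\<prec>" 50) where "x \<prec> y \<equiv> (x, y) \<in> r \<and> x \<noteq> y"

lemmas le_refl = linear_order_onD(1)[OF lin]
  and le_trans = linear_order_onD(2)[OF lin]
  and le_antisym = linear_order_onD(3)[OF lin]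
  and le_total = linear_order_onD(4)[OF lin]
  and le_carrier = linear_order_onD(5)[OF lin]

lemma le_lt_trans: "x \<preceq> y \<Longrightarrow> y \<prec> z \<Longrightarrow> x \<prec> z"
  and lt_le_trans: "x \<prec> y \<Longrightarrow> y \<preceq> z \<Longrightarrow> x \<prec> z"
  using le_trans[of x y z] le_antisym[of x y] le_antisym[of y z] by blast+

lemma not_le_lt: "x \<in> carrier G \<Longrightarrow> y \<in> carrier G \<Longrightarrow> \<not> x \<preceq> y \<longleftrightarrow> y \<prec> x"
  using le_total[of x y] le_antisym[of x y] le_refl[of x] by blast

lemma Field_r [simp]: "Field r = carrier G"
proof
  show "Field r \<subseteq> carrier G" using le_carrier unfolding Field_def by blast
  show "carrier G \<subseteq> Field r" using le_refl unfolding Field_def by blast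
qed

lemma mult_left_le: "x \<in> carrier G \<Longrightarrow> y \<in> carrier G \<Longrightarrow> g \<in> carrier G \<Longrightarrow> g \<otimes> x \<preceq> g \<otimes> y \<longleftrightarrow> x \<preceq> y"
proof
  assume c: "x \<in> carrier G" "y \<in> carrier G" "g \<in> carrier G" "g \<otimes> x \<preceq> g \<otimes> y"
  then have "inv g \<otimes> (g \<otimes> x) \<preceq> inv g \<otimes> (g \<otimes> y)"
    using mult_mono[of "g \<otimes> x" "g \<otimes> y" "inv g"] by simp
  then show "x \<preceq> y" using c by (simp add: m_assoc[symmetric])
qed (use mult_mono in blast)

lemma mult_left_lt: "x \<in> carrier G \<Longrightarrow> y \<in> carrier G \<Longrightarrow> g \<in> carrier G \<Longrightarrow> g \<otimes> x \<prec> g \<otimes> y \<longleftrightarrow> x \<prec> y"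
  using mult_left_le by simp

lemma mult_right_le: "x \<in> carrier G \<Longrightarrow> y \<in> carrier G \<Longrightarrow> g \<in> carrier G \<Longrightarrow> x \<otimes> g \<preceq> y \<otimes> g \<longleftrightarrow> x \<preceq> y"
proof
  assume c: "x \<in> carrier G" "y \<in> carrier G" "g \<in> carrier G" "x \<otimes> g \<preceq> y \<otimes> g"
  then have "x \<otimes> g \<otimes> inv g \<preceq> y \<otimes> g \<otimes> inv g"
    using mult_mono[of "x \<otimes> g" "y \<otimes> g" "inv g"] by simp
  then show "x \<preceq> y" using c by (simp add: m_assoc)
qed (use mult_mono in blast)

lemma inv_le:
  assumes "x \<in> carrier G" "y \<in> carrier G" "x \<preceq> y" shows "inv y \<preceq> inv x"
proof -
  have "inv x \<otimes> x \<preceq> inv x \<otimes> y" using assms mult_mono inv_closed by blast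
  then have "inv x \<otimes> x \<otimes> inv y \<preceq> inv x \<otimes> y \<otimes> inv y"
    using assms mult_mono[of "inv x \<otimes> x" "inv x \<otimes> y" "inv y"] by simp
  then show ?thesis using assms by (simp add: m_assoc)
qed

lemma one_le_inv_mult: "x \<in> carrier G \<Longrightarrow> y \<in> carrier G \<Longrightarrow> \<one> \<preceq> inv x \<otimes> y \<longleftrightarrow> x \<preceq> y"
  using mult_left_le[of x y "inv x"] by simp

lemma one_lt_inv_mult: "x \<in> carrier G \<Longrightarrow> y \<in> carrier G \<Longrightarrow> \<one> \<prec> inv x \<otimes> y \<longleftrightarrow> x \<prec> y"
  using mult_left_lt[of x y "inv x"] by simp

lemma mult_inv_cancel: "x \<in> carrier G \<Longrightarrow> y \<in> carrier G \<Longrightarrow> x \<otimes> (inv x \<otimes> y) = y"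
  and inv_mult_cancel: "x \<in> carrier G \<Longrightarrow> y \<in> carrier G \<Longrightarrow> inv x \<otimes> (x \<otimes> y) = y"
  by (simp_all add: m_assoc[symmetric])

lemma mult_le_mono:
  assumes "a \<preceq> b" "c \<preceq> d" shows "a \<otimes> c \<preceq> b \<otimes> d"
proof -
  have C: "a \<in> carrier G" "b \<in> carrier G" "c \<in> carrier G" "d \<in> carrier G" using assms le_carrier by blast+
  have "a \<otimes> c \<preceq> b \<otimes> c" "b \<otimes> c \<preceq> b \<otimes> d" using C assms mult_mono by blast+
  then show ?thesis using le_trans by blast
qed

text \<open>For a subgroup, convexity between \<one> and its elements yields convexity between any
  two elements by translation. Since the subgroup need not be normal, its quotient is only an
  ordered set of left cosets.\<close>

definition convex_sub :: "'a set \<Rightarrow> bool" where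
  "convex_sub H \<longleftrightarrow> subgroup H G \<and> (\<forall>x\<in>H. \<forall>g. \<one> \<preceq> g \<and> g \<preceq> x \<longrightarrow> g \<in> H)"

lemma convex_sub_subgroup: "convex_sub H \<Longrightarrow> subgroup H G"
  and convex_subD: "convex_sub H \<Longrightarrow> x \<in> H \<Longrightarrow> \<one> \<preceq> g \<Longrightarrow> g \<preceq> x \<Longrightarrow> g \<in> H"
  unfolding convex_sub_def by blast+

lemma convex_sub_carrier: "convex_sub H \<Longrightarrow> H \<subseteq> carrier G"
  by (simp add: convex_sub_subgroup subgroup.subset)

lemma convex_sub_one: "convex_sub H \<Longrightarrow> \<one> \<in> H"
  and convex_sub_inv: "convex_sub H \<Longrightarrow> x \<in> H \<Longrightarrow> inv x \<in> H"
  and convex_sub_mult: "convex_sub H \<Longrightarrow> x \<in> H \<Longrightarrow> y \<in> H \<Longrightarrow> x \<otimes> y \<in> H"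
  by (simp_all add: convex_sub_subgroup subgroup.one_closed subgroup.m_inv_closed subgroup.m_closed)

lemma convex_sub_positive:
  assumes "convex_sub K" "g \<in> carrier G" "g \<notin> K"
  obtains h where "h \<in> {g, inv g}" "\<one> \<prec> h" "h \<notin> K"
proof (cases "\<one> \<preceq> g")
  case True
  moreover have "\<one> \<in> K" using assms(1) convex_sub_one by blast
  ultimately show thesis using that[of g] assms(3) by blast
next
  case False
  then have "g \<preceq> \<one>" using le_total[of g \<one>] assms(2) by simp
  then have "\<one> \<preceq> inv g" using inv_le[of g \<one>] assms(2) by simp
  moreover have "\<one> \<in> K" using assms(1) convex_sub_one by blast
  moreover have "inv g \<notin> K"
    using convex_sub_inv[OF assms(1), of "inv g"] assms(2,3) by auto
  ultimately show thesis by (intro that[of "inv g"]) auto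
qed

text \<open>Take a positive element of each subgroup outside the other. The smaller of the two lies
  between \<one> and the larger, hence in the subgroup that it was to avoid.\<close>

lemma convex_sub_chain:
  assumes "convex_sub H" "convex_sub K" shows "H \<subseteq> K \<or> K \<subseteq> H"
proof (rule ccontr)
  assume "\<not> ?thesis"
  then obtain h k where hk: "h \<in> H" "h \<notin> K" "k \<in> K" "k \<notin> H" by blast
  have c: "h \<in> carrier G" "k \<in> carrier G" using hk assms convex_sub_carrier by blast+
  obtain h' where h': "h' \<in> {h, inv h}" "\<one> \<prec> h'" "h' \<notin> K" using convex_sub_positive[OF assms(2) c(1) hk(2)] .
  obtain k' where k': "k' \<in> {k, inv k}" "\<one> \<prec> k'" "k' \<notin> H" using convex_sub_positive[OF assms(1) c(2) hk(4)] .
  have "h' \<in> H" "k' \<in> K"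
    using h'(1) k'(1) hk(1,3) convex_sub_inv[OF assms(1)] convex_sub_inv[OF assms(2)] by auto
  moreover have "h' \<preceq> k' \<or> k' \<preceq> h'"
    using le_carrier h'(2) k'(2) le_total[of h' k'] by blast
  ultimately show False
    using h'(2,3) k'(2,3) convex_subD[OF assms(1), of h' k'] convex_subD[OF assms(2), of k' h'] by blast
qed

text \<open>Left cosets are ordered as blocks: were
  \<open>b \<otimes> k' \<preceq> a \<otimes> k\<close>, then \<open>inv a \<otimes> b\<close> would
  lie between \<one> and \<open>k \<otimes> inv k'\<close>, hence in \<open>K\<close>.\<close>

lemma coset_lt:
  assumes K: "convex_sub K" and ab: "a \<prec> b" "inv a \<otimes> b \<notin> K" and k: "k \<in> K" "k' \<in> K"
  shows "a \<otimes> k \<prec> b \<otimes> k'"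
proof -
  have sub: "subgroup K G" using K convex_sub_subgroup by blast
  have c: "a \<in> carrier G" "b \<in> carrier G" "k \<in> carrier G" "k' \<in> carrier G"
    using ab k le_carrier convex_sub_carrier[OF K] by blast+
  show ?thesis
  proof (rule ccontr)
    assume "\<not> ?thesis"
    then have "b \<otimes> k' \<preceq> a \<otimes> k" using not_le_lt[of "b \<otimes> k'" "a \<otimes> k"] c by auto
    then have "inv a \<otimes> (b \<otimes> k') \<preceq> inv a \<otimes> (a \<otimes> k)" using c mult_left_le[of "b \<otimes> k'" "a \<otimes> k" "inv a"] by simp
    then have "inv a \<otimes> b \<otimes> k' \<preceq> k" using c by (simp add: inv_mult_cancel m_assoc)
    then have "inv a \<otimes> b \<otimes> k' \<otimes> inv k' \<preceq> k \<otimes> inv k'"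
      using c mult_right_le[of "inv a \<otimes> b \<otimes> k'" k "inv k'"] by simp
    then have "inv a \<otimes> b \<preceq> k \<otimes> inv k'" using c by (simp add: m_assoc)
    moreover have "\<one> \<preceq> inv a \<otimes> b" using one_le_inv_mult[of a b] c ab by simp
    moreover have "k \<otimes> inv k' \<in> K" using k sub by (simp add: subgroup.m_closed subgroup.m_inv_closed)
    ultimately show False using convex_subD[OF K] ab(2) by blast
  qed
qed

lemma convex_sub_Inter:
  assumes "\<F> \<noteq> {}" "\<And>K. K \<in> \<F> \<Longrightarrow> convex_sub K" shows "convex_sub (\<Inter>\<F>)"
  unfolding convex_sub_def
proof (intro conjI ballI allI impI)
  show "subgroup (\<Inter>\<F>) G" using assms subgroups_Inter convex_sub_subgroup by simp
qed (use assms convex_subD in blast)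

lemma convex_sub_Union:
  assumes "\<F> \<noteq> {}" "\<And>K. K \<in> \<F> \<Longrightarrow> convex_sub K" shows "convex_sub (\<Union>\<F>)"
  unfolding convex_sub_def
proof (intro conjI ballI allI impI)
  show "subgroup (\<Union>\<F>) G"
  proof (rule subgroupI)
    show "\<Union>\<F> \<subseteq> carrier G" using assms(2) convex_sub_carrier by (simp add: Union_least)
    obtain K where "K \<in> \<F>" using assms(1) by blast
    then show "\<Union>\<F> \<noteq> {}" using convex_sub_one[OF assms(2)] by auto
  next
    fix a assume "a \<in> \<Union>\<F>"
    then obtain A where A: "A \<in> \<F>" "a \<in> A" by auto
    show "inv a \<in> \<Union>\<F>" using A(1) convex_sub_inv[OF assms(2)[OF A(1)] A(2)] by auto
  next
    fix a b assume "a \<in> \<Union>\<F>" "b \<in> \<Union>\<F>"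
    then obtain A B where AB: "A \<in> \<F>" "B \<in> \<F>" "a \<in> A" "b \<in> B" by auto
    have C: "convex_sub A" "convex_sub B" using AB assms(2) by auto
    from convex_sub_chain[OF this] show "a \<otimes> b \<in> \<Union>\<F>"
    proof
      assume "A \<subseteq> B"
      then show ?thesis using convex_sub_mult[OF C(2), of a b] AB by auto
    next
      assume "B \<subseteq> A"
      then show ?thesis using convex_sub_mult[OF C(1), of a b] AB by auto
    qed
  qed
next
  fix x g assume "x \<in> \<Union>\<F>" "\<one> \<preceq> g \<and> g \<preceq> x"
  then obtain A where "A \<in> \<F>" "x \<in> A" by auto
  then show "g \<in> \<Union>\<F>"
    using convex_subD[OF assms(2), of A x g] \<open>\<one> \<preceq> g \<and> g \<preceq> x\<close> by auto
qed

section \<open>Powers and the convex subgroup generated by one element\<close>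

lemma int_pow_pos:
  assumes "\<one> \<prec> t" "0 < (n::int)" shows "\<one> \<prec> t [^] n"
  using assms(2)
proof (induction rule: int_gr_induct)
  case base
  show ?case using assms(1) le_carrier[of \<one> t] by (simp add: int_pow_1)
next
  case (step i)
  have t: "t \<in> carrier G" using le_carrier[of \<one> t] assms(1) by simp
  have "t [^] i \<otimes> \<one> \<preceq> t [^] i \<otimes> t" using t assms(1) mult_left_le[of \<one> t "t [^] i"] by simp
  then have "t [^] i \<preceq> t [^] (i + 1)" using t by (simp add: int_pow_mult int_pow_1)
  then show ?case by (rule lt_le_trans[OF step.IH])
qed

lemma int_pow_strict_mono:
  assumes "\<one> \<prec> t" "(m::int) < n" shows "t [^] m \<prec> t [^] n"
proof -
  have t: "t \<in> carrier G" using le_carrier[of \<one> t] assms by simp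
  have "\<one> \<prec> t [^] (n - m)" using int_pow_pos[OF assms(1)] assms(2) by simp
  then have "t [^] m \<otimes> \<one> \<prec> t [^] m \<otimes> t [^] (n - m)"
    using t mult_left_lt[of \<one> "t [^] (n - m)" "t [^] m"] by simp
  then show ?thesis using t by (simp add: int_pow_mult[symmetric])
qed

text \<open>For \<open>\<one> \<preceq> t\<close> this is the smallest convex subgroup that contains
  \<open>t\<close>.\<close>

definition arch :: "'a \<Rightarrow> 'a set" where
  "arch t = {g. \<exists>(a::int) (b::int). t [^] a \<preceq> g \<and> g \<preceq> t [^] b}"

lemma convex_sub_arch:
  assumes "\<one> \<preceq> t" shows "convex_sub (arch t)"
proof -
  have t: "t \<in> carrier G" using le_carrier[of \<one> t] assms by simp
  have "subgroup (arch t) G"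
  proof (rule subgroupI)
    show "arch t \<subseteq> carrier G" unfolding arch_def by (auto dest: le_carrier)
    have "t [^] (0::int) \<preceq> \<one>" "\<one> \<preceq> t [^] (0::int)" using le_refl by simp_all
    then have "\<one> \<in> arch t" unfolding arch_def by blast
    then show "arch t \<noteq> {}" by blast
    show "inv g \<in> arch t" if g: "g \<in> arch t" for g
    proof -
      obtain a b :: int where ab: "t [^] a \<preceq> g" "g \<preceq> t [^] b" using g unfolding arch_def by blast
      have gc: "g \<in> carrier G" using le_carrier[OF ab(2)] by simp
      have "t [^] (- b) \<preceq> inv g" "inv g \<preceq> t [^] (- a)"
        using ab inv_le gc t by (simp_all add: int_pow_neg)
      then show ?thesis unfolding arch_def by blast
    qed
    show "g \<otimes> h \<in> arch t" if gh: "g \<in> arch t" "h \<in> arch t" for g h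
    proof -
      obtain a b :: int where ab: "t [^] a \<preceq> g" "g \<preceq> t [^] b" using gh unfolding arch_def by blast
      obtain c d :: int where cd: "t [^] c \<preceq> h" "h \<preceq> t [^] d" using gh unfolding arch_def by blast
      have "t [^] (a + c) \<preceq> g \<otimes> h" "g \<otimes> h \<preceq> t [^] (b + d)"
        using mult_le_mono ab cd t by (simp_all add: int_pow_mult)
      then show ?thesis unfolding arch_def by blast
    qed
  qed
  moreover have "g \<in> arch t" if x: "x \<in> arch t" and g: "\<one> \<preceq> g" "g \<preceq> x" for x g
  proof -
    obtain b :: int where "x \<preceq> t [^] b" using x unfolding arch_def by blast
    then have "g \<preceq> t [^] b" using le_trans[OF g(2)] by simp
    moreover have "t [^] (0::int) \<preceq> g" using g by simp
    ultimately show ?thesis unfolding arch_def by blast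
  qed
  ultimately show ?thesis unfolding convex_sub_def by blast
qed

lemma arch_self: "t \<in> carrier G \<Longrightarrow> t \<in> arch t"
proof -
  assume t: "t \<in> carrier G"
  then have "t [^] (1::int) \<preceq> t" "t \<preceq> t [^] (1::int)" using le_refl by (simp_all add: int_pow_1)
  then show "t \<in> arch t" unfolding arch_def by blast
qed

lemma arch_floor:
  assumes t: "\<one> \<prec> t" and g: "g \<in> arch t"
  obtains n :: int where "t [^] n \<preceq> g" "g \<prec> t [^] (n + 1)"
proof -
  have tc: "t \<in> carrier G" using t le_carrier[of \<one> t] by simp
  obtain a b :: int where ab: "t [^] a \<preceq> g" "g \<preceq> t [^] b" using g unfolding arch_def by blast
  have gc: "g \<in> carrier G" using le_carrier[OF ab(2)] by simp
  have "g \<prec> t [^] (b + 1)"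
    using le_lt_trans[OF ab(2) int_pow_strict_mono[OF t, of b "b + 1"]] by simp
  then have "\<not> t [^] (b + 1) \<preceq> g" using le_antisym by auto
  then have "\<exists>k::nat. \<not> t [^] (a + int k) \<preceq> g"
  \<comment> \<open>This shift leads from \<open>a\<close> to the exponent \<open>b + 1\<close>,
    whose power exceeds \<open>g\<close>; \<open>a \<le> b + 1\<close> is proved so that
    \<open>nat\<close> does not truncate.\<close>
  proof (intro exI[of _ "nat (b + 1 - a)"])
    have "a \<le> b + 1"
    proof (rule ccontr)
      assume "\<not> a \<le> b + 1"
      then have "t [^] (b + 1) \<prec> t [^] a" using int_pow_strict_mono[OF t] by simp
      then show False using le_trans[OF _ ab(1)] \<open>\<not> t [^] (b + 1) \<preceq> g\<close> by auto
    qed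
    then show "\<not> t [^] (a + int (nat (b + 1 - a))) \<preceq> g" using \<open>\<not> t [^] (b + 1) \<preceq> g\<close> by simp
  qed
  then obtain k where k: "\<not> t [^] (a + int k) \<preceq> g" "\<And>j. j < k \<Longrightarrow> t [^] (a + int j) \<preceq> g"
    using exists_least_iff[of "\<lambda>k. \<not> t [^] (a + int k) \<preceq> g"] by blast
  have "k \<noteq> 0" using k(1) ab(1) by (cases k) auto
  then obtain j where j: "k = Suc j" by (cases k) auto
  have "t [^] (a + int j) \<preceq> g" using k(2) j by simp
  moreover have "g \<prec> t [^] (a + int j + 1)" using k(1) j not_le_lt[of "t [^] (a + int k)" g] tc gc
    by (simp add: ac_simps)
  ultimately show thesis using that by blast
qed

section \<open>Left cosets and their representatives\<close>

definition coset_rep :: "'a set \<Rightarrow> 'a \<Rightarrow> 'a" where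
  "coset_rep K x = (SOME y. y \<in> carrier G \<and> inv x \<otimes> y \<in> K)"

context
  fixes K assumes K: "convex_sub K"
begin

lemma same_coset_sym:
  assumes "x \<in> carrier G" "y \<in> carrier G" "inv x \<otimes> y \<in> K" shows "inv y \<otimes> x \<in> K"
proof -
  have "inv (inv x \<otimes> y) \<in> K" using assms K convex_sub_inv by blast
  then show ?thesis using assms by (simp add: inv_mult_group)
qed

lemma same_coset_trans:
  assumes "x \<in> carrier G" "y \<in> carrier G" "z \<in> carrier G" "inv x \<otimes> y \<in> K" "inv y \<otimes> z \<in> K"
  shows "inv x \<otimes> z \<in> K"
proof -
  have "(inv x \<otimes> y) \<otimes> (inv y \<otimes> z) \<in> K"
    using assms K convex_sub_mult by blast
  then show ?thesis using assms by (simp add: m_assoc mult_inv_cancel)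
qed

lemma coset_rep:
  assumes "x \<in> carrier G"
  shows "coset_rep K x \<in> carrier G" "inv x \<otimes> coset_rep K x \<in> K"
proof -
  have "x \<in> carrier G \<and> inv x \<otimes> x \<in> K"
    using assms convex_sub_one[OF K] by simp
  then have "coset_rep K x \<in> carrier G \<and> inv x \<otimes> coset_rep K x \<in> K"
    unfolding coset_rep_def by (rule someI)
  then show "coset_rep K x \<in> carrier G" "inv x \<otimes> coset_rep K x \<in> K" by blast+
qed

text \<open>Elements of one left coset define the same predicate under \<open>SOME\<close>, so the
  choice depends on the coset alone. The quotient can thus be carried by a subset of the group, with
  the order \<open>r\<close>.\<close>

lemma coset_rep_eq_iff:
  assumes "x \<in> carrier G" "y \<in> carrier G"
  shows "coset_rep K x = coset_rep K y \<longleftrightarrow> inv x \<otimes> y \<in> K"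
proof
  assume "coset_rep K x = coset_rep K y"
  then show "inv x \<otimes> y \<in> K"
    using same_coset_trans[of x "coset_rep K x" y] same_coset_sym[of y "coset_rep K y"]
      coset_rep[OF assms(1)] coset_rep[OF assms(2)] assms by simp
next
  assume xy: "inv x \<otimes> y \<in> K"
  have "inv x \<otimes> z \<in> K \<longleftrightarrow> inv y \<otimes> z \<in> K" if "z \<in> carrier G" for z
    using same_coset_trans[of x y z] same_coset_trans[of y x z] same_coset_sym[of x y] assms xy that
    by blast
  then have "(\<lambda>z. z \<in> carrier G \<and> inv x \<otimes> z \<in> K) = (\<lambda>z. z \<in> carrier G \<and> inv y \<otimes> z \<in> K)" by blast
  then show "coset_rep K x = coset_rep K y" unfolding coset_rep_def by simp
qed

lemma coset_rep_coset_rep: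
  assumes "x \<in> carrier G" shows "coset_rep K (coset_rep K x) = coset_rep K x"
  using coset_rep_eq_iff[OF coset_rep(1)[OF assms] assms] coset_rep[OF assms]
    same_coset_sym[OF assms] by simp

lemma coset_rep_lt:
  assumes "x \<prec> y" "inv x \<otimes> y \<notin> K" shows "coset_rep K x \<prec> coset_rep K y"
proof -
  have c: "x \<in> carrier G" "y \<in> carrier G" using assms le_carrier[of x y] by simp_all
  show ?thesis
    using coset_lt[OF K assms coset_rep(2)[OF c(1)] coset_rep(2)[OF c(2)]]
    by (simp add: mult_inv_cancel coset_rep c)
qed

end

end

section \<open>Least positive cosets\<close>

context ogroup
begin

lemma r_trans: "trans r" and r_antisym: "antisym r" and r_total: "total_on (carrier G) r"
  using lin unfolding order_on_defs by blast+

definition least_pos :: "'a set \<Rightarrow> 'a \<Rightarrow> bool" where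
  "least_pos K t \<longleftrightarrow> \<one> \<prec> t \<and> t \<notin> K \<and>
     (\<forall>g. \<one> \<prec> g \<and> g \<preceq> t \<and> g \<notin> K \<longrightarrow> inv t \<otimes> g \<in> K)"

lemma least_pos_exists:
  assumes K: "convex_sub K" and H: "convex_sub H" and KH: "K \<subset> H" and sc: "scattered r H"
  shows "\<exists>t. least_pos K t"
proof (rule ccontr)
  assume none: "\<nexists>t. least_pos K t"
  let ?D = "coset_rep K ` H"
  have Hc: "H \<subseteq> carrier G" using convex_sub_carrier[OF H] .
  have rep: "coset_rep K x \<in> H" if x: "x \<in> H" for x
  proof -
    have xc: "x \<in> carrier G" using x Hc by blast
    have "x \<otimes> (inv x \<otimes> coset_rep K x) \<in> H"
      using convex_sub_mult[OF H x] coset_rep(2)[OF K xc] KH by blast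
    then show ?thesis by (simp add: mult_inv_cancel xc coset_rep[OF K])
  qed
  have "dense_set r ?D"
    unfolding dense_set_def
  proof (intro conjI ballI impI)
    obtain g where g: "g \<in> H" "g \<notin> K" using KH by blast
    have one: "\<one> \<in> H" using convex_sub_one[OF H] .
    have "coset_rep K \<one> \<noteq> coset_rep K g"
      using coset_rep_eq_iff[OF K, of \<one> g] g Hc by auto
    then show "\<exists>x\<in>?D. \<exists>y\<in>?D. x \<noteq> y" using one g(1) by blast
  next
    fix x y assume xy: "x \<in> ?D" "y \<in> ?D" "x \<prec> y"
    then have xH: "x \<in> H" "y \<in> H" using rep by blast+
    have c: "x \<in> carrier G" "y \<in> carrier G" using xH Hc by blast+
    have fx: "coset_rep K x = x" "coset_rep K y = y"
      using xy(1,2) coset_rep_coset_rep[OF K] Hc by (auto simp: subset_iff)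
    \<comment> \<open>The gap from \<open>x\<close> to \<open>y\<close> is translated so as to start
      at \<one>. As \<open>t\<close> does not represent a least positive coset, some positive
      \<open>g\<close> below it lies in a coset other than those of \<one> and \<open>t\<close>;
      \<open>x \<otimes> g\<close> then represents a coset strictly between those of
      \<open>x\<close> and \<open>y\<close>.\<close>
    define t where "t = inv x \<otimes> y"
    have tc: "t \<in> carrier G" using c by (simp add: t_def)
    have t: "\<one> \<prec> t" using one_lt_inv_mult[OF c] xy(3) unfolding t_def by blast
    have tK: "t \<notin> K" using coset_rep_eq_iff[OF K c] fx xy(3) unfolding t_def by auto
    obtain g where g: "\<one> \<prec> g" "g \<preceq> t" "g \<notin> K" "inv t \<otimes> g \<notin> K"
      using none t tK unfolding least_pos_def by blast
    have gc: "g \<in> carrier G" using le_carrier[OF g(2)] by simp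
    have "t \<in> H" unfolding t_def using convex_sub_mult[OF H convex_sub_inv[OF H]] xH by blast
    then have gH: "g \<in> H" using convex_subD[OF H _ _ g(2)] g(1) by blast
    let ?z = "coset_rep K (x \<otimes> g)"
    have xg: "x \<otimes> g \<in> carrier G" using c gc by simp
    have "x \<otimes> \<one> \<prec> x \<otimes> g" using mult_left_lt[of \<one> g x] g(1) c gc by blast
    then have "x \<prec> x \<otimes> g" using c by simp
    moreover have "inv x \<otimes> (x \<otimes> g) \<notin> K" using g(3) c gc by (simp add: inv_mult_cancel)
    ultimately have xz: "x \<prec> ?z" using coset_rep_lt[OF K, of x "x \<otimes> g"] fx(1) by simp
    have "g \<noteq> t" using g(4) convex_sub_one[OF K] tc by auto
    then have "x \<otimes> g \<prec> x \<otimes> t" using mult_left_lt[of g t x] g(2) c gc tc by blast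
    then have "x \<otimes> g \<prec> y" using c unfolding t_def by (simp add: mult_inv_cancel)
    moreover have "inv (x \<otimes> g) \<otimes> y \<notin> K"
    proof
      assume "inv (x \<otimes> g) \<otimes> y \<in> K"
      then have "inv y \<otimes> (x \<otimes> g) \<in> K" using same_coset_sym[OF K] xg c by blast
      moreover have "inv t \<otimes> g = inv y \<otimes> (x \<otimes> g)"
        using c gc unfolding t_def by (simp add: inv_mult_group m_assoc)
      ultimately show False using g(4) by simp
    qed
    ultimately have "?z \<prec> y" using coset_rep_lt[OF K, of "x \<otimes> g" y] fx(2) by simp
    moreover have "?z \<in> ?D" using convex_sub_mult[OF H xH(1) gH] by blast
    ultimately show "\<exists>z\<in>?D. (x, z) \<in> r \<and> x \<noteq> z \<and> (z, y) \<in> r \<and> z \<noteq> y" using xz by blast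
  qed
  moreover have "?D \<subseteq> H" using rep by blast
  ultimately show False using sc unfolding scattered_def by blast
qed

text \<open>Take a positive \<open>g\<close> in \<open>H\<close> outside \<open>K\<close>. Either
  \<open>t \<preceq> g\<close> and convexity applies, or \<open>g\<close> lies in the coset of
  \<open>t\<close>, and \<open>t\<close> is recovered from \<open>g\<close> and an element of
  \<open>K\<close>.\<close>

lemma least_pos_in:
  assumes t: "least_pos K t" and K: "convex_sub K" and H: "convex_sub H" and KH: "K \<subset> H"
  shows "t \<in> H"
proof -
  obtain g0 where g0: "g0 \<in> H" "g0 \<notin> K" using KH by blast
  have g0c: "g0 \<in> carrier G" using g0 convex_sub_carrier[OF H] by blast
  obtain g where g: "g \<in> {g0, inv g0}" "\<one> \<prec> g" "g \<notin> K"
    using convex_sub_positive[OF K g0c g0(2)] .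
  have gH: "g \<in> H" using g(1) g0(1) convex_sub_inv[OF H] by auto
  have c: "g \<in> carrier G" "t \<in> carrier G"
    using le_carrier[of \<one> g] le_carrier[of \<one> t] g(2) t unfolding least_pos_def by blast+
  show ?thesis
  proof (cases "t \<preceq> g")
    case True
    then show ?thesis using convex_subD[OF H gH _ True] t unfolding least_pos_def by blast
  next
    case False
    then have "g \<preceq> t" using le_total c by blast
    then have "inv t \<otimes> g \<in> H" using t g KH unfolding least_pos_def by blast
    then have "g \<otimes> inv (inv t \<otimes> g) \<in> H" using convex_sub_mult[OF H gH] convex_sub_inv[OF H] by blast
    then show ?thesis using c by (simp add: inv_mult_group mult_inv_cancel)
  qed
qed

text \<open>The floor exponent leaves a remainder between \<one> and \<open>t\<close>. If it is not
  in \<open>K\<close>, minimality puts it in the coset of \<open>t\<close>, and raising the exponent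
  by one leaves a remainder in \<open>K\<close>.\<close>

lemma least_pos_division:
  assumes t: "least_pos K t" and K: "convex_sub K" and g: "g \<in> arch t"
  obtains n :: int and h where "h \<in> K" "g = t [^] n \<otimes> h"
proof -
  have t1: "\<one> \<prec> t" using t unfolding least_pos_def by blast
  have tc: "t \<in> carrier G" using t1 le_carrier[of \<one> t] by simp
  obtain n :: int where n: "t [^] n \<preceq> g" "g \<prec> t [^] (n + 1)" using arch_floor[OF t1 g] .
  have gc: "g \<in> carrier G" using le_carrier[OF n(1)] by simp
  define h where "h = inv (t [^] n) \<otimes> g"
  have hc: "h \<in> carrier G" using tc gc unfolding h_def by simp
  have geq: "g = t [^] n \<otimes> h" unfolding h_def using tc gc by (simp add: mult_inv_cancel)
  show thesis
  proof (cases "h \<in> K")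
    case True then show thesis using that geq by blast
  next
    case False
    have "\<one> \<preceq> h" unfolding h_def using one_le_inv_mult n(1) tc gc by simp
    then have 1: "\<one> \<prec> h" using False convex_sub_one[OF K] by auto
    have "t [^] n \<otimes> h \<preceq> t [^] n \<otimes> t" using n(2) geq tc by (simp add: int_pow_mult int_pow_1)
    then have "h \<preceq> t" using mult_left_le[of h t "t [^] n"] hc tc by simp
    then have "inv t \<otimes> h \<in> K" using t 1 False unfolding least_pos_def by blast
    moreover have "g = t [^] (n + 1) \<otimes> (inv t \<otimes> h)"
      using geq tc hc by (simp add: int_pow_mult int_pow_1 m_assoc mult_inv_cancel)
    ultimately show thesis using that by blast
  qed
qed

text \<open>The lower subgroup of the convex jump at \<open>g\<close>, as the union of a chain. For
  nontrivial \<open>g\<close> in the scattered subgroup, its least positive coset will provide the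
  highest place in the expansion of \<open>g\<close>.\<close>

definition largest_avoiding :: "'a \<Rightarrow> 'a set" where
  "largest_avoiding g = \<Union>{K. convex_sub K \<and> g \<notin> K}"

lemma convex_sub_trivial: "convex_sub {\<one>}"
  unfolding convex_sub_def using le_antisym
  by (auto intro: triv_subgroup)

lemma largest_avoiding:
  assumes "g \<noteq> \<one>"
  shows "convex_sub (largest_avoiding g)" "g \<notin> largest_avoiding g"
    "\<And>K. convex_sub K \<Longrightarrow> g \<notin> K \<Longrightarrow> K \<subseteq> largest_avoiding g"
proof -
  have "{\<one>} \<in> {K. convex_sub K \<and> g \<notin> K}" using assms convex_sub_trivial by simp
  then have "{K. convex_sub K \<and> g \<notin> K} \<noteq> {}" by blast
  then show "convex_sub (largest_avoiding g)"
    unfolding largest_avoiding_def by (rule convex_sub_Union) simp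
qed (auto simp: largest_avoiding_def)

end

section \<open>Convex subgroups with scattered order\<close>

lemma fin_supp_upd_0:
  assumes "f \<in> fin_supp r" "f m \<noteq> 0"
  shows "f(m := 0) \<in> fin_supp r" "card {s. (f(m := 0)) s \<noteq> 0} < card {s. f s \<noteq> 0}"
proof -
  have s: "{s. (f(m := 0)) s \<noteq> 0} = {s. f s \<noteq> 0} - {m}" by auto
  show "f(m := 0) \<in> fin_supp r" using assms(1) unfolding fin_supp_def mem_Collect_eq s by blast
  show "card {s. (f(m := 0)) s \<noteq> 0} < card {s. f s \<noteq> 0}"
    unfolding s using assms by (intro card_Diff1_less) (auto simp: fin_supp_def)
qed

locale scattered_convex_sub = ogroup +
  fixes H
  assumes H: "convex_sub H" and H_scattered: "scattered r H"
begin

abbreviation proper :: "'a set \<Rightarrow> bool" where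
  "proper K \<equiv> convex_sub K \<and> K \<subset> H"

definition lead :: "'a set \<Rightarrow> 'a" where
  "lead K = (SOME t. least_pos K t)"

lemma least_pos_lead: "proper K \<Longrightarrow> least_pos K (lead K)"
  unfolding lead_def using least_pos_exists[OF _ H _ H_scattered, of K] by (rule someI_ex) simp_all

lemma lead_pos: "proper K \<Longrightarrow> \<one> \<prec> lead K"
  and lead_notin: "proper K \<Longrightarrow> lead K \<notin> K"
  using least_pos_lead unfolding least_pos_def by blast+

lemma lead_in: "proper K \<Longrightarrow> convex_sub K' \<Longrightarrow> K \<subset> K' \<Longrightarrow> lead K \<in> K'"
  using least_pos_in[OF least_pos_lead] by blast

lemma lead_in_H: "proper K \<Longrightarrow> lead K \<in> H"
  using lead_in[OF _ H] by blast

lemma lead_carrier: "proper K \<Longrightarrow> lead K \<in> carrier G"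
  using lead_in_H convex_sub_carrier[OF H] by blast

text \<open>For \<open>K \<subset> K'\<close>, the element \<open>lead K\<close> already lies in
  \<open>K'\<close>, whereas \<open>lead K'\<close> is positive and outside \<open>K'\<close>, so
  convexity puts it higher.\<close>

lemma lead_mono:
  assumes "proper K" "proper K'" shows "lead K \<prec> lead K' \<longleftrightarrow> K \<subset> K'"
proof -
  have *: "lead K \<prec> lead K'" if "proper K" "proper K'" "K \<subset> K'" for K K'
  proof -
    have in': "lead K \<in> K'" using lead_in[of K K'] that by blast
    have "\<not> lead K' \<preceq> lead K"
      using convex_subD[of K' "lead K" "lead K'"] in' lead_pos[OF that(2)] lead_notin[OF that(2)] that(2)
      by blast
    then show ?thesis using not_le_lt[OF lead_carrier[OF that(2)] lead_carrier[OF that(1)]] by blast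
  qed
  show ?thesis
  proof
    assume lt: "lead K \<prec> lead K'"
    have "K \<subseteq> K' \<or> K' \<subseteq> K" using convex_sub_chain[of K K'] assms by blast
    moreover have "\<not> K' \<subset> K"
      using *[OF assms(2,1)] lt le_antisym[of "lead K" "lead K'"] by blast
    ultimately show "K \<subset> K'" using lt by blast
  qed (use * assms in blast)
qed

text \<open>The exponent is indexed by these elements in place of the subgroups. The resulting
  well-order is then a restriction of \<open>r\<close>, and for a group on numbers it has the type
  over which \<open>OG_eps\<close> quantifies its ordinals.\<close>

definition leads :: "'a set" where
  "leads = lead ` {K. proper K}"

definition below :: "'a \<Rightarrow> 'a set" where
  "below t = (SOME K. proper K \<and> lead K = t)"

lemma below: "t \<in> leads \<Longrightarrow> proper (below t) \<and> lead (below t) = t"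
  unfolding below_def by (rule someI_ex) (auto simp: leads_def)

lemma leads_subset: "leads \<subseteq> carrier G"
  unfolding leads_def using lead_carrier by blast

lemma lead_leads: "proper K \<Longrightarrow> lead K \<in> leads"
  unfolding leads_def by blast

lemma below_mono:
  assumes "s \<in> leads" "t \<in> leads" "s \<prec> t" shows "s \<in> below t"
proof -
  note bs = below[OF assms(1)] and bt = below[OF assms(2)]
  have "below s \<subset> below t" using lead_mono[of "below s" "below t"] bs bt assms(3) by simp
  then have "lead (below s) \<in> below t" using lead_in[of "below s" "below t"] bs bt by blast
  then show ?thesis using bs by simp
qed

abbreviation \<alpha> :: "'a rel" where "\<alpha> \<equiv> Restr r leads"

lemma Field_\<alpha>: "Field \<alpha> = leads"
proof
  show "leads \<subseteq> Field \<alpha>"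
  proof
    fix x assume x: "x \<in> leads"
    then have "(x, x) \<in> \<alpha>" using leads_subset le_refl[of x] by auto
    then show "x \<in> Field \<alpha>" by (rule FieldI1)
  qed
qed (auto simp: Field_def)

lemma Linear_order_\<alpha>: "Linear_order \<alpha>"
proof -
  have "Linear_order r" using lin by simp
  then show ?thesis by (rule Linear_order_Restr)
qed

text \<open>Intersect the subgroups belonging to the leads in \<open>Q\<close>. If the intersection
  were not one of them, it would be properly contained in each, so its lead would lie in each of
  them and thus in the intersection, which it must avoid.\<close>

lemma Well_order_\<alpha>: "Well_order \<alpha>"
proof -
  have "wf (\<alpha> - Id)"
    unfolding wf_eq_minimal
  proof (intro allI impI)
    fix x and Q :: "'a set" assume x: "x \<in> Q"
    show "\<exists>z\<in>Q. \<forall>y. (y, z) \<in> \<alpha> - Id \<longrightarrow> y \<notin> Q"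
    proof (cases "Q \<inter> leads = {}")
      case True
      then show ?thesis using x by blast
    next
      case False
      let ?F = "below ` (Q \<inter> leads)"
      have F: "\<And>K. K \<in> ?F \<Longrightarrow> proper K" using below by blast
      let ?K = "\<Inter>?F"
      have K: "proper ?K"
      proof
        show "convex_sub ?K" using convex_sub_Inter[of ?F] False F by blast
        obtain t where "t \<in> Q \<inter> leads" using False by blast
        then have "below t \<in> ?F" by blast
        then show "?K \<subset> H" using F[of "below t"] by blast
      qed
      have "?K \<in> ?F"
      proof (rule ccontr)
        assume no: "?K \<notin> ?F"
        have "lead ?K \<in> K'" if K': "K' \<in> ?F" for K'
        proof -
          have "?K \<noteq> K'" using no K' by metis
          then have "?K \<subset> K'" using K' by blast
          then show ?thesis using lead_in[OF K] F[OF K'] by blast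
        qed
        then have "lead ?K \<in> ?K" by blast
        then show False using lead_notin[OF K] by blast
      qed
      then obtain t where t: "t \<in> Q \<inter> leads" "below t = ?K" by auto
      have "(y, t) \<notin> \<alpha> - Id" if y: "y \<in> Q" for y
      proof
        assume yt: "(y, t) \<in> \<alpha> - Id"
        then have "y \<in> below t" using below_mono[of y t] t by blast
        moreover have "?K \<subseteq> below y" using y yt by blast
        ultimately have "y \<in> below y" using t by blast
        then show False using lead_notin[of "below y"] below[of y] yt by auto
      qed
      then show ?thesis using t by blast
    qed
  qed
  then show ?thesis unfolding well_order_on_def using Linear_order_\<alpha> by blast
qed

text \<open>\<open>expansion f g\<close>: \<open>g\<close> is the product of the powers \<open>t [^] f t\<close>, in descending order of \<open>t\<close>.\<close>

inductive expansion :: "('a \<Rightarrow> int) \<Rightarrow> 'a \<Rightarrow> bool" where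
  expansion_0: "expansion (\<lambda>_. 0) \<one>"
| expansion_Cons: "expansion f g \<Longrightarrow> t \<in> leads \<Longrightarrow> (\<And>s. f s \<noteq> 0 \<Longrightarrow> s \<prec> t) \<Longrightarrow>
    expansion (f(t := n)) (t [^] n \<otimes> g)"

lemma convex_sub_int_pow: "convex_sub K \<Longrightarrow> t \<in> K \<Longrightarrow> t [^] (n::int) \<in> K"
  by (simp add: convex_sub_subgroup subgroup_int_pow_closed)

lemma expansion_in:
  assumes "expansion f g" "convex_sub K" "\<And>s. f s \<noteq> 0 \<Longrightarrow> s \<in> K" shows "g \<in> K"
  using assms
proof (induction)
  case expansion_0
  then show ?case using convex_sub_one by blast
next
  case (expansion_Cons f g t n)
  have "f s \<noteq> 0 \<Longrightarrow> s \<in> K" for s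
    using expansion_Cons.prems(2)[of s] expansion_Cons.hyps(3)[of s] by auto
  then have g: "g \<in> K" using expansion_Cons.IH expansion_Cons.prems(1) by blast
  have tc: "t \<in> carrier G" using expansion_Cons.hyps leads_subset by blast
  have "t [^] n \<in> K"
  proof (cases "n = 0")
    case True then show ?thesis using convex_sub_one expansion_Cons.prems(1) by simp
  next
    case False
    then have "t \<in> K" using expansion_Cons.prems(2)[of t] by simp
    then show ?thesis using convex_sub_int_pow[OF expansion_Cons.prems(1)] by blast
  qed
  then show ?case using g convex_sub_mult[OF expansion_Cons.prems(1)] by blast
qed

lemma expansion_leads: "expansion f g \<Longrightarrow> f s \<noteq> 0 \<Longrightarrow> s \<in> leads"
  by (induction rule: expansion.induct) (auto split: if_splits)

lemma expansion_H: "expansion f g \<Longrightarrow> g \<in> H"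
proof -
  assume e: "expansion f g"
  have "s \<in> H" if "f s \<noteq> 0" for s
    using expansion_leads[OF e that] lead_in_H unfolding leads_def by blast
  then show "g \<in> H" using expansion_in[OF e H] by blast
qed

text \<open>The place added last need not be \<open>t\<close>, because \<open>expansion_Cons\<close>
  admits \<open>n = 0\<close>. A zero power at another place is passed over; a nonzero one lies
  below \<open>t\<close> and forces the exponent at \<open>t\<close> to be 0, so that the whole
  product is the remainder.\<close>

lemma expansion_top:
  assumes "expansion f g" "t \<in> leads" "\<And>s. f s \<noteq> 0 \<Longrightarrow> s \<preceq> t"
  obtains u where "expansion (f(t := 0)) u" "g = t [^] f t \<otimes> u" "u \<in> below t"
proof -
  have tc: "t \<in> carrier G" using assms(2) leads_subset by blast
  have "\<exists>u. expansion (f(t := 0)) u \<and> g = t [^] f t \<otimes> u"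
    using assms
  proof (induction)
    case expansion_0
    have "(\<lambda>_. 0 :: int)(t := 0) = (\<lambda>_. 0)" by auto
    then have "expansion ((\<lambda>_. 0)(t := 0)) \<one>" using expansion.expansion_0 by metis
    then show ?case by (intro exI[of _ \<one>] conjI) (simp_all only: int_pow_0 r_one one_closed)
  next
    case (expansion_Cons f g t' n)
    have gc: "g \<in> carrier G" using expansion_H[OF expansion_Cons.hyps(1)] convex_sub_carrier[OF H] by blast
    have ft': "f t' = 0" using expansion_Cons.hyps(3)[of t'] by blast
    show ?case
    proof (cases "t' = t")
      case True
      have "(f(t' := n))(t := 0) = f" using True ft' by auto
      moreover have "(f(t' := n)) t = n" using True by simp
      ultimately show ?thesis using expansion_Cons.hyps(1) True by metis
    next
      case ne: False
      show ?thesis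
      proof (cases "n = 0")
        case True
        then have eq: "f(t' := n) = f" using ft' by auto
        have "\<exists>u. expansion (f(t := 0)) u \<and> g = t [^] f t \<otimes> u"
          using expansion_Cons.IH expansion_Cons.prems unfolding eq .
        moreover have "t' [^] n \<otimes> g = g" using True gc by simp
        ultimately show ?thesis unfolding eq by metis
      next
        case False
        then have "t' \<preceq> t" using expansion_Cons.prems(2)[of t'] by simp
        then have "f t = 0" using expansion_Cons.hyps(3)[of t] le_antisym[of t t'] ne by auto
        then have ft: "(f(t' := n)) t = 0" using ne by simp
        then have "(f(t' := n))(t := 0) = f(t' := n)" by (rule fun_upd_idem)
        moreover have "expansion (f(t' := n)) (t' [^] n \<otimes> g)"
          using expansion.expansion_Cons expansion_Cons.hyps by blast
        moreover have "t' [^] n \<otimes> g \<in> carrier G"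
          using gc leads_subset expansion_Cons.hyps(2) by (simp add: subset_iff)
        ultimately show ?thesis using ft by (metis int_pow_0 l_one)
      qed
    qed
  qed
  then obtain u where u: "expansion (f(t := 0)) u" "g = t [^] f t \<otimes> u" by blast
  have "s \<in> below t" if s: "(f(t := 0)) s \<noteq> 0" for s
  proof -
    have "s \<noteq> t" "f s \<noteq> 0" using s by (auto split: if_splits)
    then have "s \<prec> t" using assms(3) by blast
    then show ?thesis using below_mono[OF expansion_leads[OF u(1) s] assms(2)] by blast
  qed
  then have "u \<in> below t" using expansion_in[OF u(1)] below[OF assms(2)] by blast
  then show thesis using that u by blast
qed

lemma expansion_exists:
  assumes "f \<in> fin_supp \<alpha>" shows "\<exists>g. expansion f g"
  using assms
proof (induction "card {s. f s \<noteq> 0}" arbitrary: f rule: less_induct)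
  case less
  have fin: "finite {s. f s \<noteq> 0}" and sub: "{s. f s \<noteq> 0} \<subseteq> leads"
    using less.prems unfolding fin_supp_def Field_\<alpha> by blast+
  show ?case
  proof (cases "{s. f s \<noteq> 0} = {}")
    case True
    then have "f = (\<lambda>_. 0)" by auto
    then show ?thesis using expansion_0 by blast
  next
    case False
    obtain m where m: "f m \<noteq> 0" "\<And>s. f s \<noteq> 0 \<Longrightarrow> (s, m) \<in> \<alpha>"
      using finite_rel_max[OF Linear_order_\<alpha> fin False] sub unfolding Field_\<alpha> by blast
    obtain g where g: "expansion (f(m := 0)) g"
      using less.hyps[OF fin_supp_upd_0(2,1)[OF less.prems m(1)]] by blast
    have "expansion ((f(m := 0))(m := f m)) (m [^] f m \<otimes> g)"
    proof (rule expansion_Cons[OF g])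
      show "m \<in> leads" using m(1) sub by blast
      show "s \<prec> m" if "(f(m := 0)) s \<noteq> 0" for s using that m(2)[of s] by (auto split: if_splits)
    qed
    then show ?thesis by auto
  qed
qed

text \<open>Compare at the largest place \<open>m\<close> of the joint support. Equal powers cancel
  and the remainders are compared by induction. Otherwise \<open>m\<close> is the deciding place
  \<open>x\<close>, and the two powers lie in different left cosets of \<open>below m\<close>, whose
  order the remainders cannot change.\<close>

lemma expansion_strict_mono:
  assumes "expansion f g" "expansion f' g'" "f \<in> fin_supp \<alpha>" "f' \<in> fin_supp \<alpha>"
    "f x < f' x" "\<And>y. f y \<noteq> f' y \<Longrightarrow> (y, x) \<in> \<alpha>"
  shows "g \<prec> g'"
  using assms
proof (induction "card ({s. f s \<noteq> 0} \<union> {s. f' s \<noteq> 0})" arbitrary: f g f' g' rule: less_induct)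
  case less
  let ?S = "\<lambda>f f' :: 'a \<Rightarrow> int. {s. f s \<noteq> 0} \<union> {s. f' s \<noteq> 0}"
  have fin: "finite (?S f f')" and sub: "?S f f' \<subseteq> leads"
    using less.prems(3,4) unfolding fin_supp_def Field_\<alpha> by blast+
  have xS: "x \<in> ?S f f'" using less.prems(5) by auto
  then have ne: "?S f f' \<noteq> {}" by blast
  obtain m where m: "m \<in> ?S f f'" "\<And>s. s \<in> ?S f f' \<Longrightarrow> (s, m) \<in> \<alpha>"
    using finite_rel_max[OF Linear_order_\<alpha> fin ne] sub unfolding Field_\<alpha> by blast
  have ml: "m \<in> leads" using m(1) sub by blast
  have mc: "m \<in> carrier G" using ml leads_subset by blast
  note bm = below[OF ml]
  have bc: "below m \<subseteq> carrier G" using bm convex_sub_carrier by blast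
  have lef: "f s \<noteq> 0 \<Longrightarrow> s \<preceq> m" and lef': "f' s \<noteq> 0 \<Longrightarrow> s \<preceq> m" for s using m(2)[of s] by auto
  obtain u where u: "expansion (f(m := 0)) u" "g = m [^] f m \<otimes> u" "u \<in> below m"
    using expansion_top[OF less.prems(1) ml lef] by blast
  obtain v where v: "expansion (f'(m := 0)) v" "g' = m [^] f' m \<otimes> v" "v \<in> below m"
    using expansion_top[OF less.prems(2) ml lef'] by blast
  have uc: "u \<in> carrier G" "v \<in> carrier G" using u v bc by blast+
  show ?case
  proof (cases "f m = f' m")
    case True
    have S: "?S (f(m := 0)) (f'(m := 0)) = ?S f f' - {m}" by auto
    have "u \<prec> v"
    proof (rule less.hyps)
      show "card (?S (f(m := 0)) (f'(m := 0))) < card (?S f f')"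
        unfolding S using fin m(1) by (rule card_Diff1_less)
      have "{s. (f(m := 0)) s \<noteq> 0} \<subseteq> {s. f s \<noteq> 0}" "{s. (f'(m := 0)) s \<noteq> 0} \<subseteq> {s. f' s \<noteq> 0}" by auto
      then show "f(m := 0) \<in> fin_supp \<alpha>" "f'(m := 0) \<in> fin_supp \<alpha>"
        using less.prems(3,4) finite_subset unfolding fin_supp_def by blast+
      have "x \<noteq> m" using True less.prems(5) by auto
      then show "(f(m := 0)) x < (f'(m := 0)) x" using less.prems(5) by simp
      show "(y, x) \<in> \<alpha>" if "(f(m := 0)) y \<noteq> (f'(m := 0)) y" for y
        using that less.prems(6)[of y] by (auto split: if_splits)
    qed (use u v in blast)+
    then show ?thesis using u(2) v(2) True mult_left_lt[of u v "m [^] f m"] uc mc by simp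
  next
    case False
    have "(m, x) \<in> \<alpha>" using less.prems(6) False by blast
    moreover have "(x, m) \<in> \<alpha>" using m(2) xS by blast
    ultimately have "x = m" using le_antisym by blast
    then have lt: "f m < f' m" using less.prems(5) by simp
    have m1: "\<one> \<prec> m" using lead_pos[of "below m"] bm by simp
    have "m [^] f m \<prec> m [^] f' m" using int_pow_strict_mono[OF m1 lt] .
    moreover have "inv (m [^] f m) \<otimes> m [^] f' m \<notin> below m"
    proof
      assume a: "inv (m [^] f m) \<otimes> m [^] f' m \<in> below m"
      have eq: "inv (m [^] f m) \<otimes> m [^] f' m = m [^] (f' m - f m)"
        using mc by (simp add: int_pow_neg[symmetric] int_pow_mult[symmetric])
      \<comment> \<open>The quotient of the two powers is at least \<open>m\<close>, so if it were
        in \<open>below m\<close>, convexity would put \<open>m\<close> there as well.\<close>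
      have "m [^] (1::int) \<preceq> m [^] (f' m - f m)"
      proof (cases "f' m - f m = 1")
        case True then show ?thesis using mc le_refl by simp
      next
        case False
        then show ?thesis using int_pow_strict_mono[OF m1, of 1 "f' m - f m"] lt by simp
      qed
      then have "m \<preceq> inv (m [^] f m) \<otimes> m [^] f' m" using eq mc by (simp add: int_pow_1)
      then have "m \<in> below m" using convex_subD[of "below m", OF _ a] bm m1 by blast
      then show False using lead_notin[of "below m"] bm by simp
    qed
    ultimately show ?thesis unfolding u(2) v(2) using coset_lt u(3) v(3) bm by blast
  qed
qed

text \<open>Induction along \<alpha> on the lead of the convex jump at \<open>g\<close>: dividing by
  this lead leaves a remainder in \<open>largest_avoiding g\<close>, whose own jump is strictly
  lower.\<close>

lemma expansion_surj:
  assumes "g \<in> H" shows "\<exists>f\<in>fin_supp \<alpha>. expansion f g"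
proof (cases "g = \<one>")
  case True
  then show ?thesis using expansion_0 by (intro bexI[of _ "\<lambda>_. 0"]) (simp_all add: fin_supp_def)
next
  case False
  have lav: "proper (largest_avoiding g)" if "g \<in> H" "g \<noteq> \<one>" for g
    using largest_avoiding[OF that(2)] that(1) convex_sub_chain[OF H, of "largest_avoiding g"] by blast
  have wf: "wf (\<alpha> - Id)" using Well_order_\<alpha> unfolding well_order_on_def by blast
  have "g \<in> H \<Longrightarrow> g \<noteq> \<one> \<Longrightarrow> lead (largest_avoiding g) = a \<Longrightarrow>
      \<exists>f\<in>fin_supp \<alpha>. expansion f g \<and> (\<forall>s. f s \<noteq> 0 \<longrightarrow> s \<preceq> a)" for a
  proof (induction a arbitrary: g rule: wf_induct_rule[OF wf])
    case (1 a)
    let ?K = "largest_avoiding g"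
    have K: "proper ?K" using lav 1 by blast
    have al: "a \<in> leads" and ac: "a \<in> carrier G" and lp: "least_pos ?K a"
      using lead_leads[OF K] lead_carrier[OF K] least_pos_lead[OF K] 1(4) by simp_all
    have a1: "\<one> \<preceq> a" using lp unfolding least_pos_def by blast
    have "a \<notin> ?K" using lp unfolding least_pos_def by blast
    \<comment> \<open>Every convex subgroup without \<open>g\<close> is contained in
      \<open>?K\<close>; since \<open>arch a\<close> is not, it contains \<open>g\<close>, and
      division by \<open>a\<close> is possible.\<close>
    then have "\<not> arch a \<subseteq> ?K" using arch_self[OF ac] by blast
    then have "g \<in> arch a" using largest_avoiding(3)[OF 1(3) convex_sub_arch[OF a1]] by blast
    then obtain n :: int and h where h: "h \<in> ?K" "g = a [^] n \<otimes> h"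
      using least_pos_division[OF lp] K by blast
    obtain f where f: "f \<in> fin_supp \<alpha>" "expansion f h" "\<And>s. f s \<noteq> 0 \<Longrightarrow> s \<prec> a"
    proof (cases "h = \<one>")
      case True
      have "(\<lambda>_. 0) \<in> fin_supp \<alpha>" unfolding fin_supp_def by simp
      then show thesis using that[of "\<lambda>_. 0"] expansion_0 True by simp
    next
      case False
      let ?K' = "largest_avoiding h"
      have hH: "h \<in> H" using h(1) K by blast
      have K': "proper ?K'" using lav hH False by blast
      have "?K' \<subset> ?K" using largest_avoiding(2)[OF False] h(1) convex_sub_chain K K' by blast
      then have lt: "lead ?K' \<prec> a" using lead_mono[OF K' K] 1(4) by simp
      then have "(lead ?K', a) \<in> \<alpha> - Id" using lead_leads[OF K'] al by blast
      from 1(1)[OF this hH False refl] obtain f where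
        f: "f \<in> fin_supp \<alpha>" "expansion f h" "\<forall>s. f s \<noteq> 0 \<longrightarrow> s \<preceq> lead ?K'" by blast
      moreover have "s \<prec> a" if "f s \<noteq> 0" for s using le_lt_trans[OF _ lt] f(3) that by blast
      ultimately show thesis using that by blast
    qed
    have "expansion (f(a := n)) g" unfolding h(2) using expansion_Cons[OF f(2) al f(3)] .
    moreover have "f(a := n) \<in> fin_supp \<alpha>"
    proof -
      have "{s. (f(a := n)) s \<noteq> 0} \<subseteq> insert a {s. f s \<noteq> 0}" by auto
      moreover have "finite {s. f s \<noteq> 0}" "{s. f s \<noteq> 0} \<subseteq> leads"
        using f(1) unfolding fin_supp_def Field_\<alpha> by blast+
      ultimately have "finite {s. (f(a := n)) s \<noteq> 0}" "{s. (f(a := n)) s \<noteq> 0} \<subseteq> leads"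
        using al finite_subset[of _ "insert a {s. f s \<noteq> 0}"] by blast+
      then show ?thesis unfolding fin_supp_def Field_\<alpha> by blast
    qed
    moreover have "\<forall>s. (f(a := n)) s \<noteq> 0 \<longrightarrow> s \<preceq> a" using f(3) le_refl[OF ac] by auto
    ultimately show ?case by blast
  qed
  then show ?thesis using assms False by blast
qed

theorem scattered_iso: "\<exists>\<psi>. bij_betw \<psi> H (fin_supp \<alpha>) \<and>
    (\<forall>a\<in>H. \<forall>b\<in>H. a \<preceq> b \<longleftrightarrow> (\<psi> a, \<psi> b) \<in> Z_pow \<alpha>)"
proof -
  obtain \<phi> where \<phi>: "\<And>f. f \<in> fin_supp \<alpha> \<Longrightarrow> expansion f (\<phi> f)" using expansion_exists by metis
  have lt: "\<phi> f \<prec> \<phi> f'" if f: "f \<in> fin_supp \<alpha>" "f' \<in> fin_supp \<alpha>" "(f, f') \<in> Z_pow \<alpha>" "f \<noteq> f'" for f f'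
    using f expansion_strict_mono[OF \<phi>[OF f(1)] \<phi>[OF f(2)] f(1,2)] unfolding Z_pow_def by auto
  have total: "(f, f') \<in> Z_pow \<alpha> \<or> (f', f) \<in> Z_pow \<alpha>" if "f \<in> fin_supp \<alpha>" "f' \<in> fin_supp \<alpha>" for f f'
    using linear_order_onD(4)[OF linear_order_Z_pow[OF Linear_order_\<alpha>]] that by simp
  have Zrefl: "(f, f) \<in> Z_pow \<alpha>" if "f \<in> fin_supp \<alpha>" for f using total that by blast
  have inj: "inj_on \<phi> (fin_supp \<alpha>)"
  proof (rule inj_onI)
    fix f f' assume f: "f \<in> fin_supp \<alpha>" "f' \<in> fin_supp \<alpha>" "\<phi> f = \<phi> f'"
    show "f = f'" using total[OF f(1,2)] lt[OF f(1,2)] lt[OF f(2,1)] f(3) by metis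
  qed
  \<comment> \<open>\<open>\<phi>\<close> merely picks a product for each exponent function.
    Uniqueness ensures that the function found for \<open>g\<close> by \<open>expansion_surj\<close>
    is sent to \<open>g\<close> itself.\<close>
  have unique: "g = g'" if e: "expansion f g" "expansion f g'" "f \<in> fin_supp \<alpha>" for f g g'
    using e
  proof (induction "card {s. f s \<noteq> 0}" arbitrary: f g g' rule: less_induct)
    case less
    have fin: "finite {s. f s \<noteq> 0}" and sub: "{s. f s \<noteq> 0} \<subseteq> leads"
      using less.prems(3) unfolding fin_supp_def Field_\<alpha> by blast+
    show ?case
    proof (cases "{s. f s \<noteq> 0} = {}")
      case True
      then have "g \<in> {\<one>}" "g' \<in> {\<one>}"
        using expansion_in[OF _ convex_sub_trivial] less.prems(1,2) by blast+
      then show ?thesis by simp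
    next
      case False
      obtain m where m: "f m \<noteq> 0" "\<And>s. f s \<noteq> 0 \<Longrightarrow> (s, m) \<in> \<alpha>"
        using finite_rel_max[OF Linear_order_\<alpha> fin False] sub unfolding Field_\<alpha> by blast
      have ml: "m \<in> leads" and mle: "\<And>s. f s \<noteq> 0 \<Longrightarrow> s \<preceq> m" using m sub by blast+
      obtain u where u: "expansion (f(m := 0)) u" "g = m [^] f m \<otimes> u"
        using expansion_top[OF less.prems(1) ml mle] by blast
      obtain v where v: "expansion (f(m := 0)) v" "g' = m [^] f m \<otimes> v"
        using expansion_top[OF less.prems(2) ml mle] by blast
      have "u = v"
        using less.hyps[OF fin_supp_upd_0(2)[OF less.prems(3) m(1)] u(1) v(1)
            fin_supp_upd_0(1)[OF less.prems(3) m(1)]] .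
      then show ?thesis using u(2) v(2) by simp
    qed
  qed
  have im: "\<phi> ` fin_supp \<alpha> = H"
  proof
    show "\<phi> ` fin_supp \<alpha> \<subseteq> H" using \<phi> expansion_H by blast
    show "H \<subseteq> \<phi> ` fin_supp \<alpha>" using expansion_surj \<phi> unique by blast
  qed
  have iff: "(f, f') \<in> Z_pow \<alpha> \<longleftrightarrow> \<phi> f \<preceq> \<phi> f'" if "f \<in> fin_supp \<alpha>" "f' \<in> fin_supp \<alpha>" for f f'
  proof
    assume "(f, f') \<in> Z_pow \<alpha>"
    moreover have "\<phi> f \<in> carrier G" using im that convex_sub_carrier[OF H] by blast
    ultimately show "\<phi> f \<preceq> \<phi> f'" using lt that le_refl by blast
  next
    assume le: "\<phi> f \<preceq> \<phi> f'"
    show "(f, f') \<in> Z_pow \<alpha>"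
    proof (rule ccontr)
      assume no: "(f, f') \<notin> Z_pow \<alpha>"
      then have "(f', f) \<in> Z_pow \<alpha>" "f' \<noteq> f" using total that Zrefl by blast+
      then have "\<phi> f' \<prec> \<phi> f" using lt that by blast
      then show False using le le_antisym by blast
    qed
  qed
  have bij: "bij_betw \<phi> (fin_supp \<alpha>) H" using inj im unfolding bij_betw_def by blast
  let ?\<psi> = "inv_into (fin_supp \<alpha>) \<phi>"
  have "bij_betw ?\<psi> H (fin_supp \<alpha>)" using bij by (rule bij_betw_inv_into)
  moreover have "a \<preceq> b \<longleftrightarrow> (?\<psi> a, ?\<psi> b) \<in> Z_pow \<alpha>" if ab: "a \<in> H" "b \<in> H" for a b
  proof -
    have "?\<psi> a \<in> fin_supp \<alpha>" "?\<psi> b \<in> fin_supp \<alpha>" "\<phi> (?\<psi> a) = a" "\<phi> (?\<psi> b) = b"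
      using ab im by (metis inv_into_into, metis inv_into_into, metis f_inv_into_f, metis f_inv_into_f)
    then show ?thesis using iff[of "?\<psi> a" "?\<psi> b"] by simp
  qed
  ultimately show ?thesis by blast
qed

end

section \<open>The order type of a countable ordered group\<close>

lemma Field_order_prod:
  assumes "Refl r" "Refl s" shows "Field (order_prod r s) = Field r \<times> Field s"
proof
  show "Field r \<times> Field s \<subseteq> Field (order_prod r s)"
  proof
    fix z assume "z \<in> Field r \<times> Field s"
    then have "(z, z) \<in> order_prod r s"
      using assms unfolding order_prod_def refl_on_def by auto
    then show "z \<in> Field (order_prod r s)" by (rule FieldI1)
  qed
next
  have "order_prod r s \<subseteq> (Field r \<times> Field s) \<times> (Field r \<times> Field s)"
    unfolding order_prod_def by blast
  then show "Field (order_prod r s) \<subseteq> Field r \<times> Field s" by (auto simp: Field_def[of "order_prod r s"])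
qed

section \<open>The scattered part and its cosets\<close>

context ogroup
begin

text \<open>The endpoints are unordered, so that scatteredness of \<open>interval x y\<close>
  becomes an equivalence relation in \<open>x\<close> and \<open>y\<close>, invariant under left
  translation.\<close>

definition interval :: "'a \<Rightarrow> 'a \<Rightarrow> 'a set" where
  "interval x y = {z \<in> carrier G. x \<preceq> z \<and> z \<preceq> y \<or> y \<preceq> z \<and> z \<preceq> x}"

lemma interval_commute: "interval x y = interval y x"
  unfolding interval_def by blast

lemma interval_triangle:
  assumes "y \<in> carrier G" shows "interval x z \<subseteq> interval x y \<union> interval y z"
proof
  fix w assume w: "w \<in> interval x z"
  then have "w \<preceq> y \<or> y \<preceq> w" using le_total[of w y] assms unfolding interval_def by blast
  then show "w \<in> interval x y \<union> interval y z" using w unfolding interval_def by blast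
qed

lemma scattered_interval_trans:
  assumes "y \<in> carrier G" "scattered r (interval x y)" "scattered r (interval y z)"
  shows "scattered r (interval x z)"
proof -
  have "total_on (interval x y \<union> interval y z) r"
    by (rule total_on_subset[OF r_total]) (auto simp: interval_def)
  then have "scattered r (interval x y \<union> interval y z)"
    using scattered_Un[OF r_trans r_antisym] assms(2,3) by blast
  then show ?thesis using scattered_subset interval_triangle[OF assms(1)] by blast
qed

lemma scattered_interval_shift:
  assumes c: "x \<in> carrier G" "y \<in> carrier G" "g \<in> carrier G" and sc: "scattered r (interval x y)"
  shows "scattered r (interval (g \<otimes> x) (g \<otimes> y))"
proof (rule scattered_image)
  let ?f = "\<lambda>z. inv g \<otimes> z"
  have "?f ` interval (g \<otimes> x) (g \<otimes> y) \<subseteq> interval x y"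
  proof
    fix w assume "w \<in> ?f ` interval (g \<otimes> x) (g \<otimes> y)"
    then obtain z where z: "z \<in> interval (g \<otimes> x) (g \<otimes> y)" "w = inv g \<otimes> z" by blast
    then have zc: "z \<in> carrier G" unfolding interval_def by blast
    then have "w \<in> carrier G" "z = g \<otimes> w" using z(2) c by (simp_all add: mult_inv_cancel)
    then show "w \<in> interval x y" using z(1) c unfolding interval_def by (simp add: mult_left_le)
  qed
  then show "scattered r (?f ` interval (g \<otimes> x) (g \<otimes> y))" using scattered_subset[OF sc] by blast
  show "inj_on ?f (interval (g \<otimes> x) (g \<otimes> y))"
    using c by (intro inj_onI) (auto simp: interval_def)
  show "(a, b) \<in> r \<longleftrightarrow> (?f a, ?f b) \<in> r"
    if "a \<in> interval (g \<otimes> x) (g \<otimes> y)" "b \<in> interval (g \<otimes> x) (g \<otimes> y)" for a b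
    using that c mult_left_le[of a b "inv g"] unfolding interval_def by simp
qed

definition scattered_part :: "'a set" where
  "scattered_part = {g \<in> carrier G. scattered r (interval \<one> g)}"

text \<open>Translation by \<open>x\<close>. Hence the classes of points joined by scattered
  intervals are the left cosets of \<open>scattered_part\<close>.\<close>

lemma scattered_part_iff:
  assumes "x \<in> carrier G" "y \<in> carrier G"
  shows "inv x \<otimes> y \<in> scattered_part \<longleftrightarrow> scattered r (interval x y)"
proof
  assume "inv x \<otimes> y \<in> scattered_part"
  then have "scattered r (interval \<one> (inv x \<otimes> y))" unfolding scattered_part_def by blast
  from scattered_interval_shift[OF _ _ _ this, of x] show "scattered r (interval x y)"
    using assms by (simp add: mult_inv_cancel)
next
  assume "scattered r (interval x y)"
  from scattered_interval_shift[OF _ _ _ this, of "inv x"] show "inv x \<otimes> y \<in> scattered_part"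
    using assms unfolding scattered_part_def by simp
qed

text \<open>For closure under products, the interval from \<one> to \<open>x \<otimes> y\<close> is
  a translate of the one from \<open>inv x\<close> to \<open>y\<close>, which is covered by two
  scattered intervals meeting at \<one>.\<close>

lemma convex_sub_scattered_part: "convex_sub scattered_part"
  unfolding convex_sub_def
proof (intro conjI ballI allI impI)
  have inv_part: "inv x \<in> scattered_part" if x: "x \<in> scattered_part" for x
  proof -
    have "x \<in> carrier G" "scattered r (interval x \<one>)"
      using x unfolding scattered_part_def by (simp_all add: interval_commute)
    then show ?thesis using scattered_part_iff[of x \<one>] by simp
  qed
  show "subgroup scattered_part G"
  proof (rule subgroupI)
    show "scattered_part \<subseteq> carrier G" unfolding scattered_part_def by blast
    have "\<not> dense_set r D" if "D \<subseteq> interval \<one> \<one>" for D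
      using that le_antisym[of \<one>] unfolding dense_set_def interval_def by blast
    then have "\<one> \<in> scattered_part" unfolding scattered_part_def scattered_def by auto
    then show "scattered_part \<noteq> {}" by blast
    show "inv x \<in> scattered_part" if "x \<in> scattered_part" for x using inv_part[OF that] .
    show "x \<otimes> y \<in> scattered_part" if xy: "x \<in> scattered_part" "y \<in> scattered_part" for x y
    proof -
      have c: "inv x \<in> carrier G" "y \<in> carrier G" using xy unfolding scattered_part_def by auto
      have "scattered r (interval (inv x) \<one>)" "scattered r (interval \<one> y)"
        using inv_part[OF xy(1)] xy(2) unfolding scattered_part_def by (simp_all add: interval_commute)
      then have "scattered r (interval (inv x) y)"
        using scattered_interval_trans[of \<one> "inv x" y] by simp
      then show ?thesis using scattered_part_iff[OF c] xy unfolding scattered_part_def by simp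
    qed
  qed
next
  fix x g assume x: "x \<in> scattered_part" and g: "\<one> \<preceq> g \<and> g \<preceq> x"
  have "interval \<one> g \<subseteq> interval \<one> x"
  proof
    fix z assume z: "z \<in> interval \<one> g"
    then have zc: "z \<in> carrier G" unfolding interval_def by blast
    have "\<one> \<preceq> z \<and> z \<preceq> g \<or> g \<preceq> z \<and> z \<preceq> \<one>" using z unfolding interval_def by blast
    then have "\<one> \<preceq> z \<and> z \<preceq> x"
    proof
      assume "\<one> \<preceq> z \<and> z \<preceq> g"
      then show ?thesis using le_trans[of z g x] g by blast
    next
      assume "g \<preceq> z \<and> z \<preceq> \<one>"
      then show ?thesis using le_trans[of \<one> g z] le_trans[of z \<one> g] le_trans[of z g x] g by blast
    qed
    then show "z \<in> interval \<one> x" using zc unfolding interval_def by blast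
  qed
  then show "g \<in> scattered_part"
    using x g le_carrier[of \<one> g] scattered_subset unfolding scattered_part_def by blast
qed

text \<open>A dense set inside would remain dense between two of its elements \<open>x\<close> and
  \<open>y\<close>; but \<open>inv x \<otimes> y\<close> is in the subgroup, so that interval is
  scattered.\<close>

lemma scattered_scattered_part: "scattered r scattered_part"
  unfolding scattered_def
proof (intro notI, elim exE conjE)
  fix D assume D: "D \<subseteq> scattered_part" "dense_set r D"
  have Dc: "D \<subseteq> carrier G" using D(1) unfolding scattered_part_def by blast
  obtain x y where xy: "x \<in> D" "y \<in> D" "x \<noteq> y" "x \<preceq> y"
  proof -
    obtain a b where ab: "a \<in> D" "b \<in> D" "a \<noteq> b" using D(2) unfolding dense_set_def by blast
    then have "a \<preceq> b \<or> b \<preceq> a" using Dc le_total[of a b] by blast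
    then show thesis using that[of a b] that[of b a] ab by blast
  qed
  have c: "x \<in> carrier G" "y \<in> carrier G" using xy Dc by blast+
  have "inv x \<otimes> y \<in> scattered_part"
    using convex_sub_mult[OF convex_sub_scattered_part convex_sub_inv[OF convex_sub_scattered_part]] xy D(1)
    by blast
  then have sc: "scattered r (interval x y)" using scattered_part_iff[OF c] by blast
  let ?E = "{z\<in>D. (x, z) \<in> r \<and> x \<noteq> z \<and> (z, y) \<in> r \<and> z \<noteq> y}"
  have "dense_set r ?E" using dense_set_interval[OF r_trans r_antisym D(2) xy(1,2,4,3)] .
  moreover have "?E \<subseteq> interval x y" using Dc unfolding interval_def by blast
  ultimately show False using sc unfolding scattered_def by blast
qed

lemma scattered_part_eq_carrier_iff: "scattered_part = carrier G \<longleftrightarrow> scattered r (carrier G)"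
proof
  assume "scattered_part = carrier G"
  then show "scattered r (carrier G)" using scattered_scattered_part by simp
next
  assume sc: "scattered r (carrier G)"
  have "scattered r (interval \<one> g)" for g
    by (rule scattered_subset[OF sc]) (auto simp: interval_def)
  then show "scattered_part = carrier G" unfolding scattered_part_def by blast
qed

text \<open>Two neighbouring cosets would cover the interval between their representatives by two
  translates of a scattered set. The interval would be scattered and the cosets equal. Multiplying
  by a positive element outside the subgroup, or by its inverse, excludes endpoints.\<close>

lemma quotient_unbounded_dense:
  assumes ne: "scattered_part \<noteq> carrier G"
  defines "s \<equiv> Restr r (coset_rep scattered_part ` carrier G)"
  shows "unbounded_dense s" and "Field s = coset_rep scattered_part ` carrier G"
proof -
  let ?H = scattered_part and ?D = "coset_rep scattered_part ` carrier G"
  note Hc = convex_sub_scattered_part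
  have Dc: "?D \<subseteq> carrier G" using coset_rep(1)[OF Hc] by blast
  have fixed: "coset_rep ?H x = x" if "x \<in> ?D" for x
    using that coset_rep_coset_rep[OF Hc] by auto
  show Field: "Field s = ?D"
  proof
    show "?D \<subseteq> Field s"
    proof
      fix x assume x: "x \<in> ?D"
      then have "(x, x) \<in> s" using Dc le_refl[of x] unfolding s_def by blast
      then show "x \<in> Field s" by (rule FieldI1)
    qed
  qed (auto simp: s_def Field_def)
  have linr: "Linear_order r" using lin by simp
  have lins: "Linear_order s" unfolding s_def by (rule Linear_order_Restr[OF linr])
  have notin: "inv x \<otimes> y \<notin> ?H" if "x \<in> ?D" "y \<in> ?D" "x \<noteq> y" for x y
  proof -
    have "x \<in> carrier G" "y \<in> carrier G" using that Dc by blast+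
    then show ?thesis using coset_rep_eq_iff[OF Hc, of x y] fixed[OF that(1)] fixed[OF that(2)] that(3) by simp
  qed
  obtain g0 where g0: "g0 \<in> carrier G" "g0 \<notin> ?H" using ne convex_sub_carrier[OF Hc] by blast
  obtain g where g: "\<one> \<prec> g" "g \<notin> ?H" using convex_sub_positive[OF Hc g0] by blast
  have gc: "g \<in> carrier G" using le_carrier[of \<one> g] g by blast
  have above: "\<exists>y. (x, y) \<in> s \<and> x \<noteq> y" if x: "x \<in> ?D" for x
  proof -
    have xc: "x \<in> carrier G" using x Dc by blast
    have "x \<otimes> \<one> \<prec> x \<otimes> g" using mult_left_lt[of \<one> g x] g(1) gc xc by blast
    then have "x \<prec> x \<otimes> g" using xc by simp
    moreover have "inv x \<otimes> (x \<otimes> g) \<notin> ?H" using inv_mult_cancel[OF xc gc] g(2) by simp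
    ultimately have "x \<prec> coset_rep ?H (x \<otimes> g)"
      using coset_rep_lt[OF Hc, of x "x \<otimes> g"] fixed[OF x] by simp
    moreover have "coset_rep ?H (x \<otimes> g) \<in> ?D" using xc gc by simp
    ultimately show ?thesis using x unfolding s_def by blast
  qed
  have below: "\<exists>y. (y, x) \<in> s \<and> y \<noteq> x" if x: "x \<in> ?D" for x
  proof -
    have xc: "x \<in> carrier G" using x Dc by blast
    \<comment> \<open>Chosen so that \<open>inv y \<otimes> x\<close> is \<open>g\<close>, which is
      outside the subgroup: the cosets of \<open>y\<close> and \<open>x\<close> differ.\<close>
    define y where "y = x \<otimes> inv g"
    have yc: "y \<in> carrier G" and yg: "y \<otimes> g = x" using xc gc unfolding y_def by (simp_all add: m_assoc)
    have "y \<otimes> \<one> \<prec> y \<otimes> g" using mult_left_lt[of \<one> g y] g(1) gc yc by blast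
    then have "y \<prec> x" using yc yg by simp
    moreover have "inv y \<otimes> x \<notin> ?H" using inv_mult_cancel[OF yc gc] g(2) yg by simp
    ultimately have "coset_rep ?H y \<prec> x"
      using coset_rep_lt[OF Hc, of y x] fixed[OF x] by simp
    moreover have "coset_rep ?H y \<in> ?D" using yc by simp
    ultimately show ?thesis using x unfolding s_def by blast
  qed
  have between: "\<exists>z. (x, z) \<in> s \<and> x \<noteq> z \<and> (z, y) \<in> s \<and> z \<noteq> y" if xy: "(x, y) \<in> s" "x \<noteq> y" for x y
  proof (rule ccontr)
    assume none: "\<not> ?thesis"
    have D: "x \<in> ?D" "y \<in> ?D" and le: "x \<preceq> y" using xy unfolding s_def by blast+
    have c: "x \<in> carrier G" "y \<in> carrier G" using D Dc by blast+
    have "z \<in> {z \<in> carrier G. inv x \<otimes> z \<in> ?H} \<union> {z \<in> carrier G. inv y \<otimes> z \<in> ?H}" if z: "z \<in> interval x y" for z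
    proof (rule ccontr)
      assume "\<not> ?thesis"
      then have n: "inv x \<otimes> z \<notin> ?H" "inv y \<otimes> z \<notin> ?H" using z unfolding interval_def by blast+
      have zc: "z \<in> carrier G" using z unfolding interval_def by blast
      have n': "inv z \<otimes> y \<notin> ?H" using n(2) same_coset_sym[OF Hc zc c(2)] by blast
      have one: "inv x \<otimes> x \<in> ?H" "inv y \<otimes> y \<in> ?H" using convex_sub_one[OF Hc] c by simp_all
      have zne: "x \<noteq> z" "z \<noteq> y" using n one by blast+
      have "x \<preceq> z \<and> z \<preceq> y"
        using z le le_antisym[of x z] le_trans[of y z x] le_antisym[of x y] xy(2)
          le_trans[of y z x] unfolding interval_def by blast
      then have "x \<prec> coset_rep ?H z" "coset_rep ?H z \<prec> y"
        using coset_rep_lt[OF Hc _ n(1)] coset_rep_lt[OF Hc _ n'] fixed[OF D(1)] fixed[OF D(2)] zne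
        by simp_all
      moreover have "coset_rep ?H z \<in> ?D" using zc by blast
      ultimately show False using none D unfolding s_def by blast
    qed
    then have sub: "interval x y \<subseteq> {z \<in> carrier G. inv x \<otimes> z \<in> ?H} \<union> {z \<in> carrier G. inv y \<otimes> z \<in> ?H}"
      by blast
    have sc: "scattered r {z \<in> carrier G. inv a \<otimes> z \<in> ?H}" if a: "a \<in> carrier G" for a
    proof (rule scattered_image)
      show "scattered r ((\<lambda>z. inv a \<otimes> z) ` {z \<in> carrier G. inv a \<otimes> z \<in> ?H})"
        by (rule scattered_subset[OF scattered_scattered_part]) blast
      show "inj_on (\<lambda>z. inv a \<otimes> z) {z \<in> carrier G. inv a \<otimes> z \<in> ?H}"
        using a by (intro inj_onI) simp
    qed (use mult_left_le a in simp)
    have "total_on ({z \<in> carrier G. inv x \<otimes> z \<in> ?H} \<union> {z \<in> carrier G. inv y \<otimes> z \<in> ?H}) r"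
      by (rule total_on_subset[OF r_total]) blast
    from scattered_Un[OF r_trans r_antisym this sc[OF c(1)] sc[OF c(2)]]
    have "scattered r (interval x y)" using scattered_subset sub by blast
    then show False using scattered_part_iff[OF c] notin[OF D xy(2)] by blast
  qed
  show "unbounded_dense s"
    unfolding unbounded_dense_def
  proof (intro conjI ballI allI impI)
    show "Field s \<noteq> {}" unfolding Field by auto
  qed (use lins Field above below between in auto)
qed

text \<open>The alternative is expressed by scatteredness, the property that the tree of a group
  tests. Countability makes Cantor's theorem available for the cosets.\<close>

theorem Maltsev_order_type:
  assumes "countable (carrier G)"
  shows "\<exists>\<alpha> :: 'a rel. Well_order \<alpha> \<and>
    (if scattered r (carrier G) then order_isomorphic r (Z_pow \<alpha>)
     else order_isomorphic r (order_prod (Z_pow \<alpha>) Q_order))"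
proof -
  let ?H = scattered_part
  note Hc = convex_sub_scattered_part
  interpret H: scattered_convex_sub G r ?H
    by unfold_locales (rule Hc, rule scattered_scattered_part)
  obtain \<psi> where bij: "bij_betw \<psi> ?H (fin_supp H.\<alpha>)"
    and \<psi>: "\<And>a b. a \<in> ?H \<Longrightarrow> b \<in> ?H \<Longrightarrow> a \<preceq> b \<longleftrightarrow> (\<psi> a, \<psi> b) \<in> Z_pow H.\<alpha>"
    using H.scattered_iso by blast
  show ?thesis
  proof (intro exI[of _ H.\<alpha>] conjI)
    show "Well_order H.\<alpha>" using H.Well_order_\<alpha> .
    show "if scattered r (carrier G) then order_isomorphic r (Z_pow H.\<alpha>)
     else order_isomorphic r (order_prod (Z_pow H.\<alpha>) Q_order)"
    proof (cases "scattered r (carrier G)")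
      case True
      then have eq: "?H = carrier G" using scattered_part_eq_carrier_iff by blast
      have "order_isomorphic r (Z_pow H.\<alpha>)"
        unfolding order_isomorphic_def Field_r Field_Z_pow
      proof (intro exI[of _ \<psi>] conjI ballI)
        show "bij_betw \<psi> (carrier G) (fin_supp H.\<alpha>)" using bij unfolding eq .
        show "a \<preceq> b \<longleftrightarrow> (\<psi> a, \<psi> b) \<in> Z_pow H.\<alpha>" if "a \<in> carrier G" "b \<in> carrier G" for a b
          using \<psi> that unfolding eq .
      qed
      then show ?thesis using True by simp
    next
      case False
      let ?c = "coset_rep ?H"
      let ?D = "?c ` carrier G"
      let ?s = "Restr r ?D"
      have ne: "?H \<noteq> carrier G" using False scattered_part_eq_carrier_iff by blast
      note s = quotient_unbounded_dense[OF ne]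
      have "countable (Field ?s)" unfolding s(2) using assms by (rule countable_image)
      then have "order_isomorphic ?s Q_order"
        using cantor_order_isomorphic[OF s(1) _ unbounded_dense_Q_order] by simp
      then obtain q where q: "bij_betw q ?D (UNIV :: rat set)"
        "\<And>a b. a \<in> ?D \<Longrightarrow> b \<in> ?D \<Longrightarrow> a \<preceq> b \<longleftrightarrow> (q a, q b) \<in> Q_order"
        unfolding order_isomorphic_def s(2) Field_Q_order by blast
      \<comment> \<open>Remainder and coset: the second component dominates in
        \<open>order_prod\<close>, so the coset is compared first, and within one coset the
        remainders are compared after left translation into the subgroup.\<close>
      let ?f = "\<lambda>g. (\<psi> (inv (?c g) \<otimes> g), q (?c g))"
      have rem: "inv (?c g) \<otimes> g \<in> ?H" if "g \<in> carrier G" for g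
        using same_coset_sym[OF Hc that] coset_rep[OF Hc that] by blast
      have cc: "?c g \<in> carrier G" if "g \<in> carrier G" for g using coset_rep(1)[OF Hc that] .
      have q_inj: "q a = q b \<longleftrightarrow> a = b" if "a \<in> ?D" "b \<in> ?D" for a b
        using q(1) that unfolding bij_betw_def inj_on_def by blast
      have FP: "Field (order_prod (Z_pow H.\<alpha>) Q_order) = fin_supp H.\<alpha> \<times> UNIV"
      proof -
        have "Refl (Z_pow H.\<alpha>)" "Refl Q_order"
          using linear_order_Z_pow[OF H.Linear_order_\<alpha>] unbounded_dense_Q_order
          unfolding unbounded_dense_def order_on_defs by blast+
        from Field_order_prod[OF this] show ?thesis by simp
      qed
      have iff: "a \<preceq> b \<longleftrightarrow> (?f a, ?f b) \<in> order_prod (Z_pow H.\<alpha>) Q_order"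
        if ab: "a \<in> carrier G" "b \<in> carrier G" for a b
      proof -
        have fs: "\<psi> (inv (?c a) \<otimes> a) \<in> fin_supp H.\<alpha>" "\<psi> (inv (?c b) \<otimes> b) \<in> fin_supp H.\<alpha>"
          using bij rem ab bij_betwE by blast+
        have D: "?c a \<in> ?D" "?c b \<in> ?D" using ab by blast+
        show ?thesis
        proof (cases "?c a = ?c b")
          case True
          have "a \<preceq> b \<longleftrightarrow> inv (?c a) \<otimes> a \<preceq> inv (?c a) \<otimes> b"
            using mult_left_le[of a b "inv (?c a)"] ab cc by simp
          also have "\<dots> \<longleftrightarrow> (\<psi> (inv (?c a) \<otimes> a), \<psi> (inv (?c b) \<otimes> b)) \<in> Z_pow H.\<alpha>"
            using \<psi>[OF rem[OF ab(1)] rem[OF ab(2)]] True by simp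
          finally show ?thesis using True fs unfolding order_prod_def by simp
        next
          case False
          have na: "inv a \<otimes> b \<notin> ?H" and nb: "inv b \<otimes> a \<notin> ?H"
            using coset_rep_eq_iff[OF Hc ab] coset_rep_eq_iff[OF Hc ab(2,1)] False by auto
          have "a \<noteq> b" using False by blast
          have "a \<preceq> b \<longleftrightarrow> ?c a \<preceq> ?c b"
          proof
            assume "a \<preceq> b"
            then show "?c a \<preceq> ?c b" using coset_rep_lt[OF Hc _ na] \<open>a \<noteq> b\<close> by blast
          next
            assume le: "?c a \<preceq> ?c b"
            show "a \<preceq> b"
            proof (rule ccontr)
              assume "\<not> a \<preceq> b"
              then have "b \<prec> a" using not_le_lt ab by blast
              then have "?c b \<prec> ?c a" using coset_rep_lt[OF Hc _ nb] by blast
              then show False using le le_antisym[of "?c a" "?c b"] by auto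
            qed
          qed
          then show ?thesis using q(2)[OF D] q_inj[OF D] False fs unfolding order_prod_def by simp
        qed
      qed
      have "bij_betw ?f (carrier G) (fin_supp H.\<alpha> \<times> UNIV)"
        unfolding bij_betw_def
      proof
        show "inj_on ?f (carrier G)"
        proof (rule inj_onI)
          fix a b assume ab: "a \<in> carrier G" "b \<in> carrier G" "?f a = ?f b"
          have "(?f a, ?f a) \<in> order_prod (Z_pow H.\<alpha>) Q_order" using iff[OF ab(1,1)] le_refl[OF ab(1)] by blast
          then have "a \<preceq> b" "b \<preceq> a" using iff[OF ab(1,2)] iff[OF ab(2,1)] ab(3) by simp_all
          then show "a = b" using le_antisym by blast
        qed
        show "?f ` carrier G = fin_supp H.\<alpha> \<times> UNIV"
        proof
          show "?f ` carrier G \<subseteq> fin_supp H.\<alpha> \<times> UNIV" using bij rem bij_betwE by fastforce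
          show "fin_supp H.\<alpha> \<times> UNIV \<subseteq> ?f ` carrier G"
          proof
            fix z :: "('a \<Rightarrow> int) \<times> rat" assume "z \<in> fin_supp H.\<alpha> \<times> UNIV"
            then obtain f p where z: "z = (f, p)" "f \<in> fin_supp H.\<alpha>" by blast
            have "f \<in> \<psi> ` ?H" using bij_betw_imp_surj_on[OF bij] z(2) by simp
            then obtain h where h: "h \<in> ?H" "\<psi> h = f" by auto
            have "p \<in> q ` ?D" using bij_betw_imp_surj_on[OF q(1)] by simp
            then obtain d where d: "d \<in> ?D" "q d = p" by auto
            have c: "h \<in> carrier G" "d \<in> carrier G" using h(1) d(1) cc convex_sub_carrier[OF Hc] by auto
            have dd: "?c d = d" using d(1) coset_rep_coset_rep[OF Hc] by auto
            have "?c (d \<otimes> h) = ?c d"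
              using coset_rep_eq_iff[OF Hc, of d "d \<otimes> h"] c h(1) by (simp add: inv_mult_cancel)
            then have "?f (d \<otimes> h) = z" using dd z h d c by (simp add: inv_mult_cancel)
            then show "z \<in> ?f ` carrier G" using c by (intro image_eqI[of _ _ "d \<otimes> h"]) simp_all
          qed
        qed
      qed
      then have "order_isomorphic r (order_prod (Z_pow H.\<alpha>) Q_order)"
        unfolding order_isomorphic_def Field_r FP by (intro exI[of _ ?f] conjI ballI iff)
      then show ?thesis using False by simp
    qed
  qed
qed

end

section \<open>The tree of attempts at a dense set\<close>

definition code_lt :: "baire \<Rightarrow> nat \<Rightarrow> nat \<Rightarrow> bool" where
  "code_lt p a b \<longleftrightarrow> p (3 * a) \<noteq> 0 \<and> p (3 * b) \<noteq> 0 \<and> p (3 * prod_encode (a, b) + 2) \<noteq> 0 \<and> a \<noteq> b"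

lemma code_lt: "code_lt p a b \<longleftrightarrow> (a, b) \<in> coded_order p \<and> a \<noteq> b"
  unfolding code_lt_def coded_order_def coded_universe_def by auto

lemma comp_pred_code_lt [comp_fun_intros]: "comp_fun a \<Longrightarrow> comp_fun b \<Longrightarrow> comp_pred (\<lambda>p n. code_lt p (a p n) (b p n))"
  unfolding code_lt_def by (intro comp_fun_intros)

text \<open>An infinite sequence satisfying this at all \<open>n\<close> enumerates a dense set: its entry at
  \<^term>\<open>prod_encode (i, j) + 2\<close> lies between the entries at \<open>i\<close> and \<open>j\<close>.\<close>

definition dense_at :: "baire \<Rightarrow> (nat \<Rightarrow> nat) \<Rightarrow> nat \<Rightarrow> bool" where
  "dense_at p h n \<longleftrightarrow> p (3 * h n) \<noteq> 0 \<and> (n = 1 \<longrightarrow> code_lt p (h 0) (h n)) \<and>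
     (1 < n \<longrightarrow> code_lt p (h (pfst (n - 2))) (h (psnd (n - 2))) \<longrightarrow>
        code_lt p (h (pfst (n - 2))) (h n) \<and> code_lt p (h n) (h (psnd (n - 2))))"

definition dense_tree :: "baire \<Rightarrow> nat list set" where
  "dense_tree p = {\<sigma>. \<forall>n<length \<sigma>. dense_at p (lnth (list_encode \<sigma>)) n}"

lemma pfst_le: "pfst k \<le> k" and psnd_le: "psnd k \<le> k"
  by (metis le_prod_encode_1 prod_encode_pfst_psnd) (metis le_prod_encode_2 prod_encode_pfst_psnd)

text \<open>Components of a pair never exceed its code, so the condition at \<open>n\<close>
  consults no entry beyond \<open>n\<close>. This makes \<open>dense_tree\<close> closed under
  prefixes, and default values past the end of a list are never consulted.\<close>

lemma dense_at_cong:
  assumes "\<And>k. k \<le> n \<Longrightarrow> h k = h' k" shows "dense_at p h n = dense_at p h' n"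
proof -
  have "pfst (n - 2) \<le> n" "psnd (n - 2) \<le> n"
    using pfst_le[of "n - 2"] psnd_le[of "n - 2"] by linarith+
  then show ?thesis unfolding dense_at_def using assms by simp
qed

lemma tree_dense_tree: "tree (dense_tree p)"
  unfolding tree_def
proof (intro conjI ballI allI impI)
  have "[] \<in> dense_tree p" unfolding dense_tree_def by simp
  then show "dense_tree p \<noteq> {}" by blast
  fix \<sigma> \<tau> assume s: "\<sigma> \<in> dense_tree p" and pre: "prefix \<tau> \<sigma>"
  show "\<tau> \<in> dense_tree p"
    unfolding dense_tree_def
  proof (intro CollectI allI impI)
    fix n assume n: "n < length \<tau>"
    obtain \<rho> where r: "\<sigma> = \<tau> @ \<rho>" using pre by (auto simp: prefix_def)
    have "dense_at p (lnth (list_encode \<sigma>)) n" using s n r unfolding dense_tree_def by simp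
    moreover have "lnth (list_encode \<sigma>) k = lnth (list_encode \<tau>) k" if "k \<le> n" for k
      using that n r by (simp add: lnth_encode nth_append)
    ultimately show "dense_at p (lnth (list_encode \<tau>)) n" using dense_at_cong by metis
  qed
qed

lemma dense_tree_path_iff: "(\<forall>n. map h [0..<n] \<in> dense_tree p) \<longleftrightarrow> (\<forall>n. dense_at p h n)"
proof -
  have eq: "dense_at p (lnth (list_encode (map h [0..<m]))) n = dense_at p h n" if "n < m" for m n
    using that by (intro dense_at_cong) (simp add: lnth_encode)
  show ?thesis
  proof
    assume *: "\<forall>n. map h [0..<n] \<in> dense_tree p"
    show "\<forall>n. dense_at p h n"
    proof
      fix n
      have "map h [0..<Suc n] \<in> dense_tree p" using * by blast
      then have "dense_at p (lnth (list_encode (map h [0..<Suc n]))) n" unfolding dense_tree_def by force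
      then show "dense_at p h n" using eq[of n "Suc n"] by blast
    qed
  qed (simp add: dense_tree_def eq)
qed

lemma well_founded_dense_tree_iff:
  assumes "total_on (coded_universe p) (coded_order p)"
  shows "well_founded_tree (dense_tree p) \<longleftrightarrow> scattered (coded_order p) (coded_universe p)"
proof -
  let ?r = "coded_order p"
  have "(\<exists>h. \<forall>n. dense_at p h n) \<longleftrightarrow> (\<exists>D\<subseteq>coded_universe p. dense_set ?r D)"
  proof
    assume "\<exists>h. \<forall>n. dense_at p h n"
    then obtain h where h: "\<And>n. dense_at p h n" by blast
    have sub: "range h \<subseteq> coded_universe p"
      using h unfolding dense_at_def coded_universe_def by blast
    have "dense_set ?r (range h)"
      unfolding dense_set_def
    proof (intro conjI ballI impI)
      have "code_lt p (h 0) (h 1)" using h[of 1] unfolding dense_at_def by simp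
      then show "\<exists>x\<in>range h. \<exists>y\<in>range h. x \<noteq> y" unfolding code_lt by blast
    next
      fix x y assume xy: "x \<in> range h" "y \<in> range h" "(x, y) \<in> ?r \<and> x \<noteq> y"
      then obtain i j where ij: "x = h i" "y = h j" by blast
      let ?n = "prod_encode (i, j) + 2"
      have "code_lt p (h i) (h j)" using xy(3) unfolding code_lt ij .
      then have "code_lt p x (h ?n) \<and> code_lt p (h ?n) y"
        using h[of ?n] ij unfolding dense_at_def by simp
      then show "\<exists>z\<in>range h. (x, z) \<in> ?r \<and> x \<noteq> z \<and> (z, y) \<in> ?r \<and> z \<noteq> y" unfolding code_lt by blast
    qed
    then show "\<exists>D\<subseteq>coded_universe p. dense_set ?r D" using sub by blast
  next
    assume "\<exists>D\<subseteq>coded_universe p. dense_set ?r D"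
    then obtain D where D: "D \<subseteq> coded_universe p" "dense_set ?r D" by blast
    obtain a b where ab: "a \<in> D" "b \<in> D" "code_lt p a b"
    proof -
      obtain a b where ab: "a \<in> D" "b \<in> D" "a \<noteq> b" using D(2) unfolding dense_set_def by blast
      then have "code_lt p a b \<or> code_lt p b a"
        using assms D(1) unfolding total_on_def code_lt by blast
      then show thesis using that ab by blast
    qed
    \<comment> \<open>The legal choices of the \<open>n\<close>-th entry. Positions 0 and 1 are
      reserved for a pair \<open>a\<close>, \<open>b\<close> in increasing order, which explains the
      shift by 2; where nothing is demanded, \<open>a\<close> will be taken.\<close>
    let ?P = "\<lambda>h n x. x \<in> D \<and> (n = 0 \<longrightarrow> x = a) \<and> (n = 1 \<longrightarrow> x = b) \<and>
      (1 < n \<longrightarrow> code_lt p (h (pfst (n - 2))) (h (psnd (n - 2))) \<longrightarrow>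
        code_lt p (h (pfst (n - 2))) x \<and> code_lt p x (h (psnd (n - 2))))"
    have lt: "pfst (n - 2) < n" "psnd (n - 2) < n" if "1 < n" for n
      using that pfst_le[of "n - 2"] psnd_le[of "n - 2"] by linarith+
    have "\<exists>h. \<forall>n. ?P h n (h n)"
    \<comment> \<open>A demand at \<open>n\<close> may refer to any two earlier entries, so the
      choice needs the whole history.\<close>
    proof (rule dependent_wf_choice[OF wf_less_than])
      fix h h' :: "nat \<Rightarrow> nat" and n x assume "\<And>m. (m, n) \<in> less_than \<Longrightarrow> h m = h' m"
      then have "h m = h' m" if "m < n" for m using that by simp
      then show "?P h n x = ?P h' n x" using lt[of n] by (cases "1 < n") simp_all
    next
      fix n and h :: "nat \<Rightarrow> nat" assume "\<And>m. (m, n) \<in> less_than \<Longrightarrow> ?P h m (h m)"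
      then have inD: "h m \<in> D" if "m < n" for m using that by simp
      consider "n = 0" | "n = 1" | "1 < n" "code_lt p (h (pfst (n - 2))) (h (psnd (n - 2)))"
        | "1 < n" "\<not> code_lt p (h (pfst (n - 2))) (h (psnd (n - 2)))" by linarith
      then show "\<exists>x. ?P h n x"
      proof cases
        case 3
        obtain z where "z \<in> D" "code_lt p (h (pfst (n - 2))) z" "code_lt p z (h (psnd (n - 2)))"
          using dense_setD[OF D(2) inD[OF lt(1)[OF 3(1)]] inD[OF lt(2)[OF 3(1)]]] 3(2)
          unfolding code_lt by blast
        then show ?thesis using 3(1) by (intro exI[of _ z]) simp
      next
        case 4
        then show ?thesis using ab(1) by (intro exI[of _ a]) simp
      qed (use ab in auto)
    qed
    then obtain h where h: "\<And>n. ?P h n (h n)" by blast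
    have "dense_at p h n" for n
    proof -
      have "p (3 * h n) \<noteq> 0" using h[of n] D(1) unfolding coded_universe_def by blast
      moreover have "n = 1 \<longrightarrow> code_lt p (h 0) (h n)" using h[of 0] h[of 1] ab(3) by simp
      ultimately show ?thesis using h[of n] unfolding dense_at_def by blast
    qed
    then show "\<exists>h. \<forall>n. dense_at p h n" by blast
  qed
  then show ?thesis unfolding well_founded_tree_def dense_tree_path_iff scattered_def by blast
qed

text \<open>Here membership takes a computable form: the code bounds the positions, and
  \<open>ldrop\<close> tells which of them are inside the list.\<close>

lemma tree_rep_dense_tree:
  "tree_rep (\<lambda>c. of_bool (\<forall>n<c. ldrop c n \<noteq> 0 \<longrightarrow> dense_at p (lnth c) n)) = Some (dense_tree p)"
proof -
  have "(\<forall>n<list_encode \<sigma>. ldrop (list_encode \<sigma>) n \<noteq> 0 \<longrightarrow> dense_at p (lnth (list_encode \<sigma>)) n) \<longleftrightarrow>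
      \<sigma> \<in> dense_tree p" for \<sigma>
    unfolding dense_tree_def ldrop_encode_neq_0 using length_le_list_encode[of \<sigma>] by auto
  then show ?thesis unfolding tree_rep_def using tree_dense_tree by simp
qed

lemma computable_dense_tree:
  "computable (\<lambda>p. Some (\<lambda>c. of_bool (\<forall>n<c. ldrop c n \<noteq> 0 \<longrightarrow> dense_at p (lnth c) n)))"
proof (rule computable_cf)
  have "comp_pred (\<lambda>p c. \<forall>n<c. ldrop c n \<noteq> 0 \<longrightarrow> dense_at p (lnth c) n)"
    unfolding dense_at_def by (intro comp_fun_intros)
  then show "comp_fun (\<lambda>p c. of_bool (\<forall>n<c. ldrop c n \<noteq> 0 \<longrightarrow> dense_at p (lnth c) n))" unfolding comp_pred_def .
qed

text \<open>Position 1 of \<^term>\<open>baire_pair p q\<close> carries the bit \<^term>\<open>q 0\<close>.\<close>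

lemma computable_second_bit: "computable (\<lambda>p. Some (\<lambda>n. p 1))"
  by (rule computable_cf) (intro comp_fun_intros)

text \<open>Serves reductions that hand on the answer, as both do here. Only 0 and 1 have names, so
  the solution sets are compared on these values.\<close>

lemma weihrauch_le_bitI:
  assumes "computable (\<lambda>p. Some (F p))" "outrep f = bit_rep" "outrep g = bit_rep"
    and "\<And>p x Y. inrep f p = Some x \<Longrightarrow> mvf f x = Some Y \<Longrightarrow>
      \<exists>z V. inrep g (F p) = Some z \<and> mvf g z = Some V \<and> (\<forall>v\<in>V. v \<in> {0, 1} \<longrightarrow> v \<in> Y)"
  shows "f \<le>\<^sub>W g"
  unfolding weihrauch_le_def
proof (rule exI[of _ "\<lambda>p. Some (F p)"], rule exI[of _ "\<lambda>r. Some (\<lambda>n. r 1)"], intro conjI allI impI)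
  fix p x Y assume p: "inrep f p = Some x \<and> mvf f x = Some Y"
  then obtain z V where z: "inrep g (F p) = Some z" "mvf g z = Some V" "\<forall>v\<in>V. v \<in> {0, 1} \<longrightarrow> v \<in> Y"
    using assms(4) by blast
  have "\<exists>q' y. Some (\<lambda>n. baire_pair p q 1) = Some q' \<and> outrep f q' = Some y \<and> y \<in> Y"
    if q: "outrep g q = Some v \<and> v \<in> V" for q v
  proof -
    have v: "q 0 = v" "v \<in> {0, 1}" using q assms(3) unfolding bit_rep_def by (auto split: if_splits)
    have "baire_pair p q 1 = v" using v unfolding baire_pair_def by simp
    moreover have "bit_rep (\<lambda>n. v) = Some v" using v(2) unfolding bit_rep_def by simp
    moreover have "v \<in> Y" using z(3) q v(2) by blast
    ultimately show ?thesis using assms(2) by simp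
  qed
  with z show "\<exists>p' z V. Some (F p) = Some p' \<and> inrep g p' = Some z \<and> mvf g z = Some V \<and>
      (\<forall>q v. outrep g q = Some v \<and> v \<in> V \<longrightarrow>
        (\<exists>q' y. Some (\<lambda>n. baire_pair p q 1) = Some q' \<and> outrep f q' = Some y \<and> y \<in> Y))" by blast
qed (use assms(1) computable_second_bit in auto)

section \<open>From groups to trees\<close>

lemma coded_group_carrier [simp]: "carrier (coded_group p) = coded_universe p"
  and coded_group_mult [simp]: "mult (coded_group p) = coded_mult p"
  by (simp_all add: coded_group_def)

text \<open>The bit of the tree has to belong to the solution set, which demands an actual
  well-order as witness; it is supplied by \<open>Maltsev_order_type\<close>.\<close>

lemma OG_eps_le_WF: "OG_eps \<le>\<^sub>W WF"
proof (rule weihrauch_le_bitI[OF computable_dense_tree])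
  show "outrep OG_eps = bit_rep" "outrep WF = bit_rep" by (simp_all add: OG_eps_def WF_def)
  fix p x Y assume px: "inrep OG_eps p = Some x" "mvf OG_eps x = Some Y"
  then have og: "ordered_group (coded_group p) (coded_order p)"
    and x: "x = (coded_group p, coded_order p)"
    unfolding OG_eps_def og_rep_def by (auto split: if_splits)
  have Y: "Y = {\<epsilon>. \<exists>\<alpha> :: nat rel. Well_order \<alpha> \<and> has_order_type_ZQ (coded_order p) \<alpha> \<epsilon>}"
    using px(2) og unfolding x OG_eps_def by simp
  interpret group "coded_group p" using og unfolding ordered_group_def by blast
  interpret ogroup "coded_group p" "coded_order p"
    by unfold_locales (use og in \<open>auto simp: ordered_group_def\<close>)
  have "countable (carrier (coded_group p))" by simp
  from Maltsev_order_type[OF this] obtain \<alpha> :: "nat rel" where \<alpha>: "Well_order \<alpha>"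
    "if scattered (coded_order p) (coded_universe p)
     then order_isomorphic (coded_order p) (Z_pow \<alpha>)
     else order_isomorphic (coded_order p) (order_prod (Z_pow \<alpha>) Q_order)" by auto
  let ?T = "dense_tree p"
  have "(if well_founded_tree ?T then 0 else 1) \<in> Y"
    unfolding Y using \<alpha> well_founded_dense_tree_iff[of p] r_total
    by (auto simp: has_order_type_ZQ_def split: if_splits)
  then show "\<exists>z V. inrep WF (\<lambda>c. of_bool (\<forall>n<c. ldrop c n \<noteq> 0 \<longrightarrow> dense_at p (lnth c) n)) = Some z \<and>
      mvf WF z = Some V \<and> (\<forall>v\<in>V. v \<in> {0, 1} \<longrightarrow> v \<in> Y)"
    using tree_rep_dense_tree[of p] tree_dense_tree by (simp add: WF_def split: if_splits)
qed

section \<open>The Kleene--Brouwer order\<close>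

text \<open>Views a coded list as an infinite sequence, with entries raised by one and 0 after the
  end. Codes can then be compared without reference to lengths.\<close>

definition entry :: "nat \<Rightarrow> nat \<Rightarrow> nat" where
  "entry x i = (if ldrop x i \<noteq> 0 then Suc (lnth x i) else 0)"

lemma entry_encode: "entry (list_encode xs) i = (if i < length xs then Suc (xs ! i) else 0)"
  unfolding entry_def using ldrop_encode_neq_0[of xs i] lnth_encode[of xs i] by simp

lemma entry_antimono: "entry x i = 0 \<Longrightarrow> i \<le> j \<Longrightarrow> entry x j = 0"
  using entry_encode[of "list_decode x"] by (simp split: if_splits)

lemma entry_eqI:
  assumes "\<And>i. entry x i = entry y i" shows "x = y"
proof -
  let ?xs = "list_decode x" and ?ys = "list_decode y"
  have eq: "(if i < length ?xs then Suc (?xs ! i) else 0) = (if i < length ?ys then Suc (?ys ! i) else 0)" for i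
    using assms[of i] entry_encode[of ?xs i] entry_encode[of ?ys i] by simp
  then have "i < length ?xs \<longleftrightarrow> i < length ?ys" for i by (metis nat.distinct(1))
  then have len: "length ?xs = length ?ys" by (metis linorder_neqE_nat nat_less_le)
  have "?xs ! i = ?ys ! i" if "i < length ?xs" for i using eq[of i] len that by simp
  then have "?xs = ?ys" using len by (rule nth_equalityI[rotated])
  then show ?thesis by (metis list_decode_inverse)
qed

lemma entry_neq_0_less: "entry x i \<noteq> 0 \<Longrightarrow> i < x"
  using entry_encode[of "list_decode x" i] length_le_list_encode[of "list_decode x"]
  by (simp split: if_splits)

definition entry_lt :: "nat \<Rightarrow> nat \<Rightarrow> bool" where
  "entry_lt m n \<longleftrightarrow> m \<noteq> 0 \<and> (n = 0 \<or> m < n)"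

text \<open>The Kleene--Brouwer order on codes of sequences, where \<open>0\<close> marks the end and is the
  largest entry.\<close>

definition kb_lt :: "nat \<Rightarrow> nat \<Rightarrow> bool" where
  "kb_lt x y \<longleftrightarrow> (\<exists>i<x. entry_lt (entry x i) (entry y i) \<and> (\<forall>j<i. entry x j = entry y j))"

text \<open>The bound in \<open>kb_lt\<close> keeps the relation decidable; it is met automatically
  because \<open>entry x i\<close> is nonzero, hence \<open>i < x\<close>.\<close>

lemma kb_ltI: "entry_lt (entry x i) (entry y i) \<Longrightarrow> (\<And>j. j < i \<Longrightarrow> entry x j = entry y j) \<Longrightarrow> kb_lt x y"
  unfolding kb_lt_def entry_lt_def using entry_neq_0_less[of x i] by blast

lemma kb_lt_irrefl: "\<not> kb_lt x x"
  unfolding kb_lt_def entry_lt_def by auto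

lemma kb_lt_trans:
  assumes "kb_lt x y" "kb_lt y z" shows "kb_lt x z"
proof -
  obtain i where i: "entry_lt (entry x i) (entry y i)" "\<And>j. j < i \<Longrightarrow> entry x j = entry y j"
    using assms(1) unfolding kb_lt_def by blast
  obtain k where k: "entry_lt (entry y k) (entry z k)" "\<And>j. j < k \<Longrightarrow> entry y j = entry z j"
    using assms(2) unfolding kb_lt_def by blast
  show ?thesis
  proof (rule kb_ltI[of _ "min i k"])
    consider "i < k" | "i = k" | "k < i" by linarith
    then show "entry_lt (entry x (min i k)) (entry z (min i k))"
      by cases (use i k in \<open>auto simp: entry_lt_def\<close>)
    show "entry x j = entry z j" if "j < min i k" for j using i(2)[of j] k(2)[of j] that by simp
  qed
qed

lemma kb_lt_total:
  assumes "x \<noteq> y" shows "kb_lt x y \<or> kb_lt y x"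
proof -
  have "\<exists>i. entry x i \<noteq> entry y i" using entry_eqI assms by blast
  then obtain i where i: "entry x i \<noteq> entry y i" "\<And>j. j < i \<Longrightarrow> entry x j = entry y j"
    using exists_least_iff[of "\<lambda>i. entry x i \<noteq> entry y i"] by blast
  have "entry_lt (entry x i) (entry y i) \<or> entry_lt (entry y i) (entry x i)"
    using i(1) unfolding entry_lt_def by linarith
  then show ?thesis using kb_ltI[of x i y] kb_ltI[of y i x] i(2) by auto
qed

text \<open>Nodes are represented by their codes. The relation is a linear order for every
  \<open>p\<close>, tree or not, so the group built on it exists for every point of Baire
  space.\<close>

definition kb_order :: "baire \<Rightarrow> nat rel" where
  "kb_order p = {(x, y). p x \<noteq> 0 \<and> p y \<noteq> 0 \<and> (x = y \<or> kb_lt x y)}"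

lemma Field_kb_order: "Field (kb_order p) = {x. p x \<noteq> 0}"
  unfolding kb_order_def Field_def by auto

lemma linear_order_kb_order: "Linear_order (kb_order p)"
proof -
  have "kb_order p \<subseteq> {x. p x \<noteq> 0} \<times> {x. p x \<noteq> 0}" unfolding kb_order_def by auto
  moreover have "refl_on {x. p x \<noteq> 0} (kb_order p)" unfolding kb_order_def refl_on_def by auto
  moreover have "trans (kb_order p)"
    unfolding kb_order_def by (rule transI) (auto dest: kb_lt_trans)
  moreover have "antisym (kb_order p)"
    unfolding kb_order_def by (rule antisymI) (use kb_lt_trans kb_lt_irrefl in blast)
  moreover have "total_on {x. p x \<noteq> 0} (kb_order p)"
    unfolding kb_order_def by (rule total_onI) (use kb_lt_total in blast)
  ultimately show ?thesis unfolding Field_kb_order order_on_defs by blast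
qed

definition extends :: "nat \<Rightarrow> nat list \<Rightarrow> bool" where
  "extends x \<sigma> \<longleftrightarrow> (\<forall>i<length \<sigma>. entry x i = Suc (\<sigma> ! i))"

lemma extends_encode: "extends (list_encode \<tau>) \<sigma> \<longleftrightarrow> prefix \<sigma> \<tau>"
proof
  assume e: "extends (list_encode \<tau>) \<sigma>"
  then have *: "i < length \<tau> \<and> \<tau> ! i = \<sigma> ! i" if "i < length \<sigma>" for i
    using that entry_encode[of \<tau> i] unfolding extends_def by (auto split: if_splits)
  then have "length \<sigma> \<le> length \<tau>" by (meson leI less_irrefl)
  then have "take (length \<sigma>) \<tau> = \<sigma>" using * by (intro nth_equalityI) auto
  then show "prefix \<sigma> \<tau>" by (metis take_is_prefix)
qed (auto simp: extends_def entry_encode prefix_def nth_append)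

lemma extends_snoc: "extends x (\<sigma> @ [v]) \<longleftrightarrow> extends x \<sigma> \<and> entry x (length \<sigma>) = Suc v"
  unfolding extends_def by (auto simp: less_Suc_eq nth_append)

lemma kb_lt_extends:
  assumes "extends x \<sigma>" "extends y \<sigma>" "entry_lt (entry x (length \<sigma>)) (entry y (length \<sigma>))"
  shows "kb_lt x y"
  using kb_ltI[OF assms(3)] assms(1,2) unfolding extends_def by simp

text \<open>A nonempty set without a minimum is followed downwards: at each node one passes to the
  leftmost child through which members of the set still go, and this yields an infinite
  path.\<close>

lemma Well_order_kb_order:
  assumes T: "tree {\<sigma>. p (list_encode \<sigma>) \<noteq> 0}" and wf: "well_founded_tree {\<sigma>. p (list_encode \<sigma>) \<noteq> 0}"
  shows "Well_order (kb_order p)"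
proof -
  have "wf (kb_order p - Id)"
    unfolding wf_eq_minimal
  proof (intro allI impI)
    fix x0 and Q :: "nat set" assume x0: "x0 \<in> Q"
    show "\<exists>z\<in>Q. \<forall>y. (y, z) \<in> kb_order p - Id \<longrightarrow> y \<notin> Q"
    proof (rule ccontr)
      assume "\<not> ?thesis"
      then have nomin: "\<exists>y\<in>Q. (y, z) \<in> kb_order p - Id" if "z \<in> Q" for z using that by blast
      have lower: "\<exists>y\<in>Q. kb_lt y z" if "z \<in> Q" for z
        using nomin[OF that] unfolding kb_order_def by blast
      have Qp: "p z \<noteq> 0" if "z \<in> Q" for z
        using nomin[OF that] unfolding kb_order_def by blast
      \<comment> \<open>The members of \<open>Q\<close> that extend \<sigma> form a nonempty initial
        part of \<open>Q\<close>, so anything in \<open>Q\<close> below one of them extends \<sigma>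
        as well.\<close>
      define good where "good \<sigma> \<longleftrightarrow> (\<exists>z\<in>Q. extends z \<sigma>) \<and>
        (\<forall>y\<in>Q. \<forall>z\<in>Q. extends z \<sigma> \<and> \<not> extends y \<sigma> \<longrightarrow> kb_lt z y)" for \<sigma>
      have step: "\<exists>v. good (\<sigma> @ [v])" if g: "good \<sigma>" for \<sigma>
      proof -
        let ?n = "length \<sigma>"
        obtain z where z: "z \<in> Q" "extends z \<sigma>" using g unfolding good_def by blast
        \<comment> \<open>Otherwise every member extending \<sigma> would end there and be the code
          of \<sigma>; a lower member would extend \<sigma> too and coincide with it.\<close>
        have "\<exists>v. \<exists>y\<in>Q. extends y (\<sigma> @ [v])"
        proof (rule ccontr)
          assume none: "\<not> ?thesis"
          have last: "entry y ?n = 0" if "y \<in> Q" "extends y \<sigma>" for y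
            using none that unfolding extends_snoc by (metis not0_implies_Suc)
          obtain y where y: "y \<in> Q" "kb_lt y z" using lower z(1) by blast
          have ey: "extends y \<sigma>"
          proof (rule ccontr)
            assume "\<not> extends y \<sigma>"
            then have "kb_lt z y" using g z y(1) unfolding good_def by blast
            then show False using y(2) kb_lt_trans kb_lt_irrefl by blast
          qed
          have "entry y i = entry z i" for i
          proof (cases "i < ?n")
            case True
            then show ?thesis using ey z(2) unfolding extends_def by simp
          next
            case False
            then show ?thesis
              using entry_antimono[OF last[OF z]] entry_antimono[OF last[OF y(1) ey]] by simp
          qed
          then have "y = z" by (rule entry_eqI)
          then show False using y(2) kb_lt_irrefl by blast
        qed
        \<comment> \<open>The least possible next entry: members with a larger entry there, or
          ending at \<sigma>, come later in the order, so \<open>good\<close> is preserved.\<close>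
        then obtain v where v: "\<exists>y\<in>Q. extends y (\<sigma> @ [v])"
          "\<And>w. w < v \<Longrightarrow> \<not> (\<exists>y\<in>Q. extends y (\<sigma> @ [w]))"
          using exists_least_iff[of "\<lambda>v. \<exists>y\<in>Q. extends y (\<sigma> @ [v])"] by blast
        have "kb_lt z y" if zy: "y \<in> Q" "z \<in> Q" "extends z (\<sigma> @ [v])" "\<not> extends y (\<sigma> @ [v])" for y z
        proof (cases "extends y \<sigma>")
          case True
          have "entry_lt (entry z ?n) (entry y ?n)"
          proof (cases "entry y ?n")
            case 0
            then show ?thesis using zy(3) unfolding extends_snoc entry_lt_def by simp
          next
            case (Suc w)
            then have "\<not> w < v" "w \<noteq> v" using v(2)[of w] zy(1,4) True unfolding extends_snoc by blast+
            then show ?thesis using zy(3) Suc unfolding extends_snoc entry_lt_def by simp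
          qed
          then show ?thesis using kb_lt_extends True zy(3) unfolding extends_snoc by blast
        next
          case False
          then show ?thesis using g zy unfolding good_def extends_snoc by blast
        qed
        then have "good (\<sigma> @ [v])" using v(1) unfolding good_def by blast
        then show ?thesis by blast
      qed
      have "\<exists>f. \<forall>n. (length (f n) = n \<and> good (f n)) \<and> (\<exists>v. f (Suc n) = f n @ [v])"
      proof (rule dependent_nat_choice)
        have "good []" using x0 unfolding good_def extends_def by auto
        then show "\<exists>\<sigma>. length \<sigma> = 0 \<and> good \<sigma>" by auto
      next
        fix \<sigma> n assume s: "length \<sigma> = n \<and> good \<sigma>"
        then obtain v where "good (\<sigma> @ [v])" using step by blast
        then show "\<exists>\<tau>. (length \<tau> = Suc n \<and> good \<tau>) \<and> (\<exists>v. \<tau> = \<sigma> @ [v])"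
          using s by (intro exI[of _ "\<sigma> @ [v]"]) auto
      qed
      then obtain f where f: "\<And>n. length (f n) = n" "\<And>n. good (f n)" "\<And>n. \<exists>v. f (Suc n) = f n @ [v]"
        by blast
      define h where "h n = last (f (Suc n))" for n
      have fh: "f n = map h [0..<n]" for n
      proof (induction n)
        case 0
        then show ?case using f(1)[of 0] by simp
      next
        case (Suc n)
        obtain v where "f (Suc n) = f n @ [v]" using f(3) by blast
        then show ?case using Suc unfolding h_def by simp
      qed
      have "map h [0..<n] \<in> {\<sigma>. p (list_encode \<sigma>) \<noteq> 0}" for n
      proof -
        obtain z where z: "z \<in> Q" "extends z (f n)" using f(2)[of n] unfolding good_def by blast
        have "prefix (f n) (list_decode z)" using z(2) extends_encode[of "list_decode z"] by simp
        moreover have "list_decode z \<in> {\<sigma>. p (list_encode \<sigma>) \<noteq> 0}" using Qp[OF z(1)] by simp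
        ultimately show ?thesis using T fh unfolding tree_def by metis
      qed
      then show False using wf unfolding well_founded_tree_def by blast
    qed
  qed
  then show ?thesis unfolding well_order_on_def using linear_order_kb_order by blast
qed

lemma dense_Z_pow_kb_order:
  assumes "\<not> well_founded_tree {\<sigma>. p (list_encode \<sigma>) \<noteq> 0}"
  shows "\<exists>D\<subseteq>fin_supp (kb_order p). dense_set (Z_pow (kb_order p)) D"
proof -
  obtain h where path: "\<And>n. p (list_encode (map h [0..<n])) \<noteq> 0"
    using assms unfolding well_founded_tree_def by blast
  define x where "x n = list_encode (map h [0..<n])" for n
  have h: "p (x n) \<noteq> 0" for n using path unfolding x_def .
  let ?K = "kb_order p"
  note K = linear_order_onD[OF linear_order_kb_order[of p]]
  \<comment> \<open>Prolonging a sequence replaces the end marker, the largest entry, by a smaller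
    one, so the path is a descending sequence.\<close>
  have dec: "(x (Suc n), x n) \<in> ?K" "x (Suc n) \<noteq> x n" for n
  proof -
    have "kb_lt (x (Suc n)) (x n)"
      unfolding x_def by (rule kb_ltI[of _ n]) (auto simp: entry_encode entry_lt_def nth_append)
    then show "(x (Suc n), x n) \<in> ?K" "x (Suc n) \<noteq> x n"
      using h kb_lt_irrefl unfolding kb_order_def by auto
  qed
  let ?D = "{f \<in> fin_supp ?K. {y. f y \<noteq> 0} \<subseteq> range x}"
  have upd: "f(x n := k) \<in> ?D" if f: "f \<in> ?D" for f n k
  proof -
    have "{y. (f(x n := k)) y \<noteq> 0} \<subseteq> insert (x n) {y. f y \<noteq> 0}" by auto
    moreover have "finite {y. f y \<noteq> 0}" "{y. f y \<noteq> 0} \<subseteq> Field ?K" "{y. f y \<noteq> 0} \<subseteq> range x"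
      using f unfolding fin_supp_def by blast+
    moreover have "x n \<in> Field ?K" using h Field_kb_order by blast
    ultimately have "finite {y. (f(x n := k)) y \<noteq> 0}" "{y. (f(x n := k)) y \<noteq> 0} \<subseteq> Field ?K"
      "{y. (f(x n := k)) y \<noteq> 0} \<subseteq> range x"
      using finite_subset[of "{y. (f(x n := k)) y \<noteq> 0}" "insert (x n) {y. f y \<noteq> 0}"] by blast+
    then show ?thesis unfolding fin_supp_def by blast
  qed
  have zero: "(\<lambda>_. 0) \<in> ?D" unfolding fin_supp_def by simp
  have "dense_set (Z_pow ?K) ?D"
    unfolding dense_set_def
  proof (intro conjI ballI impI)
    have "(\<lambda>_. 0 :: int) \<noteq> (\<lambda>_. 0)(x 0 := 1)" by (metis fun_upd_same zero_neq_one)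
    then show "\<exists>f\<in>?D. \<exists>g\<in>?D. f \<noteq> g" using zero upd[OF zero, of 0 1] by blast
  next
    fix f g assume f: "f \<in> ?D" and g: "g \<in> ?D" and fg: "(f, g) \<in> Z_pow ?K \<and> f \<noteq> g"
    obtain y where y: "f y < g y" "\<And>z. f z \<noteq> g z \<Longrightarrow> (z, y) \<in> ?K"
      using fg unfolding Z_pow_def by blast
    have "f y \<noteq> 0 \<or> g y \<noteq> 0" using y(1) by auto
    then obtain n where n: "y = x n" using f g by blast
    \<comment> \<open>The place \<open>x (Suc n)\<close> lies strictly below the deciding place
      \<open>y = x n\<close>. Adding 1 there passes \<open>f\<close> but does not affect the
      comparison with \<open>g\<close>, which takes place at \<open>y\<close>.\<close>
    let ?e = "f(x (Suc n) := f (x (Suc n)) + 1)"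
    have e: "?e \<in> ?D" using upd[OF f] .
    have fe: "(f, ?e) \<in> Z_pow ?K"
    proof -
      have "(x (Suc n), x (Suc n)) \<in> ?K" using K(1) h Field_kb_order by blast
      then show ?thesis using f e unfolding Z_pow_def by (auto intro!: exI[of _ "x (Suc n)"])
    qed
    have fe': "f \<noteq> ?e" by (metis add_cancel_right_right fun_upd_same zero_neq_one)
    have ey: "?e y = f y" using dec(2)[of n] n by simp
    have "(z, y) \<in> ?K" if "?e z \<noteq> g z" for z
      using that y(2)[of z] dec(1)[of n] n by (cases "z = x (Suc n)") auto
    moreover have "?e y < g y" using ey y(1) by simp
    ultimately have "\<exists>w. ?e w < g w \<and> (\<forall>z. ?e z \<noteq> g z \<longrightarrow> (z, w) \<in> ?K)" by blast
    then have "(?e, g) \<in> Z_pow ?K" using e g unfolding Z_pow_def by blast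
    moreover have "?e \<noteq> g" using ey y(1) by auto
    ultimately show "\<exists>e\<in>?D. (f, e) \<in> Z_pow ?K \<and> f \<noteq> e \<and> (e, g) \<in> Z_pow ?K \<and> e \<noteq> g" using e fe fe' by blast
  qed
  moreover have "?D \<subseteq> fin_supp ?K" by simp
  ultimately show ?thesis by (intro exI[of _ ?D] conjI)
qed

section \<open>The ordered group of a tree\<close>

text \<open>Integers are coded non-uniquely as differences of the components of a pair, so a finitely
  supported function has many codes; only its least code belongs to the universe.\<close>

definition coef :: "nat \<Rightarrow> nat \<Rightarrow> int" where
  "coef c i = int (pfst (lnth c i)) - int (psnd (lnth c i))"

lemma coef_neq_0_less: "coef c i \<noteq> 0 \<Longrightarrow> i < c"
proof -
  assume "coef c i \<noteq> 0"
  then have "lnth c i \<noteq> 0" unfolding coef_def by (cases "lnth c i = 0") auto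
  then have "i < length (list_decode c)"
    using lnth_encode[of "list_decode c" i] by (simp split: if_splits)
  then show "i < c" using length_le_list_encode[of "list_decode c"] by simp
qed

lemma finite_coef: "finite {i. coef c i \<noteq> 0}"
  by (rule finite_subset[of _ "{..<c}"]) (auto dest: coef_neq_0_less)

lemma coef_surj:
  assumes "finite {i. f i \<noteq> 0}" shows "\<exists>c. coef c = f"
proof -
  obtain N where N: "{i. f i \<noteq> 0} \<subseteq> {..<N}" using assms finite_nat_iff_bounded by blast
  let ?xs = "map (\<lambda>i. prod_encode (nat (f i), nat (- f i))) [0..<N]"
  have "coef (list_encode ?xs) i = f i" for i
  proof (cases "i < N")
    case False
    then have "f i = 0" using N by auto
    then show ?thesis using False unfolding coef_def by (simp add: lnth_encode)
  qed (simp add: coef_def lnth_encode)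
  then show ?thesis by blast
qed

definition universe :: "baire \<Rightarrow> nat set" where
  "universe p = {c. (\<forall>i<c. coef c i \<noteq> 0 \<longrightarrow> p i \<noteq> 0) \<and> (\<forall>b<c. \<exists>i<c. coef b i \<noteq> coef c i)}"

text \<open>Coefficients at positions not below the code vanish, so the bounded quantifiers in
  \<open>universe\<close> express statements about whole functions.\<close>

lemma universe_iff:
  "c \<in> universe p \<longleftrightarrow> coef c \<in> fin_supp (kb_order p) \<and> (\<forall>b<c. coef b \<noteq> coef c)"
proof -
  have "(\<exists>i<c. coef b i \<noteq> coef c i) \<longleftrightarrow> coef b \<noteq> coef c" if "b < c" for b
    using coef_neq_0_less[of b] coef_neq_0_less[of c] that by (metis ext less_trans)
  moreover have "(\<forall>i<c. coef c i \<noteq> 0 \<longrightarrow> p i \<noteq> 0) \<longleftrightarrow> coef c \<in> fin_supp (kb_order p)"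
    using finite_coef[of c] coef_neq_0_less[of c] unfolding fin_supp_def Field_kb_order by blast
  ultimately show ?thesis unfolding universe_def by auto
qed

lemma Least_code_universe:
  assumes "f \<in> fin_supp (kb_order p)"
  shows "(LEAST c. coef c = f) \<in> universe p" "coef (LEAST c. coef c = f) = f"
proof -
  have "\<exists>c. coef c = f" using coef_surj assms unfolding fin_supp_def by blast
  then show eq: "coef (LEAST c. coef c = f) = f" by (rule LeastI_ex)
  have "coef b \<noteq> f" if "b < (LEAST c. coef c = f)" for b using not_less_Least[OF that] .
  then show "(LEAST c. coef c = f) \<in> universe p" unfolding universe_iff eq using assms by blast
qed

lemma inj_on_coef: "inj_on coef (universe p)"
proof (rule inj_onI)
  fix a b assume "a \<in> universe p" "b \<in> universe p" "coef a = coef b"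
  then have "\<not> a < b" "\<not> b < a" unfolding universe_iff by auto
  then show "a = b" by simp
qed

lemma bij_betw_coef: "bij_betw coef (universe p) (fin_supp (kb_order p))"
  unfolding bij_betw_def
proof
  show "coef ` universe p = fin_supp (kb_order p)"
  proof
    show "coef ` universe p \<subseteq> fin_supp (kb_order p)" by (auto simp: universe_iff)
    show "fin_supp (kb_order p) \<subseteq> coef ` universe p" using Least_code_universe by (metis image_eqI subsetI)
  qed
qed (rule inj_on_coef)

text \<open>Minimisation finds a code of the sum and at once the least one, so the result stays in
  the universe. From the bound on, all three coefficients vanish, which makes the test decidable;
  the search succeeds for all \<open>a\<close> and \<open>b\<close>.\<close>

definition code_add :: "nat \<Rightarrow> nat \<Rightarrow> nat" where
  "code_add a b = (LEAST c. \<forall>i<a + b + c. coef c i = coef a i + coef b i)"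

definition code_le :: "nat \<Rightarrow> nat \<Rightarrow> bool" where
  "code_le a b \<longleftrightarrow> a = b \<or> (\<exists>x<a + b. coef a x < coef b x \<and>
     (\<forall>y<a + b. coef a y \<noteq> coef b y \<longrightarrow> y = x \<or> kb_lt y x))"

lemma code_add_eq: "code_add a b = (LEAST c. coef c = (\<lambda>i. coef a i + coef b i))"
proof -
  have "(\<forall>i<a + b + c. coef c i = coef a i + coef b i) \<longleftrightarrow> coef c = (\<lambda>i. coef a i + coef b i)" for c
  proof
    assume *: "\<forall>i<a + b + c. coef c i = coef a i + coef b i"
    have "coef c i = coef a i + coef b i" for i
    proof (cases "i < a + b + c")
      case False
      then have "\<not> i < a" "\<not> i < b" "\<not> i < c" by simp_all
      then have "coef a i = 0" "coef b i = 0" "coef c i = 0" using coef_neq_0_less by blast+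
      then show ?thesis by simp
    qed (use * in blast)
    then show "coef c = (\<lambda>i. coef a i + coef b i)" by blast
  qed simp
  then show ?thesis unfolding code_add_def by simp
qed

lemma fin_supp_add:
  assumes "f \<in> fin_supp r" "g \<in> fin_supp r" shows "(\<lambda>i. f i + g i) \<in> fin_supp r"
proof -
  have "{i. f i + g i \<noteq> 0} \<subseteq> {i. f i \<noteq> 0} \<union> {i. g i \<noteq> 0}" by auto
  moreover have "finite ({i. f i \<noteq> 0} \<union> {i. g i \<noteq> 0})" using assms unfolding fin_supp_def by blast
  moreover have "{i. f i \<noteq> 0} \<union> {i. g i \<noteq> 0} \<subseteq> Field r" using assms unfolding fin_supp_def by blast
  ultimately have "finite {i. f i + g i \<noteq> 0}" "{i. f i + g i \<noteq> 0} \<subseteq> Field r"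
    using finite_subset by blast+
  then show ?thesis unfolding fin_supp_def by blast
qed

lemma code_add:
  assumes "a \<in> universe p" "b \<in> universe p"
  shows "code_add a b \<in> universe p" "coef (code_add a b) = (\<lambda>i. coef a i + coef b i)"
  using Least_code_universe[OF fin_supp_add, of "coef a" p "coef b"] assms
  unfolding code_add_eq universe_iff[of a] universe_iff[of b] by blast+

text \<open>Places where the coefficients differ lie below \<open>a + b\<close>, and membership in
  \<open>universe p\<close> confines them to the field of \<open>kb_order p\<close>. Therefore
  \<open>code_le\<close> can be defined without reference to \<open>p\<close>.\<close>

lemma code_le_iff:
  assumes "a \<in> universe p" "b \<in> universe p"
  shows "code_le a b \<longleftrightarrow> (coef a, coef b) \<in> Z_pow (kb_order p)"
proof -
  have F: "coef a \<in> fin_supp (kb_order p)" "coef b \<in> fin_supp (kb_order p)"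
    using assms universe_iff by blast+
  have supp: "p y \<noteq> 0" "y < a + b" if "coef a y \<noteq> coef b y" for y
  proof -
    have ne: "coef a y \<noteq> 0 \<or> coef b y \<noteq> 0" using that by auto
    then show "y < a + b" using coef_neq_0_less[of a y] coef_neq_0_less[of b y] by auto
    show "p y \<noteq> 0" using F ne unfolding fin_supp_def Field_kb_order by blast
  qed
  have ex: "(\<exists>x<a + b. coef a x < coef b x \<and> (\<forall>y<a + b. coef a y \<noteq> coef b y \<longrightarrow> y = x \<or> kb_lt y x)) \<longleftrightarrow>
    (\<exists>x. coef a x < coef b x \<and> (\<forall>y. coef a y \<noteq> coef b y \<longrightarrow> (y, x) \<in> kb_order p))"
    (is "?L \<longleftrightarrow> ?R")
  proof
    assume ?L
    then obtain x where x: "coef a x < coef b x"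
      "\<And>y. y < a + b \<Longrightarrow> coef a y \<noteq> coef b y \<Longrightarrow> y = x \<or> kb_lt y x" by blast
    have "coef a x \<noteq> coef b x" using x(1) by simp
    then have "(y, x) \<in> kb_order p" if "coef a y \<noteq> coef b y" for y
      using supp[of x] supp[OF that] x(2)[of y] that unfolding kb_order_def by blast
    then show ?R using x(1) by blast
  next
    assume ?R
    then obtain x where x: "coef a x < coef b x"
      "\<And>y. coef a y \<noteq> coef b y \<Longrightarrow> (y, x) \<in> kb_order p" by blast
    have "x < a + b" using supp(2)[of x] x(1) by simp
    then show ?L using x unfolding kb_order_def by blast
  qed
  have eq: "a = b \<longleftrightarrow> coef a = coef b" using inj_on_coef assms unfolding inj_on_def by blast
  show ?thesis unfolding code_le_def ex unfolding eq Z_pow_def using F by simp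
qed

lemma Z_pow_add:
  assumes "(f, g) \<in> Z_pow r" "h \<in> fin_supp r"
  shows "((\<lambda>i. f i + h i), (\<lambda>i. g i + h i)) \<in> Z_pow r"
  using assms fin_supp_add[of _ r h] unfolding Z_pow_def by auto

definition group_name :: "baire \<Rightarrow> baire" where
  "group_name p n = (let m = n div 3 in
     if n = 3 * m then of_bool (m \<in> universe p)
     else if n = 3 * m + 1 then code_add (pfst m) (psnd m)
     else of_bool (code_le (pfst m) (psnd m)))"

lemma group_name_simps:
  "group_name p (3 * m) = of_bool (m \<in> universe p)"
  "group_name p (3 * m + 1) = code_add (pfst m) (psnd m)"
  "group_name p (3 * m + 2) = of_bool (code_le (pfst m) (psnd m))"
proof -
  have "(3 * m + 1) div 3 = m" "(3 * m + 2) div 3 = m" by simp_all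
  then show "group_name p (3 * m) = of_bool (m \<in> universe p)"
    "group_name p (3 * m + 1) = code_add (pfst m) (psnd m)"
    "group_name p (3 * m + 2) = of_bool (code_le (pfst m) (psnd m))"
    unfolding group_name_def Let_def by simp_all
qed

lemma coded_universe_group_name [simp]: "coded_universe (group_name p) = universe p"
  unfolding coded_universe_def group_name_simps by simp

lemma coded_mult_group_name:
  "a \<in> universe p \<Longrightarrow> b \<in> universe p \<Longrightarrow> coded_mult (group_name p) a b = code_add a b"
  unfolding coded_mult_def group_name_simps by simp

lemma coded_order_group_name:
  "coded_order (group_name p) =
    {(a, b). a \<in> universe p \<and> b \<in> universe p \<and> (coef a, coef b) \<in> Z_pow (kb_order p)}"
  unfolding coded_order_def group_name_simps using code_le_iff by auto

text \<open>The laws are checked coefficientwise, as \<open>coef\<close> is injective on the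
  universe. The identity of a coded group is a definite description, so the least code of the zero
  function is first shown to be the only candidate.\<close>

lemma ordered_group_group_name: "ordered_group (coded_group (group_name p)) (coded_order (group_name p))"
proof -
  let ?G = "coded_group (group_name p)" and ?r = "coded_order (group_name p)" and ?U = "universe p"
    and ?K = "kb_order p"
  note Z = linear_order_onD[OF linear_order_Z_pow[OF linear_order_kb_order[of p]]]
  have inj: "a = b" if "a \<in> ?U" "b \<in> ?U" "coef a = coef b" for a b
    using inj_on_coef that unfolding inj_on_def by blast
  have FS: "coef a \<in> fin_supp ?K" if "a \<in> ?U" for a using that universe_iff by blast
  note add = coded_mult_group_name code_add
  define e where "e = (LEAST c. coef c = (\<lambda>_. 0))"
  have "(\<lambda>_. 0) \<in> fin_supp ?K" unfolding fin_supp_def by simp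
  from Least_code_universe[OF this] have e: "e \<in> ?U" "coef e = (\<lambda>_. 0)" unfolding e_def by blast+
  have unit: "code_add e a = a" "code_add a e = a" if "a \<in> ?U" for a
    using that e by (auto intro!: inj simp: code_add)
  have "one ?G = (THE e. e \<in> ?U \<and> (\<forall>a\<in>?U. coded_mult (group_name p) e a = a \<and> coded_mult (group_name p) a e = a))"
    by (simp add: coded_group_def)
  also have "\<dots> = e"
  proof (rule the_equality)
    show "e \<in> ?U \<and> (\<forall>a\<in>?U. coded_mult (group_name p) e a = a \<and> coded_mult (group_name p) a e = a)"
      using e unit by (simp add: coded_mult_group_name)
    fix e' assume e': "e' \<in> ?U \<and> (\<forall>a\<in>?U. coded_mult (group_name p) e' a = a \<and> coded_mult (group_name p) a e' = a)"
    then have "coded_mult (group_name p) e' e = e" using e(1) by blast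
    then show "e' = e" using e' e(1) unit(2)[of e'] by (simp add: coded_mult_group_name)
  qed
  finally have one: "one ?G = e" .
  have "group ?G"
  proof (rule groupI)
    fix x y z assume xyz: "x \<in> carrier ?G" "y \<in> carrier ?G" "z \<in> carrier ?G"
    have "code_add (code_add x y) z = code_add x (code_add y z)"
      by (rule inj) (use xyz in \<open>simp_all add: code_add[of _ p] algebra_simps\<close>)
    then show "x \<otimes>\<^bsub>?G\<^esub> y \<otimes>\<^bsub>?G\<^esub> z = x \<otimes>\<^bsub>?G\<^esub> (y \<otimes>\<^bsub>?G\<^esub> z)"
      using xyz by (simp add: coded_mult_group_name code_add)
  next
    fix x assume x: "x \<in> carrier ?G"
    have "{i. - coef x i \<noteq> 0} = {i. coef x i \<noteq> 0}" by auto
    then have "(\<lambda>i. - coef x i) \<in> fin_supp ?K" using FS[of x] x unfolding fin_supp_def by simp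
    then obtain y where y: "y \<in> ?U" "coef y = (\<lambda>i. - coef x i)" using Least_code_universe by metis
    have "code_add y x = e" by (rule inj) (use x y e in \<open>simp_all add: code_add[of _ p]\<close>)
    then show "\<exists>y\<in>carrier ?G. y \<otimes>\<^bsub>?G\<^esub> x = \<one>\<^bsub>?G\<^esub>"
      using x y(1) by (intro bexI[of _ y]) (simp_all add: coded_mult_group_name one)
  qed (use e unit in \<open>simp_all add: one coded_mult_group_name code_add\<close>)
  moreover have "linear_order_on (carrier ?G) ?r"
  proof -
    have "?r \<subseteq> ?U \<times> ?U" unfolding coded_order_group_name by blast
    moreover have "refl_on ?U ?r"
      using Z(1) FS unfolding coded_order_group_name refl_on_def by simp
    moreover have "trans ?r" unfolding coded_order_group_name by (rule transI) (use Z(2) in blast)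
    moreover have "antisym ?r"
      unfolding coded_order_group_name by (rule antisymI) (use Z(3) inj in blast)
    moreover have "total_on ?U ?r"
      using Z(4) FS unfolding coded_order_group_name total_on_def by simp
    ultimately show ?thesis unfolding order_on_defs by simp
  qed
  moreover have "(a \<otimes>\<^bsub>?G\<^esub> g, b \<otimes>\<^bsub>?G\<^esub> g) \<in> ?r \<and> (g \<otimes>\<^bsub>?G\<^esub> a, g \<otimes>\<^bsub>?G\<^esub> b) \<in> ?r"
    if "a \<in> carrier ?G" "b \<in> carrier ?G" "g \<in> carrier ?G" "(a, b) \<in> ?r" for a b g
  proof -
    have U: "a \<in> ?U" "b \<in> ?U" "g \<in> ?U" and ab: "(coef a, coef b) \<in> Z_pow ?K"
      using that unfolding coded_order_group_name by auto
    from Z_pow_add[OF ab FS[OF U(3)]] show ?thesis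
      using U unfolding coded_order_group_name by (simp add: coded_mult_group_name code_add[of _ p] add.commute)
  qed
  ultimately show ?thesis unfolding ordered_group_def by blast
qed

lemma order_isomorphic_group_name:
  "order_isomorphic (coded_order (group_name p)) (Z_pow (kb_order p))"
proof -
  have lin: "linear_order_on (universe p) (coded_order (group_name p))"
    using ordered_group_group_name unfolding ordered_group_def by simp
  have "Field (coded_order (group_name p)) = universe p"
    using linear_order_onD(1,5)[OF lin] by (fastforce simp: Field_def)
  then show ?thesis
    unfolding order_isomorphic_def
    using bij_betw_coef by (intro exI[of _ coef]) (simp add: coded_order_group_name)
qed

section \<open>Computability of the group, and the reduction from trees\<close>

lemma comp_pred_comp_pair:
  assumes "comp_pred (\<lambda>p k. P p (pfst k) (psnd k))" "comp_fun a" "comp_fun b" shows "comp_pred (\<lambda>p n. P p (a p n) (b p n))"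
proof -
  have "comp_fun (\<lambda>p n. prod_encode (a p n, b p n))" using assms(2,3) by (intro comp_fun_intros)
  from comp_pred_comp[OF assms(1) this] show ?thesis by simp
qed

lemma comp_pred_coef_eq_0 [comp_fun_intros]: "comp_fun a \<Longrightarrow> comp_fun b \<Longrightarrow> comp_pred (\<lambda>p n. coef (a p n) (b p n) = 0)"
  unfolding coef_def by (simp only: right_minus_eq of_nat_eq_iff) (intro comp_fun_intros)

text \<open>Integers are differences of naturals; moving the negative parts across turns comparisons
  into arithmetic on naturals, for which computability rules are at hand.\<close>

lemma coef_compare:
  "coef a i = coef b j \<longleftrightarrow> pfst (lnth a i) + psnd (lnth b j) = pfst (lnth b j) + psnd (lnth a i)"
  "coef a i < coef b j \<longleftrightarrow> pfst (lnth a i) + psnd (lnth b j) < pfst (lnth b j) + psnd (lnth a i)"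
  "coef c k = coef a i + coef b j \<longleftrightarrow>
     pfst (lnth c k) + (psnd (lnth a i) + psnd (lnth b j)) = pfst (lnth a i) + pfst (lnth b j) + psnd (lnth c k)"
  unfolding coef_def by linarith+

lemma computable_group_name: "computable (\<lambda>p. Some (group_name p))"
proof (rule computable_cf)
  have U: "comp_pred (\<lambda>p n. n \<in> universe p)"
    unfolding universe_def mem_Collect_eq coef_compare(1) by (intro comp_fun_intros)
  have "comp_pred (\<lambda>p k. kb_lt (pfst k) (psnd k))"
    unfolding kb_lt_def entry_lt_def entry_def by (intro comp_fun_intros)
  note kb = comp_pred_comp_pair[OF this]
  have le: "comp_pred (\<lambda>p k. code_le (pfst k) (psnd k))"
    unfolding code_le_def coef_compare(1,2) by (intro comp_fun_intros kb)
  have add: "comp_fun (\<lambda>p n. code_add (pfst n) (psnd n))"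
    unfolding code_add_def
  proof (rule comp_fun_Least)
    show "comp_pred (\<lambda>p k. \<forall>i<pfst (pfst k) + psnd (pfst k) + psnd k.
        coef (psnd k) i = coef (pfst (pfst k)) i + coef (psnd (pfst k)) i)"
      unfolding coef_compare(3) by (intro comp_fun_intros)
    fix n
    have "finite {i. coef (pfst n) i + coef (psnd n) i \<noteq> 0}"
      by (rule finite_subset[of _ "{i. coef (pfst n) i \<noteq> 0} \<union> {i. coef (psnd n) i \<noteq> 0}"])
        (auto simp: finite_coef)
    from coef_surj[OF this] show "\<exists>c. \<forall>i<pfst n + psnd n + c. coef c i = coef (pfst n) i + coef (psnd n) i"
      by metis
  qed
  \<comment> \<open>Division by 3 is obtained by search.\<close>
  have "(LEAST m. n < 3 * m + 3) = n div 3" for n :: nat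
    by (rule Least_equality) linarith+
  moreover have "comp_fun (\<lambda>p n. LEAST m. n < 3 * m + 3)"
  proof (rule comp_fun_Least)
    show "comp_pred (\<lambda>p k. pfst k < 3 * psnd k + 3)" by (intro comp_fun_intros)
    show "\<exists>m. n < 3 * m + 3" for n :: nat by (rule exI[of _ n]) simp
  qed
  ultimately have div: "comp_fun (\<lambda>p n. n div 3)" by simp
  have "comp_fun (\<lambda>p n. of_bool (n div 3 \<in> universe p))"
    using comp_pred_comp[OF U div] unfolding comp_pred_def .
  moreover have "comp_fun (\<lambda>p n. of_bool (code_le (pfst (n div 3)) (psnd (n div 3))))"
    using comp_pred_comp[OF le div] unfolding comp_pred_def .
  moreover have "comp_pred (\<lambda>p n. n = 3 * (n div 3))" "comp_pred (\<lambda>p n. n = 3 * (n div 3) + 1)"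
    by (intro comp_fun_intros div)+
  ultimately show "comp_fun group_name"
    unfolding group_name_def Let_def using comp_fun_comp[OF add div] by (intro comp_fun_if)
qed

text \<open>The dense set is the copy of the rationals over the zero function.\<close>

lemma dense_Z_pow_Q:
  fixes \<alpha> :: "'a rel"
  obtains D where "D \<subseteq> Field (order_prod (Z_pow \<alpha>) Q_order)" "dense_set (order_prod (Z_pow \<alpha>) Q_order) D"
proof -
  let ?z = "\<lambda>_ :: 'a. 0 :: int" and ?r = "order_prod (Z_pow \<alpha>) Q_order"
  have z: "?z \<in> fin_supp \<alpha>" unfolding fin_supp_def by simp
  then have zz: "(?z, ?z) \<in> Z_pow \<alpha>" unfolding Z_pow_def by simp
  have Q: "(a, b) \<in> Q_order \<longleftrightarrow> a \<le> b" for a b unfolding Q_order_def by simp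
  have iff: "((?z, a), (?z, b)) \<in> ?r \<longleftrightarrow> a \<le> b" for a b
    using z zz unfolding order_prod_def by (auto simp: Q)
  have "dense_set ?r (range (Pair ?z))"
    unfolding dense_set_def
  proof (intro conjI ballI impI)
    have "(?z, 0 :: rat) \<noteq> (?z, 1)" by simp
    then show "\<exists>x\<in>range (Pair ?z). \<exists>y\<in>range (Pair ?z). x \<noteq> (y :: _ \<times> rat)" by blast
  next
    fix x y assume "x \<in> range (Pair ?z)" "y \<in> range (Pair ?z)" "(x, y) \<in> ?r \<and> x \<noteq> y"
    then obtain a b where ab: "x = (?z, a)" "y = (?z, b)" "a < b" using iff by (auto simp: less_le)
    then obtain c where "a < c" "c < b" using dense by blast
    then show "\<exists>z\<in>range (Pair ?z). (x, z) \<in> ?r \<and> x \<noteq> z \<and> (z, y) \<in> ?r \<and> z \<noteq> y"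
      using iff ab by (intro bexI[of _ "(?z, c)"]) auto
  qed
  moreover have "range (Pair ?z) \<subseteq> Field ?r"
  proof
    fix x :: "('a \<Rightarrow> int) \<times> rat" assume "x \<in> range (Pair ?z)"
    then have "(x, x) \<in> ?r" using iff by auto
    then show "x \<in> Field ?r" by (rule FieldI1)
  qed
  ultimately show thesis using that by blast
qed

text \<open>A solution may come with any well-order \<alpha>, so it is tested by the presence of a
  dense subset, carried along the isomorphisms: a wrong answer would put a dense set into
  \<open>Z_pow\<close> of a well-order, the Kleene-Brouwer order in one case and \<alpha> in the
  other.\<close>

lemma WF_le_OG_eps: "WF \<le>\<^sub>W OG_eps"
proof (rule weihrauch_le_bitI[OF computable_group_name])
  show "outrep WF = bit_rep" "outrep OG_eps = bit_rep" by (simp_all add: OG_eps_def WF_def)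
  fix p T Y assume pT: "inrep WF p = Some T" "mvf WF T = Some Y"
  then have T: "T = {\<sigma>. p (list_encode \<sigma>) \<noteq> 0}" "tree T"
    unfolding WF_def tree_rep_def by (auto simp: Let_def split: if_splits)
  have Y: "Y = {if well_founded_tree T then 0 else 1}" using pT(2) T(2) by (simp add: WF_def)
  let ?G = "coded_group (group_name p)" and ?r = "coded_order (group_name p)" and ?K = "kb_order p"
  note og = ordered_group_group_name[of p]
  note iso = order_isomorphic_group_name[of p]
  have "v \<in> Y" if v: "v \<in> {0, 1}" "Well_order \<alpha>" "has_order_type_ZQ ?r \<alpha> v" for v and \<alpha> :: "nat rel"
  proof (cases "well_founded_tree T")
    case True
    have "v \<noteq> 1"
    proof
      assume "v = 1"
      then have "order_isomorphic (order_prod (Z_pow \<alpha>) Q_order) ?r"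
        using v(3) order_isomorphic_sym unfolding has_order_type_ZQ_def by auto
      then obtain E where E: "E \<subseteq> Field ?r" "dense_set ?r E"
        using order_isomorphic_dense dense_Z_pow_Q by metis
      from order_isomorphic_dense[OF iso E(2,1)] obtain D where
        "D \<subseteq> fin_supp ?K" "dense_set (Z_pow ?K) D" by auto
      moreover have "Well_order ?K" using Well_order_kb_order T True by blast
      ultimately show False using Z_pow_scattered unfolding scattered_def by blast
    qed
    then show ?thesis using v(1) True Y by simp
  next
    case False
    have "v \<noteq> 0"
    proof
      assume "v = 0"
      then have iso': "order_isomorphic ?r (Z_pow \<alpha>)" using v(3) unfolding has_order_type_ZQ_def by auto
      obtain D where D: "D \<subseteq> fin_supp ?K" "dense_set (Z_pow ?K) D"
        using dense_Z_pow_kb_order False T(1) by blast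
      obtain E where E: "E \<subseteq> Field ?r" "dense_set ?r E"
        using order_isomorphic_dense[OF order_isomorphic_sym[OF iso] D(2)] D(1) by auto
      from order_isomorphic_dense[OF iso' E(2,1)] show False
        using Z_pow_scattered[OF v(2)] unfolding scattered_def by auto
    qed
    then show ?thesis using v(1) False Y by simp
  qed
  then show "\<exists>z V. inrep OG_eps (group_name p) = Some z \<and> mvf OG_eps z = Some V \<and>
      (\<forall>v\<in>V. v \<in> {0, 1} \<longrightarrow> v \<in> Y)"
    using og by (auto simp: OG_eps_def og_rep_def)
qed

theorem proposition2p13:
  shows "OG_eps \<equiv>\<^sub>W WF"
  unfolding weihrauch_equiv_def using OG_eps_le_WF WF_le_OG_eps by blast

end
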